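(* Let $\tau, \omega > 0$ and let $T = \chi_{(-\tau,\tau)} + S_\omega$, a bounded operator on $L^2(\mathbb{R})$. Then the spectrum $\sigma(T)$ consists exactly of the numbers $1 \pm \sqrt{\lambda_n(\omega\tau)}$, $n = 0, 1, 2, \dots$, each of which is an eigenvalue of $T$, together with the two additional points $0$ and $1$; that is, $$\sigma(T) = \{0, 1\} \cup \left\{ 1 + \sqrt{\lambda_n(\omega\tau)} : n \geq 0 \right\} \cup \left\{ 1 - \sqrt{\lambda_n(\omega\tau)} : n \geq 0 \right\}.$$
   Context: $L^2(\mathbb{R})$ is the complex Hilbert space of square-integrable functions, and $\sigma(T)$ denotes the spectrum of a bounded operator $T$. For $\tau > 0$, $\chi_{(-\tau,\tau)}$ denotes both the characteristic function of the interval $(-\tau,\tau)$ and the orthogonal projection $f \mapsto \chi_{(-\tau,\tau)} f$ on $L^2(\mathbb{R})$. The Fourier transform $\mathcal{F}$ is the unitary operator on $L^2(\mathbb{R})$ given by $\mathcal{F} f(\xi) = \frac{1}{\sqrt{2\pi}} \lim_{N\to\infty} \int_{-N}^{N} e^{-i x\xi} f(x)\,dx$ (limit in $L^2(\mathbb{R})$). For $\omega > 0$, $S_\omega := \mathcal{F} \chi_{(-\omega,\omega)} \mathcal{F}^*$; it is an orthogonal projection on $L^2(\mathbb{R})$, and $$S_\omega f(x) = \int_{\mathbb{R}} \frac{\sin \omega(x-y)}{\pi(x-y)} f(y)\,dy.$$ For $c > 0$, $\lambda_0(c) > \lambda_1(c) > \dots > 0$ denote the eigenvalues of the integral operator on $L^2(-1,1)$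 with kernel $\frac{\sin c(x-y)}{\pi(x-y)}$, listed in decreasing order; it is known that $0 < \lambda_n(c) < 1$ for all $n$. *)

theory Defs
  imports "HOL-Analysis.Analysis"
begin

section \<open>The Hilbert space \<open>L\<^sup>2(\<real>)\<close>\<close>

definition square_integrable :: "'a measure \<Rightarrow> ('a \<Rightarrow> complex) \<Rightarrow> bool" where
  "square_integrable M f \<longleftrightarrow>
     f \<in> borel_measurable M \<and> integrable M (\<lambda>x. (cmod (f x))\<^sup>2)"

lemma borel_measurable_cnj [measurable (raw)]:
  "f \<in> borel_measurable M \<Longrightarrow> (\<lambda>x. cnj (f x)) \<in> borel_measurable M"
  by (erule measurable_compose)
     (rule borel_measurable_continuous_onI[OF continuous_on_cnj[OF continuous_on_id]])

lemma square_integrable_mult: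
  assumes "square_integrable M f" "square_integrable M g"
  shows "integrable M (\<lambda>x. f x * cnj (g x))"
proof (rule Bochner_Integration.integrable_bound)
  show "integrable M (\<lambda>x. (cmod (f x))\<^sup>2 + (cmod (g x))\<^sup>2)"
    using assms by (auto simp: square_integrable_def)
  show "(\<lambda>x. f x * cnj (g x)) \<in> borel_measurable M"
    using assms by (auto simp: square_integrable_def)
  have "cmod a * cmod b \<le> (cmod a)\<^sup>2 + (cmod b)\<^sup>2" for a b
    using sum_squares_bound[of "cmod a" "cmod b"]
      mult_nonneg_nonneg[OF norm_ge_zero[of a] norm_ge_zero[of b]]
    by linarith
  then show "AE x in M. norm (f x * cnj (g x)) \<le> norm ((cmod (f x))\<^sup>2 + (cmod (g x))\<^sup>2)"
    by (auto simp: norm_mult)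
qed

lemma square_integrable_cmult:
  assumes "square_integrable M f"
  shows "square_integrable M (\<lambda>x. c * f x)"
  using assms by (auto simp: square_integrable_def norm_mult power_mult_distrib)

lemma square_integrable_add:
  assumes "square_integrable M f" "square_integrable M g"
  shows "square_integrable M (\<lambda>x. f x + g x)"
  unfolding square_integrable_def
proof
  show m: "(\<lambda>x. f x + g x) \<in> borel_measurable M"
    using assms by (auto simp: square_integrable_def)
  show "integrable M (\<lambda>x. (cmod (f x + g x))\<^sup>2)"
  proof (rule Bochner_Integration.integrable_bound)
    show "integrable M (\<lambda>x. 2 * (cmod (f x))\<^sup>2 + 2 * (cmod (g x))\<^sup>2)"
      using assms by (auto simp: square_integrable_def)
    show "(\<lambda>x. (cmod (f x + g x))\<^sup>2) \<in> borel_measurable M"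
      using m by auto
    have "(cmod (a + b))\<^sup>2 \<le> 2 * (cmod a)\<^sup>2 + 2 * (cmod b)\<^sup>2" for a b
    proof -
      have "(cmod (a + b))\<^sup>2 \<le> (cmod a + cmod b)\<^sup>2"
        by (simp add: norm_triangle_ineq power_mono)
      also have "\<dots> \<le> 2 * (cmod a)\<^sup>2 + 2 * (cmod b)\<^sup>2"
        using sum_squares_bound[of "cmod a" "cmod b"] by (simp add: power2_sum)
      finally show ?thesis .
    qed
    then show "AE x in M. norm ((cmod (f x + g x))\<^sup>2)
        \<le> norm (2 * (cmod (f x))\<^sup>2 + 2 * (cmod (g x))\<^sup>2)"
      by auto
  qed
qed

quotient_type l2 = "real \<Rightarrow> complex" / partial:
  "\<lambda>f g. square_integrable lborel f \<and> square_integrable lborel g \<and> (AE x in lborel. f x = g x)"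
  morphisms rep_l2 abs_l2
proof (rule part_equivpI)
  show "\<exists>f. square_integrable lborel f \<and> square_integrable lborel f \<and> (AE x in lborel. f x = f x)"
    by (rule exI[of _ "\<lambda>_. 0"]) (simp add: square_integrable_def)
qed (auto intro!: sympI transpI)

instantiation l2 :: ab_group_add
begin

lift_definition zero_l2 :: l2 is "\<lambda>_. 0"
  by (simp add: square_integrable_def)

lift_definition plus_l2 :: "l2 \<Rightarrow> l2 \<Rightarrow> l2" is "\<lambda>f g x. f x + g x"
  by (auto intro: square_integrable_add)

lift_definition uminus_l2 :: "l2 \<Rightarrow> l2" is "\<lambda>f x. - f x"
  by (auto simp: square_integrable_def)

definition minus_l2 :: "l2 \<Rightarrow> l2 \<Rightarrow> l2" where
  "minus_l2 f g = f + (- g)"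

instance
proof
  fix a b c :: l2
  show "a + b + c = a + (b + c)"
    by transfer (auto intro!: square_integrable_add simp: add.assoc)
  show "a + b = b + a"
    by transfer (auto intro!: square_integrable_add simp: add.commute)
  show "0 + a = a"
    by transfer auto
  show "- a + a = 0"
    by transfer (auto simp: square_integrable_def)
  show "a - b = a + - b"
    by (simp add: minus_l2_def)
qed

end

lift_definition scaleC_l2 :: "complex \<Rightarrow> l2 \<Rightarrow> l2" (infixr "*\<^sub>C" 75) is "\<lambda>c f x. c * f x"
  by (auto intro: square_integrable_cmult)

lift_definition cinner_l2 :: "l2 \<Rightarrow> l2 \<Rightarrow> complex" is "\<lambda>f g. (LINT x|lborel. f x * cnj (g x))"
  by (rule integral_cong_AE) (auto simp: square_integrable_def)

text \<open>
  The real inner product underlying the complex one induces the usual norm and topology of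
  \<open>L\<^sup>2(\<real>)\<close>.
\<close>

instantiation l2 :: real_inner
begin

definition scaleR_l2 :: "real \<Rightarrow> l2 \<Rightarrow> l2" where
  "scaleR_l2 r f = complex_of_real r *\<^sub>C f"

definition inner_l2 :: "l2 \<Rightarrow> l2 \<Rightarrow> real" where
  "inner_l2 f g = Re (cinner_l2 f g)"

definition norm_l2 :: "l2 \<Rightarrow> real" where
  "norm_l2 f = sqrt (inner f f)"

definition dist_l2 :: "l2 \<Rightarrow> l2 \<Rightarrow> real" where
  "dist_l2 f g = norm (f - g)"

definition sgn_l2 :: "l2 \<Rightarrow> l2" where
  "sgn_l2 f = inverse (norm f) *\<^sub>R f"

definition uniformity_l2 :: "(l2 \<times> l2) filter" where
  "uniformity_l2 = (INF e\<in>{0<..}. principal {(f, g). dist f g < e})"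

definition open_l2 :: "l2 set \<Rightarrow> bool" where
  "open_l2 U \<longleftrightarrow> (\<forall>f\<in>U. eventually (\<lambda>(f', g). f' = f \<longrightarrow> g \<in> U) uniformity)"

instance
proof
  fix a b c :: l2 and r s :: real
  show "r *\<^sub>R (a + b) = r *\<^sub>R a + r *\<^sub>R b"
    unfolding scaleR_l2_def
    by transfer (auto intro!: square_integrable_add square_integrable_cmult simp: ring_distribs)
  show "(r + s) *\<^sub>R a = r *\<^sub>R a + s *\<^sub>R a"
    unfolding scaleR_l2_def
    by transfer
       (auto intro!: square_integrable_add square_integrable_cmult
             simp: ring_distribs)
  show "r *\<^sub>R s *\<^sub>R a = (r * s) *\<^sub>R a"
    unfolding scaleR_l2_def
    by transfer
       (auto intro!: square_integrable_cmult simp: mult.assoc)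
  show "1 *\<^sub>R a = a"
    unfolding scaleR_l2_def by transfer auto
  show "inner a b = inner b a"
  proof -
    have "cinner_l2 b a = cnj (cinner_l2 a b)"
      by transfer
         (simp only: Bochner_Integration.integral_cnj[symmetric] complex_cnj_mult
            complex_cnj_cnj mult.commute)
    then show ?thesis
      by (simp add: inner_l2_def)
  qed
  show "inner (a + b) c = inner a c + inner b c"
  proof -
    have "cinner_l2 (a + b) c = cinner_l2 a c + cinner_l2 b c"
      by transfer (simp add: ring_distribs square_integrable_mult)
    then show ?thesis
      by (simp add: inner_l2_def)
  qed
  show "inner (r *\<^sub>R a) b = r * inner a b"
  proof -
    have "cinner_l2 (complex_of_real r *\<^sub>C a) b = complex_of_real r * cinner_l2 a b"
      by transfer (simp add: mult.assoc)
    then show ?thesis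
      by (simp add: inner_l2_def scaleR_l2_def)
  qed
  have sq: "inner a a = (LINT x|lborel. (cmod (rep_l2 a x))\<^sup>2)" for a
  proof -
    have "cinner_l2 a a = complex_of_real (LINT x|lborel. (cmod (rep_l2 a x))\<^sup>2)"
      unfolding cinner_l2.rep_eq complex_norm_square[symmetric]
      by (rule integral_complex_of_real)
    then show ?thesis
      by (simp add: inner_l2_def)
  qed
  show "0 \<le> inner a a"
    by (simp add: sq)
  show "inner a a = 0 \<longleftrightarrow> a = 0"
  proof -
    have rep: "square_integrable lborel (rep_l2 a)"
      using Quotient_l2 by (metis (no_types, lifting) Quotient_rep_reflp)
    then have "inner a a = 0 \<longleftrightarrow> (AE x in lborel. (cmod (rep_l2 a x))\<^sup>2 = 0)"
      unfolding sq by (intro integral_nonneg_eq_0_iff_AE) (auto simp: square_integrable_def)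
    also have "\<dots> \<longleftrightarrow> abs_l2 (rep_l2 a) = abs_l2 (\<lambda>_. 0)"
      using rep Quotient_rel[OF Quotient_l2, of "rep_l2 a" "\<lambda>_. 0"]
      by (auto simp: square_integrable_def)
    also have "\<dots> \<longleftrightarrow> a = 0"
      by (simp add: zero_l2_def Quotient_abs_rep[OF Quotient_l2])
    finally show ?thesis .
  qed
qed (simp_all add: norm_l2_def dist_l2_def sgn_l2_def uniformity_l2_def open_l2_def)

end

section \<open>Operators and spectra\<close>

definition bounded_clinear_l2 :: "(l2 \<Rightarrow> l2) \<Rightarrow> bool" where
  "bounded_clinear_l2 A \<longleftrightarrow> bounded_linear A \<and> (\<forall>c f. A (c *\<^sub>C f) = c *\<^sub>C A f)"

definition hilbert_adjoint :: "(l2 \<Rightarrow> l2) \<Rightarrow> (l2 \<Rightarrow> l2)" where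
  "hilbert_adjoint A = (THE B. \<forall>f g. cinner_l2 (A f) g = cinner_l2 f (B g))"

definition l2_spectrum :: "(l2 \<Rightarrow> l2) \<Rightarrow> complex set" where
  "l2_spectrum A = {z. \<not> (\<exists>B. bounded_clinear_l2 B \<and>
     (\<forall>f. B (A f - z *\<^sub>C f) = f) \<and> (\<forall>f. A (B f) - z *\<^sub>C B f = f))}"

definition l2_eigenvalue :: "(l2 \<Rightarrow> l2) \<Rightarrow> complex \<Rightarrow> bool" where
  "l2_eigenvalue A z \<longleftrightarrow> (\<exists>f. f \<noteq> 0 \<and> A f = z *\<^sub>C f)"

section \<open>Time and band limiting\<close>

text \<open>Multiplication by the characteristic function of \<open>(-\<tau>, \<tau>)\<close>.\<close>

lift_definition time_limit :: "real \<Rightarrow> l2 \<Rightarrow> l2" is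
  "\<lambda>\<tau> f x. indicator {-\<tau><..<\<tau>} x * f x"
proof -
  fix \<tau> :: real and f g :: "real \<Rightarrow> complex"
  have "square_integrable lborel (\<lambda>x. indicator {-\<tau><..<\<tau>} x * h x)"
    if "square_integrable lborel h" for h :: "real \<Rightarrow> complex"
    unfolding square_integrable_def
  proof
    show "(\<lambda>x. indicator {-\<tau><..<\<tau>} x * h x) \<in> borel_measurable lborel"
      using that by (auto simp: square_integrable_def)
    show "integrable lborel (\<lambda>x. (cmod (indicator {-\<tau><..<\<tau>} x * h x))\<^sup>2)"
      by (rule Bochner_Integration.integrable_bound[of _ "\<lambda>x. (cmod (h x))\<^sup>2"])
         (use that in \<open>auto simp: square_integrable_def indicator_def\<close>)
  qed
  then show "square_integrable lborel f \<and> square_integrable lborel g \<and> (AE x in lborel. f x = g x) \<Longrightarrow>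
    square_integrable lborel (\<lambda>x. indicator {-\<tau><..<\<tau>} x * f x) \<and>
    square_integrable lborel (\<lambda>x. indicator {-\<tau><..<\<tau>} x * g x) \<and>
    (AE x in lborel. indicator {-\<tau><..<\<tau>} x * f x = indicator {-\<tau><..<\<tau>} x * g x)"
    by auto
qed

lift_definition truncated_fourier :: "real \<Rightarrow> l2 \<Rightarrow> real \<Rightarrow> complex" is
  "\<lambda>N f \<xi>. complex_of_real (1 / sqrt (2 * pi)) *
     (LINT x:{-N..N}|lborel. exp (- (\<i> * complex_of_real (x * \<xi>))) * f x)"
proof -
  fix N :: real and f g :: "real \<Rightarrow> complex"
  assume "square_integrable lborel f \<and> square_integrable lborel g \<and> (AE x in lborel. f x = g x)"
  then have "(LINT x:{-N..N}|lborel. exp (- (\<i> * complex_of_real (x * \<xi>))) * f x) =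
    (LINT x:{-N..N}|lborel. exp (- (\<i> * complex_of_real (x * \<xi>))) * g x)" for \<xi>
    unfolding set_lebesgue_integral_def
    by (intro integral_cong_AE) (auto simp: square_integrable_def)
  then show "(\<lambda>\<xi>. complex_of_real (1 / sqrt (2 * pi)) *
      (LINT x:{-N..N}|lborel. exp (- (\<i> * complex_of_real (x * \<xi>))) * f x)) =
    (\<lambda>\<xi>. complex_of_real (1 / sqrt (2 * pi)) *
      (LINT x:{-N..N}|lborel. exp (- (\<i> * complex_of_real (x * \<xi>))) * g x))"
    by simp
qed

text \<open>The limit is taken in the norm topology of \<open>l2\<close>.\<close>

definition fourier_l2 :: "l2 \<Rightarrow> l2" where
  "fourier_l2 f = Lim at_top (\<lambda>N::real. abs_l2 (truncated_fourier N f))"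

definition band_limit :: "real \<Rightarrow> l2 \<Rightarrow> l2" where
  "band_limit \<omega> = fourier_l2 \<circ> time_limit \<omega> \<circ> hilbert_adjoint fourier_l2"

section \<open>The eigenvalues of the sinc kernel operator on \<open>L\<^sup>2(-1, 1)\<close>\<close>

definition sinc_kernel :: "real \<Rightarrow> real \<Rightarrow> real \<Rightarrow> real" where
  "sinc_kernel c x y = (if x = y then c / pi else sin (c * (x - y)) / (pi * (x - y)))"

text \<open>
  Elements of \<open>L\<^sup>2(-1, 1)\<close> are represented by square integrable functions for Lebesgue measure
  on \<open>(-1, 1)\<close>, equality being equality almost everywhere.
\<close>

definition sinc_eigenvalue :: "real \<Rightarrow> complex \<Rightarrow> bool" where
  "sinc_eigenvalue c z \<longleftrightarrow>
     (let M = restrict_space lborel {-1<..<1::real} in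
      \<exists>f. square_integrable M f \<and> \<not> (AE x in M. f x = 0) \<and>
        (AE x in M. (LINT y|M. complex_of_real (sinc_kernel c x y) * f y) = z * f x))"

text \<open>
  All eigenvalues are simple, so listing them in decreasing order gives a strictly decreasing
  sequence, which is determined by the set of eigenvalues.
\<close>

definition sinc_eigenvalue_seq :: "real \<Rightarrow> nat \<Rightarrow> real" where
  "sinc_eigenvalue_seq c =
     (THE l. (\<forall>m n. m < n \<longrightarrow> l n < l m) \<and>
             range (\<lambda>n. complex_of_real (l n)) = {z. sinc_eigenvalue c z})"

end

theory Submission
  imports Defs "HOL-Probability.Levy" "HOL-Complex_Analysis.Great_Picard"
begin

text \<open>
  Write \<open>P\<close> for time limiting to \<open>(-\<tau>, \<tau>)\<close> and \<open>Q\<close> for band limiting to \<open>(-\<omega>, \<omega>)\<close>. Both are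
  orthogonal projections, and the spectrum of \<open>T = P + Q\<close> can be read off from the operator \<open>P Q\<close>
  on the range of \<open>P\<close>. If \<open>T u = z u\<close> with \<open>z \<noteq> 0, 1\<close>, then \<open>a = P u\<close> and \<open>b = Q u\<close> satisfy
  \<open>P b = (z - 1) a\<close> and \<open>Q a = (z - 1) b\<close>, so \<open>P Q a = (z - 1)\<^sup>2 a\<close>
  (\<open>eigenvalue_T_only_if\<close>); conversely, \<open>P Q a = l a\<close> and \<open>w\<^sup>2 = l\<close> make \<open>a + Q a / w\<close> an
  eigenvector of \<open>T\<close> for \<open>1 + w\<close> (\<open>eigenvalue_T_if\<close>). In the coordinates
  \<open>x = \<tau> x'\<close> the operator \<open>P Q\<close> on the range of \<open>P\<close> is the integral operator with the sinc kernel of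
  parameter \<open>\<omega> \<tau>\<close> on \<open>(-1, 1)\<close> (\<open>band_limit_kernel\<close>, \<open>sinc_eigenvalue_iff_compression\<close>).

  The operator \<open>P Q\<close> is compact, because band limited functions of bounded norm are uniformly
  Lipschitz (\<open>time_limit_band_limit_compact\<close>). Hence every point of the spectrum of \<open>T\<close> other than
  \<open>0\<close> and \<open>1\<close> is an eigenvalue (\<open>not_in_spectrum_T\<close>): approximate eigenvectors have a convergent
  subsequence, and an operator that is bounded below and has an injective adjoint is onto. The points \<open>0\<close> and \<open>1\<close>
  have approximate eigenvectors given by functions that oscillate faster and faster
  (\<open>tendsto_fourier_modulated\<close>).

  The eigenvalues of \<open>P Q\<close> on the range of \<open>P\<close> lie strictly between \<open>0\<close> and \<open>1\<close>, because the Fourier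
  transform of a function of bounded support is entire, so unless it is zero it can vanish neither
  inside nor outside the band (\<open>truncated_fourier_unique_continuation\<close>). They accumulate only at \<open>0\<close> by compactness, and
  there are infinitely many of them (\<open>infinite_eigenvalues\<close>): otherwise a product of factors
  \<open>P Q - m\<close> with \<open>m \<noteq> 0\<close> would annihilate the range of \<open>P\<close>, making \<open>P Q\<close> bounded below there, which the
  oscillating functions refute. An infinite set of positive numbers that accumulates only at \<open>0\<close> has
  exactly one strictly decreasing enumeration, and this is the sequence \<open>sinc_eigenvalue_seq\<close>.

  All of this needs \<open>L\<^sup>2\<close> to be complete, which is the Riesz-Fischer theorem, and the Fourier
  transform to be an isometry with a computable adjoint. Parseval's identity for indicators of intervals
  is an instance of Levy's inversion formula for uniform distributions (\<open>interval_parseval\<close>);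
  density of the step functions extends it to Plancherel's theorem (\<open>plancherel\<close>), and Fubini's
  theorem identifies the adjoint (\<open>cinner_fourier_adjoint\<close>).
\<close>

section \<open>Square integrable functions and their classes\<close>

abbreviation sqint :: "(real \<Rightarrow> complex) \<Rightarrow> bool" where
  "sqint \<equiv> square_integrable lborel"

lemma sqint_measurable: "sqint f \<Longrightarrow> f \<in> borel_measurable borel"
  by (simp add: square_integrable_def)

lemma sqint_integrable: "sqint f \<Longrightarrow> integrable lborel (\<lambda>x. (cmod (f x))\<^sup>2)"
  by (simp add: square_integrable_def)

lemma sqint_rep [simp]: "sqint (rep_l2 u)"
  using Quotient_l2 by (metis (no_types, lifting) Quotient_rep_reflp)

lemma rep_l2_measurable [measurable]: "rep_l2 u \<in> borel_measurable borel"
  by (rule sqint_measurable[OF sqint_rep])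

lemma abs_rep_l2 [simp]: "abs_l2 (rep_l2 u) = u"
  by (rule Quotient_abs_rep[OF Quotient_l2])

lemma abs_l2_eq_iff:
  "sqint f \<Longrightarrow> sqint g \<Longrightarrow> abs_l2 f = abs_l2 g \<longleftrightarrow> (AE x in lborel. f x = g x)"
  using Quotient_rel[OF Quotient_l2, of f g] by auto

lemma abs_l2_cong:
  "sqint f \<Longrightarrow> g \<in> borel_measurable borel \<Longrightarrow> AE x in lborel. f x = g x \<Longrightarrow> abs_l2 f = abs_l2 g"
proof -
  assume f: "sqint f" and g [measurable]: "g \<in> borel_measurable borel"
    and ae: "AE x in lborel. f x = g x"
  have [measurable]: "f \<in> borel_measurable borel" using f by (rule sqint_measurable)
  have "integrable lborel (\<lambda>x. (cmod (g x))\<^sup>2)"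
    using sqint_integrable[OF f] by (rule integrable_cong_AE_imp) (use ae in auto)
  then have "sqint g" by (simp add: square_integrable_def g)
  then show ?thesis using f ae by (simp add: abs_l2_eq_iff)
qed

lemma l2_cases: obtains f where "sqint f" "u = abs_l2 f"
  by (metis sqint_rep abs_rep_l2)

lemma sqint_zero [simp]: "sqint (\<lambda>_. 0)"
  by (simp add: square_integrable_def)

lemma sqint_uminus: "sqint f \<Longrightarrow> sqint (\<lambda>x. - f x)"
  by (simp add: square_integrable_def)

lemma sqint_diff: "sqint f \<Longrightarrow> sqint g \<Longrightarrow> sqint (\<lambda>x. f x - g x)"
  using square_integrable_add[of lborel f "\<lambda>x. - g x"] sqint_uminus[of g] by simp

lemma sqint_cnj: "sqint f \<Longrightarrow> sqint (\<lambda>x. cnj (f x))"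
  by (simp add: square_integrable_def borel_measurable_cnj)

lemma sqint_bound:
  assumes "sqint g" "f \<in> borel_measurable borel" "AE x in lborel. cmod (f x) \<le> cmod (g x)"
  shows "sqint f"
  unfolding square_integrable_def
proof
  show "f \<in> borel_measurable lborel" using assms by simp
  show "integrable lborel (\<lambda>x. (cmod (f x))\<^sup>2)"
    by (rule Bochner_Integration.integrable_bound[OF sqint_integrable[OF assms(1)]])
       (use assms in \<open>auto intro: power_mono\<close>)
qed

lemma plus_abs_l2: "sqint f \<Longrightarrow> sqint g \<Longrightarrow> abs_l2 f + abs_l2 g = abs_l2 (\<lambda>x. f x + g x)"
  by (simp add: plus_l2.abs_eq)

lemma uminus_abs_l2: "sqint f \<Longrightarrow> - abs_l2 f = abs_l2 (\<lambda>x. - f x)"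
  by (simp add: uminus_l2.abs_eq)

lemma minus_abs_l2: "sqint f \<Longrightarrow> sqint g \<Longrightarrow> abs_l2 f - abs_l2 g = abs_l2 (\<lambda>x. f x - g x)"
  unfolding minus_l2_def by (simp only: uminus_abs_l2 plus_abs_l2 sqint_uminus) simp

lemma scaleC_abs_l2: "sqint f \<Longrightarrow> c *\<^sub>C abs_l2 f = abs_l2 (\<lambda>x. c * f x)"
  by (simp add: scaleC_l2.abs_eq)

lemma cinner_abs_l2:
  "sqint f \<Longrightarrow> sqint g \<Longrightarrow> cinner_l2 (abs_l2 f) (abs_l2 g) = (LINT x|lborel. f x * cnj (g x))"
  by (simp add: cinner_l2.abs_eq)

lemma zero_l2_abs: "0 = abs_l2 (\<lambda>_. 0)"
  by (simp add: zero_l2_def)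

lemma abs_l2_eq_0_iff: "sqint f \<Longrightarrow> abs_l2 f = 0 \<longleftrightarrow> (AE x in lborel. f x = 0)"
  by (simp add: zero_l2_abs abs_l2_eq_iff)

section \<open>Complex linear structure\<close>

lemma scaleC_add_right: "c *\<^sub>C (u + v) = c *\<^sub>C u + c *\<^sub>C (v::l2)"
  by transfer (auto intro!: square_integrable_add square_integrable_cmult simp: ring_distribs)

lemma scaleC_add_left: "(c + d) *\<^sub>C u = c *\<^sub>C u + d *\<^sub>C (u::l2)"
  by transfer (auto intro!: square_integrable_add square_integrable_cmult simp: ring_distribs)

lemma scaleC_scaleC [simp]: "c *\<^sub>C d *\<^sub>C u = (c * d) *\<^sub>C (u::l2)"
  by transfer (auto intro!: square_integrable_cmult simp: mult.assoc)

lemma scaleC_one [simp]: "1 *\<^sub>C u = u"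
  by transfer simp

lemma scaleC_zero_left [simp]: "0 *\<^sub>C u = 0"
  by transfer simp

lemma scaleC_zero_right [simp]: "c *\<^sub>C 0 = 0"
  by transfer simp

lemma scaleC_minus_right: "c *\<^sub>C (- u) = - (c *\<^sub>C u)"
  by transfer (auto intro!: square_integrable_cmult simp: square_integrable_def norm_mult power_mult_distrib)

lemma scaleC_diff_right: "c *\<^sub>C (u - v) = c *\<^sub>C u - c *\<^sub>C v"
  unfolding minus_l2_def scaleC_add_right scaleC_minus_right ..

lemma scaleC_minus_left: "(- c) *\<^sub>C u = - (c *\<^sub>C u)"
  by transfer (auto intro!: square_integrable_cmult simp: square_integrable_def norm_mult power_mult_distrib)

lemma scaleC_diff_left: "(c - d) *\<^sub>C u = c *\<^sub>C u - d *\<^sub>C u"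
  using scaleC_add_left[of c "- d" u] by (simp add: scaleC_minus_left)

lemma scaleC_of_real: "complex_of_real r *\<^sub>C u = r *\<^sub>R u"
  by (simp add: scaleR_l2_def)

lemma cinner_add_left: "cinner_l2 (u + v) w = cinner_l2 u w + cinner_l2 v w"
  by transfer (simp add: ring_distribs square_integrable_mult)

lemma cinner_scaleC_left: "cinner_l2 (c *\<^sub>C u) w = c * cinner_l2 u w"
  by transfer (simp add: mult.assoc)

lemma cinner_cnj: "cinner_l2 v u = cnj (cinner_l2 u v)"
  by transfer
    (simp only: Bochner_Integration.integral_cnj[symmetric] complex_cnj_mult complex_cnj_cnj mult.commute)

lemma cinner_add_right: "cinner_l2 u (v + w) = cinner_l2 u v + cinner_l2 u w"
  by (metis cinner_cnj cinner_add_left complex_cnj_add)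

lemma cinner_scaleC_right: "cinner_l2 u (c *\<^sub>C w) = cnj c * cinner_l2 u w"
  by (metis cinner_cnj cinner_scaleC_left complex_cnj_mult)

lemma cinner_minus_left: "cinner_l2 (- u) w = - cinner_l2 u w"
  using cinner_scaleC_left[of "-1" u w] by (simp add: scaleC_minus_left)

lemma cinner_minus_right: "cinner_l2 u (- w) = - cinner_l2 u w"
  using cinner_scaleC_right[of u "-1" w] by (simp add: scaleC_minus_left)

lemma cinner_diff_left: "cinner_l2 (u - v) w = cinner_l2 u w - cinner_l2 v w"
  by (simp only: minus_l2_def cinner_add_left cinner_minus_left) simp

lemma cinner_diff_right: "cinner_l2 u (v - w) = cinner_l2 u v - cinner_l2 u w"
  by (simp only: minus_l2_def cinner_add_right cinner_minus_right) simp

lemma cinner_self: "cinner_l2 u u = complex_of_real ((norm u)\<^sup>2)"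
proof -
  have "Im (cinner_l2 u u) = 0"
    using cinner_cnj[of u u] by (simp add: complex_eq_iff)
  then show ?thesis
    by (simp add: complex_eq_iff power2_norm_eq_inner inner_l2_def)
qed

lemma norm_scaleC [simp]: "norm (c *\<^sub>C u) = cmod c * norm (u::l2)"
proof -
  have "complex_of_real ((norm (c *\<^sub>C u))\<^sup>2) = complex_of_real ((cmod c * norm u)\<^sup>2)"
    unfolding cinner_self[symmetric] cinner_scaleC_left cinner_scaleC_right
    by (simp add: cinner_self power_mult_distrib complex_norm_square mult_ac del: of_real_power)
  then show ?thesis
    by (simp only: of_real_eq_iff) (simp add: power2_eq_iff_nonneg)
qed

lemma scaleC_eq_0_iff [simp]: "c *\<^sub>C u = 0 \<longleftrightarrow> c = 0 \<or> (u::l2) = 0"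
  by (metis mult_eq_0_iff norm_eq_zero norm_scaleC)

lemma cinner_zero_left [simp]: "cinner_l2 0 u = 0"
  using cinner_scaleC_left[of 0 0 u] by simp

lemma cinner_zero_right [simp]: "cinner_l2 u 0 = 0"
  using cinner_scaleC_right[of u 0 0] by simp

lemma cmod_cinner_le: "cmod (cinner_l2 u v) \<le> norm u * norm v"
proof (cases "cinner_l2 u v = 0")
  case False
  define c where "c = cnj (sgn (cinner_l2 u v))"
  have c: "cmod c = 1" using False by (simp add: c_def norm_sgn)
  have "cinner_l2 (c *\<^sub>C u) v = complex_of_real (cmod (cinner_l2 u v))"
    using False
    by (simp add: cinner_scaleC_left c_def sgn_eq complex_norm_square[symmetric] power2_eq_square
        mult.commute[of "cnj _"])
  then have "cmod (cinner_l2 u v) = inner (c *\<^sub>C u) v"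
    by (simp add: inner_l2_def)
  also have "\<dots> \<le> norm (c *\<^sub>C u) * norm v" by (rule norm_cauchy_schwarz)
  finally show ?thesis by (simp add: c)
qed simp

lemma bounded_linear_scaleC: "bounded_linear (\<lambda>u::l2. c *\<^sub>C u)"
proof (rule bounded_linear_intro)
  show "c *\<^sub>C (u + v) = c *\<^sub>C u + c *\<^sub>C v" for u v :: l2 by (rule scaleC_add_right)
  show "c *\<^sub>C (r *\<^sub>R u) = r *\<^sub>R c *\<^sub>C u" for r and u :: l2
    by (simp add: scaleC_of_real[symmetric] mult.commute)
  show "norm (c *\<^sub>C u) \<le> norm u * cmod c" for u :: l2 by simp
qed

lemma cinner_eq_inner: "cinner_l2 u v = Complex (inner u v) (inner u (\<i> *\<^sub>C v))"
  by (simp add: complex_eq_iff inner_l2_def cinner_scaleC_right)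

lemma tendsto_cinner:
  assumes "(f \<longlongrightarrow> a) F" "(g \<longlongrightarrow> b) F"
  shows "((\<lambda>x. cinner_l2 (f x) (g x)) \<longlongrightarrow> cinner_l2 a b) F"
proof -
  have "((\<lambda>x. \<i> *\<^sub>C g x) \<longlongrightarrow> \<i> *\<^sub>C b) F"
    using bounded_linear.tendsto[OF bounded_linear_scaleC assms(2)] .
  then show ?thesis
    unfolding cinner_eq_inner using assms by (intro tendsto_Complex tendsto_inner)
qed

lemma cinner_ext: "(\<And>w. cinner_l2 u w = cinner_l2 v w) \<Longrightarrow> u = v"
proof -
  assume a: "\<And>w. cinner_l2 u w = cinner_l2 v w"
  have "cinner_l2 (u - v) (u - v) = 0" unfolding cinner_diff_left using a by simp
  then show "u = v" by (simp add: cinner_self)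
qed

section \<open>Norms as integrals, limits and completeness\<close>

lemma norm_abs_l2_square:
  assumes "sqint f"
  shows "(norm (abs_l2 f))\<^sup>2 = (LINT x|lborel. (cmod (f x))\<^sup>2)"
proof -
  have "complex_of_real ((norm (abs_l2 f))\<^sup>2) = (LINT x|lborel. f x * cnj (f x))"
    using assms by (simp only: cinner_self[symmetric] cinner_abs_l2)
  also have "\<dots> = complex_of_real (LINT x|lborel. (cmod (f x))\<^sup>2)"
    unfolding complex_norm_square[symmetric] by (rule integral_complex_of_real)
  finally show ?thesis by (simp only: of_real_eq_iff)
qed

lemma nn_integral_norm_abs_l2:
  assumes "sqint f"
  shows "(\<integral>\<^sup>+x. ennreal ((cmod (f x))\<^sup>2) \<partial>lborel) = ennreal ((norm (abs_l2 f))\<^sup>2)"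
  unfolding norm_abs_l2_square[OF assms]
  by (rule nn_integral_eq_integral[OF sqint_integrable[OF assms]]) simp

lemma sqint_nn_integralI:
  assumes "f \<in> borel_measurable borel" "0 \<le> C"
    and "(\<integral>\<^sup>+x. ennreal ((cmod (f x))\<^sup>2) \<partial>lborel) \<le> ennreal (C\<^sup>2)"
  shows "sqint f" "norm (abs_l2 f) \<le> C"
proof -
  have "integrable lborel (\<lambda>x. (cmod (f x))\<^sup>2)"
    using assms by (intro integrableI_bounded) (auto simp: less_top[symmetric] top_unique)
  then show f: "sqint f" using assms(1) by (simp add: square_integrable_def)
  show "norm (abs_l2 f) \<le> C"
    using assms(2,3) unfolding nn_integral_norm_abs_l2[OF f]
    by (simp add: ennreal_le_iff)
qed

lemma norm_abs_l2_mono: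
  assumes "sqint g" "f \<in> borel_measurable borel" "AE x in lborel. cmod (f x) \<le> cmod (g x)"
  shows "norm (abs_l2 f) \<le> norm (abs_l2 g)"
proof (rule sqint_nn_integralI(2))
  show "(\<integral>\<^sup>+x. ennreal ((cmod (f x))\<^sup>2) \<partial>lborel) \<le> ennreal ((norm (abs_l2 g))\<^sup>2)"
    unfolding nn_integral_norm_abs_l2[OF assms(1), symmetric]
    by (rule nn_integral_mono_AE) (use assms(3) in \<open>auto intro!: ennreal_leI power_mono\<close>)
qed (use assms in auto)

text \<open>
  A pointwise limit inherits a bound on the \<open>L\<^sup>2\<close> norms by Fatou's lemma. This single fact
  produces square integrability wherever a limit is only known pointwise.
\<close>

lemma sqint_Fatou:
  assumes f: "\<And>n. sqint (f n)" and h [measurable]: "h \<in> borel_measurable borel"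
    and lim: "AE x in lborel. (\<lambda>n. f n x) \<longlonglongrightarrow> h x"
    and C: "\<And>n. norm (abs_l2 (f n)) \<le> C"
  shows "sqint h" "norm (abs_l2 h) \<le> C"
proof -
  have [measurable]: "f n \<in> borel_measurable borel" for n
    by (rule sqint_measurable[OF f])
  have C0: "0 \<le> C" using C[of 0] norm_ge_zero order_trans by blast
  have "(\<integral>\<^sup>+x. ennreal ((cmod (h x))\<^sup>2) \<partial>lborel)
      = (\<integral>\<^sup>+x. liminf (\<lambda>n. ennreal ((cmod (f n x))\<^sup>2)) \<partial>lborel)"
  proof (rule nn_integral_cong_AE, use lim in eventually_elim)
    fix x assume "(\<lambda>n. f n x) \<longlonglongrightarrow> h x"
    then have "(\<lambda>n. ennreal ((cmod (f n x))\<^sup>2)) \<longlonglongrightarrow> ennreal ((cmod (h x))\<^sup>2)"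
      by (intro tendsto_ennrealI tendsto_intros)
    then show "ennreal ((cmod (h x))\<^sup>2) = liminf (\<lambda>n. ennreal ((cmod (f n x))\<^sup>2))"
      using lim_imp_Liminf[OF sequentially_bot] by metis
  qed
  also have "\<dots> \<le> liminf (\<lambda>n. \<integral>\<^sup>+x. ennreal ((cmod (f n x))\<^sup>2) \<partial>lborel)"
    by (rule nn_integral_liminf) auto
  also have "\<dots> \<le> liminf (\<lambda>n. ennreal (C\<^sup>2))"
    unfolding nn_integral_norm_abs_l2[OF f]
    by (intro Liminf_mono always_eventually allI ennreal_leI power_mono C) auto
  also have "\<dots> = ennreal (C\<^sup>2)" by (simp add: Liminf_const)
  finally have le: "(\<integral>\<^sup>+x. ennreal ((cmod (h x))\<^sup>2) \<partial>lborel) \<le> ennreal (C\<^sup>2)" .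
  show "sqint h" "norm (abs_l2 h) \<le> C"
    using sqint_nn_integralI[OF h C0 le] by auto
qed

lemma abs_l2_dominated_convergence:
  fixes f :: "nat \<Rightarrow> real \<Rightarrow> complex"
  assumes f: "\<And>n. f n \<in> borel_measurable borel" and h [measurable]: "h \<in> borel_measurable borel"
    and lim: "AE x in lborel. (\<lambda>n. f n x) \<longlonglongrightarrow> h x"
    and g: "sqint g" and bd: "\<And>n. AE x in lborel. cmod (f n x) \<le> cmod (g x)"
  shows "sqint h" "(\<lambda>n. abs_l2 (f n)) \<longlonglongrightarrow> abs_l2 h"
proof -
  have [measurable]: "f n \<in> borel_measurable borel" "g \<in> borel_measurable borel" for n
    using f sqint_measurable[OF g] by auto
  have sf: "sqint (f n)" for n by (rule sqint_bound[OF g f bd])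
  have bdh: "AE x in lborel. cmod (h x) \<le> cmod (g x)"
    using lim AE_all_countable[THEN iffD2, of "\<lambda>n x. cmod (f n x) \<le> cmod (g x)", OF allI[OF bd]]
  proof eventually_elim
    case (elim x)
    then have "(\<lambda>n. cmod (f n x)) \<longlonglongrightarrow> cmod (h x)" by (intro tendsto_norm) auto
    then show ?case by (rule Lim_bounded[of _ _ 0]) (use elim in auto)
  qed
  show sh: "sqint h" by (rule sqint_bound[OF g h bdh])
  have "(\<lambda>n. LINT x|lborel. (cmod (f n x - h x))\<^sup>2) \<longlonglongrightarrow> integral\<^sup>L lborel (\<lambda>x::real. 0::real)"
  proof (rule integral_dominated_convergence[where w = "\<lambda>x. 4 * (cmod (g x))\<^sup>2"])
    show "integrable lborel (\<lambda>x. 4 * (cmod (g x))\<^sup>2)" using sqint_integrable[OF g] by simp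
    show "AE x in lborel. (\<lambda>n. (cmod (f n x - h x))\<^sup>2) \<longlonglongrightarrow> 0"
      using lim
    proof eventually_elim
      case (elim x)
      then have "(\<lambda>n. (cmod (f n x - h x))\<^sup>2) \<longlonglongrightarrow> (cmod (h x - h x))\<^sup>2"
        by (intro tendsto_intros)
      then show ?case by simp
    qed
    show "AE x in lborel. norm ((cmod (f n x - h x))\<^sup>2) \<le> 4 * (cmod (g x))\<^sup>2" for n
      using bd[of n] bdh
    proof eventually_elim
      case (elim x)
      then have "cmod (f n x - h x) \<le> 2 * cmod (g x)"
        using norm_triangle_ineq4[of "f n x" "h x"] by linarith
      then have "(cmod (f n x - h x))\<^sup>2 \<le> (2 * cmod (g x))\<^sup>2" by (intro power_mono) auto
      then show ?case by (simp add: power_mult_distrib)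
    qed
  qed auto
  then have "(\<lambda>n. (norm (abs_l2 (f n) - abs_l2 h))\<^sup>2) \<longlonglongrightarrow> 0"
    by (simp add: minus_abs_l2 sf sh norm_abs_l2_square sqint_diff)
  then have "(\<lambda>n. sqrt ((norm (abs_l2 (f n) - abs_l2 h))\<^sup>2)) \<longlonglongrightarrow> sqrt 0"
    by (intro tendsto_intros)
  then have "(\<lambda>n. norm (abs_l2 (f n) - abs_l2 h)) \<longlonglongrightarrow> 0" by simp
  then show "(\<lambda>n. abs_l2 (f n)) \<longlonglongrightarrow> abs_l2 h"
    by (simp add: LIM_zero_iff tendsto_norm_zero_iff)
qed

text \<open>
  The integral of \<open>\<Sum>k. 4^k \<bar>d\<^sub>k(x)\<bar>\<^sup>2\<close>, where \<open>d\<^sub>k\<close> is the \<open>k\<close>-th increment, is at most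
  \<open>\<Sum>k. 4^k (1/8)^k\<close>. So this sum is finite for almost every \<open>x\<close>, which forces
  \<open>\<bar>d\<^sub>k(x)\<bar> \<le> (1/2)^k\<close> from some \<open>k\<close> on. Weighting the squares in this way avoids any
  estimate of \<open>L\<^sup>1\<close> norms on a space of infinite measure.
\<close>

lemma AE_convergent_of_small_increments:
  assumes f: "\<And>n. sqint (f n)"
    and d: "\<And>n. (norm (abs_l2 (f (Suc n)) - abs_l2 (f n)))\<^sup>2 \<le> (1/8) ^ n"
  shows "AE x in lborel. convergent (\<lambda>n. f n x)"
proof -
  have [measurable]: "f n \<in> borel_measurable borel" for n
    by (rule sqint_measurable[OF f])
  define e where "e k x = 4 ^ k * (cmod (f (Suc k) x - f k x))\<^sup>2" for k x
  have [measurable]: "e k \<in> borel_measurable borel" for k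
    unfolding e_def by measurable
  have "(\<integral>\<^sup>+x. (\<Sum>k. ennreal (e k x)) \<partial>lborel) = (\<Sum>k. \<integral>\<^sup>+x. ennreal (e k x) \<partial>lborel)"
    by (rule nn_integral_suminf) auto
  also have "\<dots> \<le> (\<Sum>k. ennreal ((1/2) ^ k))"
  proof (rule suminf_le)
    fix k
    have "(\<integral>\<^sup>+x. ennreal (e k x) \<partial>lborel)
        = (\<integral>\<^sup>+x. ennreal (4 ^ k) * ennreal ((cmod (f (Suc k) x - f k x))\<^sup>2) \<partial>lborel)"
      by (simp add: e_def ennreal_mult)
    also have "\<dots> = ennreal (4 ^ k) * ennreal ((norm (abs_l2 (f (Suc k)) - abs_l2 (f k)))\<^sup>2)"
      by (subst nn_integral_cmult)
         (auto simp: nn_integral_norm_abs_l2 sqint_diff f minus_abs_l2)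
    also have "\<dots> \<le> ennreal (4 ^ k) * ennreal ((1/8) ^ k)"
      by (intro mult_left_mono ennreal_leI d) auto
    also have "\<dots> = ennreal ((1/2) ^ k)"
      by (simp add: ennreal_mult[symmetric] power_mult_distrib[symmetric])
    finally show "(\<integral>\<^sup>+x. ennreal (e k x) \<partial>lborel) \<le> ennreal ((1/2) ^ k)" .
  qed auto
  also have "\<dots> = ennreal (\<Sum>k. (1/2) ^ k)"
    by (rule suminf_ennreal2) (auto intro: summable_geometric)
  finally have "(\<integral>\<^sup>+x. (\<Sum>k. ennreal (e k x)) \<partial>lborel) \<noteq> \<infinity>"
    using neq_top_trans[OF ennreal_neq_top] by simp
  then have "AE x in lborel. (\<Sum>k. ennreal (e k x)) \<noteq> \<infinity>"
    by (intro nn_integral_noteq_infinite) auto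
  then show ?thesis
  proof eventually_elim
    case (elim x)
    have pow4: "((2::real) ^ k)\<^sup>2 = 4 ^ k" for k
      by (simp add: power2_eq_square power_mult_distrib[symmetric])
    have "summable (\<lambda>k. e k x)"
      using elim by (intro summable_suminf_not_top) (auto simp: e_def)
    then have "(\<lambda>k. e k x) \<longlonglongrightarrow> 0" by (rule summable_LIMSEQ_zero)
    then have "eventually (\<lambda>k. e k x < 1) sequentially"
      by (rule order_tendstoD) simp
    then have "eventually (\<lambda>k. norm (f (Suc k) x - f k x) \<le> (1/2) ^ k) sequentially"
    proof eventually_elim
      case (elim k)
      then have "(2 ^ k * cmod (f (Suc k) x - f k x))\<^sup>2 \<le> 1\<^sup>2"
        by (simp add: e_def power_mult_distrib pow4)
      then have "2 ^ k * cmod (f (Suc k) x - f k x) \<le> 1"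
        by (rule power2_le_imp_le) simp
      then show ?case by (simp add: power_one_over field_simps)
    qed
    then have "summable (\<lambda>k. f (Suc k) x - f k x)"
      by (rule summable_comparison_test_ev) (simp add: summable_geometric)
    then have "convergent (\<lambda>n. \<Sum>k<n. f (Suc k) x - f k x)"
      by (simp add: summable_iff_convergent)
    then have "convergent (\<lambda>n. f n x - f 0 x)"
      by (simp only: sum_lessThan_telescope[of "\<lambda>k. f k x"])
    then show ?case by (simp add: convergent_diff_const_right_iff)
  qed
qed

text \<open>
  The Riesz-Fischer theorem: a rapidly converging subsequence has a pointwise limit, and Fatou's
  lemma, applied to its tails, shows that this is also the limit in norm.
\<close>

instance l2 :: complete_space
proof
  fix X :: "nat \<Rightarrow> l2" assume X: "Cauchy X"
  have "\<exists>N. \<forall>m\<ge>N. \<forall>n\<ge>N. norm (X m - X n) < sqrt ((1/8) ^ k)" for k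
    using X[THEN CauchyD, of "sqrt ((1/8) ^ k)"] by simp
  then obtain N where N: "\<And>k m n. m \<ge> N k \<Longrightarrow> n \<ge> N k \<Longrightarrow> norm (X m - X n) < sqrt ((1/8) ^ k)"
    by metis
  \<comment> \<open>indices beyond \<open>N k\<close> that increase strictly\<close>
  define r where "r = rec_nat (N 0) (\<lambda>k m. max (Suc m) (N (Suc k)))"
  have r_Suc: "r (Suc k) = max (Suc (r k)) (N (Suc k))" for k by (simp add: r_def)
  have r_N: "N k \<le> r k" for k by (cases k) (simp_all add: r_Suc, simp add: r_def)
  have r_mono: "strict_mono r" by (rule strict_monoI_Suc) (simp add: r_Suc)
  define f where "f k = rep_l2 (X (r k))" for k
  have f: "sqint (f k)" for k by (simp add: f_def)
  have [measurable]: "f k \<in> borel_measurable borel" for k by (simp add: f_def)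
  have fX: "abs_l2 (f k) = X (r k)" for k by (simp add: f_def)
  have "AE x in lborel. convergent (\<lambda>n. f n x)"
  proof (rule AE_convergent_of_small_increments[OF f])
    fix n
    have "N n \<le> r (Suc n)" using r_N[of n] by (simp add: r_Suc)
    then have "norm (X (r (Suc n)) - X (r n)) \<le> sqrt ((1/8) ^ n)"
      using N[of n "r (Suc n)" "r n"] r_N[of n] by simp
    then have "(norm (X (r (Suc n)) - X (r n)))\<^sup>2 \<le> (sqrt ((1/8) ^ n))\<^sup>2"
      by (intro power_mono) auto
    then show "(norm (abs_l2 (f (Suc n)) - abs_l2 (f n)))\<^sup>2 \<le> (1/8) ^ n"
      by (simp add: fX)
  qed
  then have lim: "AE x in lborel. (\<lambda>n. f n x) \<longlonglongrightarrow> lim (\<lambda>n. f n x)"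
    by eventually_elim (rule convergent_LIMSEQ_iff[THEN iffD1])
  define h where "h x = lim (\<lambda>n. f n x)" for x
  have h [measurable]: "h \<in> borel_measurable borel"
    unfolding h_def by measurable
  have hk: "sqint (\<lambda>x. h x - f k x) \<and> norm (abs_l2 (\<lambda>x. h x - f k x)) \<le> \<epsilon>"
    if "\<And>m. m \<ge> k \<Longrightarrow> norm (X (r m) - X (r k)) \<le> \<epsilon>" for k \<epsilon>
  proof -
    have l: "AE x in lborel. (\<lambda>n. f (n + k) x - f k x) \<longlonglongrightarrow> h x - f k x"
      using lim
      by eventually_elim (intro tendsto_diff tendsto_const LIMSEQ_ignore_initial_segment, simp add: h_def)
    have b: "norm (abs_l2 (\<lambda>x. f (n + k) x - f k x)) \<le> \<epsilon>" for n
      using that[of "n + k"] by (simp add: minus_abs_l2[symmetric] f fX)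
    show ?thesis
      using sqint_Fatou[OF sqint_diff[OF f f] _ l b] by simp
  qed
  have "\<exists>k0. \<forall>k\<ge>k0. \<forall>m\<ge>k0. norm (X (r m) - X (r k)) < \<epsilon>" if "\<epsilon> > 0" for \<epsilon>
    using CauchyD[OF Cauchy_subseq_Cauchy[OF X r_mono] that] by fastforce
  note cau = this
  obtain k0 where "\<forall>k\<ge>k0. \<forall>m\<ge>k0. norm (X (r m) - X (r k)) < 1"
    using cau[of 1] by auto
  then have "sqint (\<lambda>x. h x - f k0 x)" using hk[of k0 1] by (auto intro: less_imp_le)
  from square_integrable_add[OF this f[of k0]] have sh: "sqint h" by simp
  have "(\<lambda>k. X (r k)) \<longlonglongrightarrow> abs_l2 h"
  proof (rule LIMSEQ_I)
    fix \<epsilon> :: real assume "\<epsilon> > 0"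
    then obtain k0 where k0: "\<forall>k\<ge>k0. \<forall>m\<ge>k0. norm (X (r m) - X (r k)) < \<epsilon>/2"
      using cau[of "\<epsilon>/2"] by auto
    have "norm (X (r k) - abs_l2 h) < \<epsilon>" if "k \<ge> k0" for k
    proof -
      have "norm (abs_l2 (\<lambda>x. h x - f k x)) \<le> \<epsilon>/2"
      proof -
        have "norm (X (r m) - X (r k)) \<le> \<epsilon>/2" if "m \<ge> k" for m
          using k0 \<open>k \<ge> k0\<close> that by (meson less_imp_le order_trans)
        then show ?thesis using hk[of k "\<epsilon>/2"] by blast
      qed
      then have "norm (abs_l2 h - X (r k)) \<le> \<epsilon>/2"
        by (simp add: minus_abs_l2[symmetric] sh f fX)
      then show ?thesis using \<open>\<epsilon> > 0\<close> by (simp add: norm_minus_commute)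
    qed
    then show "\<exists>no. \<forall>n\<ge>no. norm (X (r n) - abs_l2 h) < \<epsilon>" by blast
  qed
  then have "X \<longlonglongrightarrow> abs_l2 h"
    by (intro Cauchy_converges_subseq[OF X r_mono]) (simp add: o_def)
  then show "convergent X" by (rule convergentI)
qed

text \<open>
  The truncated Fourier transform of a norm limit is known pointwise, while its integrability is
  known only through the norm limit of the transforms; the two descriptions agree.
\<close>

lemma AE_limit_eq_l2_limit:
  assumes f: "\<And>n. sqint (f n)" and h [measurable]: "h \<in> borel_measurable borel"
    and lim: "AE x in lborel. (\<lambda>n. f n x) \<longlonglongrightarrow> h x"
    and u: "(\<lambda>n. abs_l2 (f n)) \<longlonglongrightarrow> u"
  shows "sqint h" "abs_l2 h = u"
proof -
  have *: "sqint (\<lambda>x. h x - rep_l2 u x) \<and> norm (abs_l2 (\<lambda>x. h x - rep_l2 u x)) \<le> \<epsilon>"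
    if "\<epsilon> > 0" for \<epsilon>
  proof -
    obtain k where k: "\<And>n. n \<ge> k \<Longrightarrow> norm (abs_l2 (f n) - u) < \<epsilon>"
      using LIMSEQ_D[OF u \<open>\<epsilon> > 0\<close>] by blast
    have l: "AE x in lborel. (\<lambda>n. f (n + k) x - rep_l2 u x) \<longlonglongrightarrow> h x - rep_l2 u x"
      using lim
      by eventually_elim (intro tendsto_diff tendsto_const LIMSEQ_ignore_initial_segment)
    have b: "norm (abs_l2 (\<lambda>x. f (n + k) x - rep_l2 u x)) \<le> \<epsilon>" for n
      using k[of "n + k"] by (simp add: minus_abs_l2[symmetric] f less_imp_le)
    show ?thesis using sqint_Fatou[OF sqint_diff[OF f sqint_rep] _ l b] by simp
  qed
  then have "sqint (\<lambda>x. h x - rep_l2 u x)" by (metis zero_less_one)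
  from square_integrable_add[OF this sqint_rep[of u]] show sh: "sqint h" by simp
  have "norm (abs_l2 h - u) \<le> \<epsilon>" if "\<epsilon> > 0" for \<epsilon>
    using *[OF that] minus_abs_l2[OF sh sqint_rep[of u]] by simp
  then have "norm (abs_l2 h - u) \<le> 0" by (rule field_le_epsilon) simp
  then show "abs_l2 h = u" by simp
qed

section \<open>Density of the indicators of intervals\<close>

lemma sqint_indicator_mult:
  "sqint f \<Longrightarrow> A \<in> sets borel \<Longrightarrow> sqint (\<lambda>x. indicator A x * f x)"
  by (rule sqint_bound[of f])
     (auto simp: indicator_def sqint_measurable intro!: borel_measurable_times)

lemma sqint_const_indicator:
  assumes "A \<in> sets borel" "emeasure lborel A < \<infinity>"
  shows "sqint (\<lambda>x. c * indicator A x)"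
proof -
  have "integrable lborel (\<lambda>x. (cmod c)\<^sup>2 * indicator A x)"
    using assms by (intro integrable_mult_right) (auto simp: integrable_real_indicator)
  moreover have "(cmod (c * indicator A x))\<^sup>2 = (cmod c)\<^sup>2 * indicator A x" for x
    by (simp add: norm_mult power_mult_distrib indicator_def)
  ultimately show ?thesis
    using assms by (simp add: square_integrable_def borel_measurable_indicator)
qed

lemma emeasure_bounded_interval_finite:
  "emeasure lborel (A \<inter> {a<..b::real}) < \<infinity>" if "A \<in> sets borel"
proof -
  have "emeasure lborel (A \<inter> {a<..b}) \<le> emeasure lborel {a<..b}"
    by (rule emeasure_mono) auto
  also have "\<dots> < \<infinity>" by (cases "a \<le> b") auto
  finally show ?thesis .
qed

lemma sqint_Ioc: "sqint (\<lambda>x. c * indicator {a<..b::real} x)"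
  using emeasure_bounded_interval_finite[of UNIV a b] by (intro sqint_const_indicator) auto

lemma sqint_Icc: "sqint (\<lambda>x. c * indicator {a..b::real} x)"
  by (rule sqint_const_indicator) (cases "a \<le> b"; simp)+

lemma tendsto_indicator_window: "(\<lambda>n. indicator {- real n..real n} x * c) \<longlonglongrightarrow> (c :: complex)"
proof -
  obtain k where k: "\<bar>x\<bar> < real k" using reals_Archimedean2 by blast
  have "\<forall>\<^sub>F n in sequentially. indicator {- real n..real n} x * c = c"
    using eventually_ge_at_top[of k] by eventually_elim (use k in \<open>auto simp: indicator_def\<close>)
  then show ?thesis by (rule tendsto_eventually)
qed

lemma abs_l2_sum:
  assumes "finite I" "\<And>i. i \<in> I \<Longrightarrow> sqint (f i)"
  shows "sqint (\<lambda>x. \<Sum>i\<in>I. f i x) \<and> abs_l2 (\<lambda>x. \<Sum>i\<in>I. f i x) = (\<Sum>i\<in>I. abs_l2 (f i))"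
  using assms
proof (induction I rule: finite_induct)
  case empty
  then show ?case by (simp add: zero_l2_abs)
next
  case (insert i I)
  then show ?case by (auto simp: plus_abs_l2[symmetric] intro: square_integrable_add)
qed

text \<open>
  Complex multiples are included because the subspaces in what follows are real subspaces.
\<close>

definition interval_functions :: "l2 set" where
  "interval_functions = {abs_l2 (\<lambda>x. c * indicator {a<..b} x) | c a b. True}"

text \<open>
  The Borel sets with this property are closed under complements and countable disjoint unions, and
  they contain the intervals, which are stable under intersection. Cutting down to a bounded
  interval keeps all indicators square integrable.
\<close>

lemma indicator_in_closed_subspace:
  assumes V: "closed V" "subspace V" "interval_functions \<subseteq> V" and A: "A \<in> sets borel"
  shows "abs_l2 (\<lambda>x. c * indicator (A \<inter> {a<..b}) x) \<in> V"
  using A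
proof (induction A rule: borel_set_induct)
  case empty
  have "abs_l2 (\<lambda>x. c * indicator ({} \<inter> {a<..b}) x) = 0" by (simp add: zero_l2_abs)
  then show ?case using subspace_0[OF V(2)] by simp
next
  case (interval d e)
  have "abs_l2 (\<lambda>x. c * indicator {max a d<..min b e} x)
      = abs_l2 (\<lambda>x. c * indicator ({d..e} \<inter> {a<..b}) x)"
  proof (rule abs_l2_cong)
    show "sqint (\<lambda>x. c * indicator {max a d<..min b e} x)" by (rule sqint_Ioc)
    show "AE x in lborel. c * indicator {max a d<..min b e} x = c * indicator ({d..e} \<inter> {a<..b}) x"
      using AE_lborel_singleton[of d] by eventually_elim (auto simp: indicator_def)
  qed auto
  moreover have "abs_l2 (\<lambda>x. c * indicator {max a d<..min b e} x) \<in> V"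
    using V(3) by (auto simp: interval_functions_def)
  ultimately show ?case by simp
next
  case (compl A)
  note A [measurable] = compl.hyps
  have s: "sqint (\<lambda>x. c * indicator {a<..b} x)" "sqint (\<lambda>x. c * indicator (A \<inter> {a<..b}) x)"
    using emeasure_bounded_interval_finite[OF A] by (auto intro!: sqint_const_indicator sqint_Ioc)
  have "abs_l2 (\<lambda>x. c * indicator (- A \<inter> {a<..b}) x)
      = abs_l2 (\<lambda>x. c * indicator {a<..b} x - c * indicator (A \<inter> {a<..b}) x)"
    by (rule arg_cong[where f = abs_l2]) (auto simp: fun_eq_iff indicator_def)
  also have "\<dots> = abs_l2 (\<lambda>x. c * indicator {a<..b} x) - abs_l2 (\<lambda>x. c * indicator (A \<inter> {a<..b}) x)"
    by (rule minus_abs_l2[OF s, symmetric])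
  also have "\<dots> \<in> V"
    using V(3) compl.IH by (intro subspace_diff[OF V(2)]) (auto simp: interval_functions_def)
  finally show ?case .
next
  case (union F)
  note F [measurable] = union.hyps(2)
  define G where "G n = (\<Union>i<n. F i)" for n :: nat
  have G [measurable]: "G n \<in> sets borel" for n unfolding G_def by auto
  have ind: "indicator (G n \<inter> {a<..b}) x = (\<Sum>i<n. indicator (F i \<inter> {a<..b}) x :: complex)" for n x
  proof -
    have "disjoint_family_on (\<lambda>i. F i \<inter> {a<..b}) {..<n}"
      using union.hyps(1) by (auto simp: disjoint_family_on_def)
    then have "indicator (\<Union>i<n. F i \<inter> {a<..b}) x = (\<Sum>i<n. indicator (F i \<inter> {a<..b}) x :: complex)"
      by (intro indicator_UN_disjoint) auto
    then show ?thesis by (simp add: G_def)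
  qed
  have sF: "sqint (\<lambda>x. c * indicator (F i \<inter> {a<..b}) x)" for i
    using emeasure_bounded_interval_finite[OF F] by (intro sqint_const_indicator) auto
  have "abs_l2 (\<lambda>x. c * indicator (G n \<inter> {a<..b}) x) \<in> V" for n
  proof -
    have "abs_l2 (\<lambda>x. c * indicator (G n \<inter> {a<..b}) x)
        = (\<Sum>i<n. abs_l2 (\<lambda>x. c * indicator (F i \<inter> {a<..b}) x))"
      using abs_l2_sum[OF finite_lessThan[of n] sF] by (simp add: ind sum_distrib_left)
    then show ?thesis using union.IH by (simp add: subspace_sum[OF V(2)])
  qed
  moreover have "(\<lambda>n. abs_l2 (\<lambda>x. c * indicator (G n \<inter> {a<..b}) x))
      \<longlonglongrightarrow> abs_l2 (\<lambda>x. c * indicator ((\<Union>i. F i) \<inter> {a<..b}) x)"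
  proof (rule abs_l2_dominated_convergence)
    show "sqint (\<lambda>x. c * indicator {a<..b} x)" by (rule sqint_Ioc)
    show "AE x in lborel. (\<lambda>n. c * indicator (G n \<inter> {a<..b}) x)
        \<longlonglongrightarrow> c * indicator ((\<Union>i. F i) \<inter> {a<..b}) x"
    proof (rule AE_I2)
      fix x
      have "\<forall>\<^sub>F n in sequentially. c * indicator (G n \<inter> {a<..b}) x
          = c * indicator ((\<Union>i. F i) \<inter> {a<..b}) x"
      proof (cases "x \<in> (\<Union>i. F i)")
        case True
        then obtain i where i: "x \<in> F i" by blast
        show ?thesis using eventually_gt_at_top[of i]
          by eventually_elim (use i in \<open>auto simp: G_def indicator_def\<close>)
      qed (auto simp: G_def indicator_def)
      then show "(\<lambda>n. c * indicator (G n \<inter> {a<..b}) x)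
          \<longlonglongrightarrow> c * indicator ((\<Union>i. F i) \<inter> {a<..b}) x"
        by (rule tendsto_eventually)
    qed
  qed (auto simp: indicator_def)
  ultimately show ?case by (rule closed_sequentially[OF V(1)])
qed

text \<open>
  Simple functions approximating \<open>f\<close> pointwise with \<open>\<bar>s\<^sub>i\<bar> \<le> 2 \<bar>f\<bar>\<close>, cut off to \<open>(-i, i]\<close>, converge
  to \<open>f\<close> by dominated convergence.
\<close>

lemma interval_functions_dense:
  assumes V: "closed V" "subspace V" "interval_functions \<subseteq> V"
  shows "V = UNIV"
proof -
  have "u \<in> V" for u
  proof -
    define f where "f = rep_l2 u"
    have f: "sqint f" and [measurable]: "f \<in> borel_measurable borel" by (simp_all add: f_def)
    have "f \<in> borel_measurable lborel" by simp
    from borel_measurable_implies_sequence_metric[OF this, of 0] obtain s where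
      s: "\<And>i. simple_function lborel (s i)" "\<And>x. (\<lambda>i. s i x) \<longlonglongrightarrow> f x"
        "\<And>i x. dist (s i x) 0 \<le> 2 * dist (f x) 0" by auto
    have sm [measurable]: "s i \<in> borel_measurable borel" for i
      using borel_measurable_simple_function[OF s(1)] by simp
    define g where "g i x = s i x * indicator {- real i<..real i} x" for i x
    define piece where "piece i y x = y * indicator (s i -` {y} \<inter> {- real i<..real i}) x" for i y x
    have gm [measurable]: "g i \<in> borel_measurable borel" for i unfolding g_def by measurable
    have "abs_l2 (g i) \<in> V" for i
    proof -
      have fin: "finite (range (s i))"
        using simple_functionD(1)[OF s(1)] by simp
      have [measurable]: "s i -` {y} \<in> sets borel" for y
        using measurable_sets[OF sm, of "{y}"] by simp
      have "g i = (\<lambda>x. \<Sum>y\<in>range (s i). piece i y x)"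
      proof
        fix x
        have "(\<Sum>y\<in>range (s i). piece i y x) = (\<Sum>y\<in>{s i x}. piece i y x)"
          by (rule sum.mono_neutral_right[OF fin]) (auto simp: piece_def indicator_def)
        then show "g i x = (\<Sum>y\<in>range (s i). piece i y x)"
          by (simp add: g_def piece_def indicator_def)
      qed
      moreover have "sqint (piece i y)" for y
        unfolding piece_def using emeasure_bounded_interval_finite[of "s i -` {y}"]
        by (intro sqint_const_indicator) auto
      ultimately have "abs_l2 (g i) = (\<Sum>y\<in>range (s i). abs_l2 (piece i y))"
        using abs_l2_sum[OF fin, of "piece i"] by simp
      also have "\<dots> \<in> V"
        unfolding piece_def by (intro subspace_sum[OF V(2)] indicator_in_closed_subspace[OF V]) simp
      finally show ?thesis .
    qed
    moreover have "(\<lambda>i. abs_l2 (g i)) \<longlonglongrightarrow> abs_l2 f"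
    proof (rule abs_l2_dominated_convergence)
      show "sqint (\<lambda>x. 2 * f x)" by (rule square_integrable_cmult[OF f])
      show "AE x in lborel. (\<lambda>i. g i x) \<longlonglongrightarrow> f x"
      proof (rule AE_I2)
        fix x
        have "\<forall>\<^sub>F i in sequentially. s i x = g i x"
        proof -
          obtain k where k: "\<bar>x\<bar> < real k" using reals_Archimedean2 by blast
          show ?thesis using eventually_ge_at_top[of k]
            by eventually_elim (use k in \<open>auto simp: g_def indicator_def\<close>)
        qed
        then show "(\<lambda>i. g i x) \<longlonglongrightarrow> f x" using s(2)[of x] by (rule Lim_transform_eventually[rotated])
      qed
      show "AE x in lborel. cmod (g n x) \<le> cmod (2 * f x)" for n
        using s(3)[of n] by (auto simp: g_def indicator_def norm_mult)
    qed simp_all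
    ultimately have "abs_l2 f \<in> V" by (rule closed_sequentially[OF V(1)])
    then show ?thesis by (simp add: f_def)
  qed
  then show ?thesis by auto
qed

section \<open>Parseval's identity for indicators of intervals\<close>

definition interval_fourier :: "real \<Rightarrow> real \<Rightarrow> real \<Rightarrow> complex" where
  "interval_fourier a b t = (LINT x|lborel. exp (- (\<i> * complex_of_real (x * t))) * indicator {a<..b} x)"

lemma interval_fourier_measurable [measurable]: "interval_fourier a b \<in> borel_measurable borel"
  unfolding interval_fourier_def by measurable

lemma interval_fourier_empty: "b \<le> a \<Longrightarrow> interval_fourier a b t = 0"
  by (simp add: interval_fourier_def)

lemma interval_fourier_eq:
  assumes "a \<le> b" "t \<noteq> 0"
  shows "interval_fourier a b t = (iexp (- (t * a)) - iexp (- (t * b))) / (\<i> * t)"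
proof -
  define F where "F x = \<i> / t * exp (- (\<i> * complex_of_real (x * t)))" for x :: real
  have "((\<lambda>x. F x) has_vector_derivative exp (- (\<i> * complex_of_real (x * t)))) (at x within {a..b})" for x
  proof -
    have "((\<lambda>z. \<i> / t * exp (- (\<i> * (z * t)))) has_field_derivative exp (- (\<i> * (x * t)))) (at (complex_of_real x))"
      using assms(2) by (auto intro!: derivative_eq_intros)
    from has_vector_derivative_real_field[OF this]
    show ?thesis
      by (auto simp: F_def intro: has_vector_derivative_at_within)
  qed
  then have "(LINT x|lborel. indicator {a..b} x *\<^sub>R exp (- (\<i> * complex_of_real (x * t)))) = F b - F a"
    by (intro integral_FTC_Icc assms) (auto intro!: continuous_intros)
  moreover have "interval_fourier a b t
      = (LINT x|lborel. indicator {a..b} x *\<^sub>R exp (- (\<i> * complex_of_real (x * t))))"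
    unfolding interval_fourier_def
  proof (rule integral_cong_AE)
    show "AE x in lborel. exp (- (\<i> * complex_of_real (x * t))) * indicator {a<..b} x
        = indicator {a..b} x *\<^sub>R exp (- (\<i> * complex_of_real (x * t)))"
      using AE_lborel_singleton[of a] by eventually_elim (auto simp: indicator_def)
  qed auto
  ultimately have "interval_fourier a b t = F b - F a" by simp
  also have "\<dots> = (iexp (- (t * a)) - iexp (- (t * b))) / (\<i> * t)"
    using assms(2) by (simp add: F_def field_simps)
  finally show ?thesis .
qed

text \<open>
  The characteristic function of the uniform distribution on \<open>(c, d]\<close> is the conjugate of
  \<open>interval_fourier c d\<close> divided by \<open>d - c\<close>, and the kernel in Levy's inversion formula for
  \<open>(a, b]\<close> is \<open>interval_fourier a b\<close>. The inversion formula thus is Parseval's identity, except that the integral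
  is an improper one.
\<close>

lemma interval_parseval_limit:
  assumes "a \<le> b" "c < d"
  shows "(\<lambda>n::nat. LINT t|lborel. indicator {- real n..real n} t * interval_fourier a b t * cnj (interval_fourier c d t))
    \<longlonglongrightarrow> complex_of_real (2 * pi * measure lborel ({c<..d} \<inter> {a<..b}))"
proof -
  define M where "M = density lborel (\<lambda>x. ennreal (indicator {c<..d} x / (d - c)))"
  have Mu: "M = uniform_measure lborel {c<..d}"
    unfolding M_def uniform_measure_def
    by (rule density_cong)
       (use assms in \<open>auto simp: emeasure_lborel_Ioc divide_ennreal indicator_def ennreal_1[symmetric] simp del: ennreal_1\<close>)
  have pos: "emeasure lborel {c<..d} \<noteq> 0" "emeasure lborel {c<..d} \<noteq> \<infinity>"
    using assms by auto
  interpret real_distribution M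
    unfolding real_distribution_def real_distribution_axioms_def
    using prob_space_uniform_measure[OF pos] by (simp add: Mu)
  have m: "measure M A = measure lborel ({c<..d} \<inter> A) / (d - c)" if "A \<in> sets borel" for A
    unfolding Mu using measure_uniform_measure[OF pos, of A] that assms by simp
  have m0: "measure M {x} = 0" for x
  proof -
    have "measure lborel ({c<..d} \<inter> {x}) \<le> measure lborel {x}"
      by (rule measure_mono_fmeasurable) (auto simp: fmeasurable_def)
    then show ?thesis by (simp add: m measure_def[of lborel "{x}"] antisym)
  qed
  have ch: "char M t = cnj (interval_fourier c d t) / (d - c)" for t
  proof -
    have "char M t = (LINT x|lborel. (indicator {c<..d} x / (d - c)) *\<^sub>R iexp (t * x))"
      unfolding char_def M_def by (rule integral_density) (use assms in auto)
    also have "\<dots> = (LINT x|lborel. cnj (exp (- (\<i> * complex_of_real (x * t))) * indicator {c<..d} x) / (d - c))"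
      by (rule Bochner_Integration.integral_cong)
         (auto simp: indicator_def exp_cnj scaleR_conv_of_real mult.commute)
    also have "\<dots> = cnj (interval_fourier c d t) / (d - c)"
      unfolding interval_fourier_def
      by (simp only: integral_divide_zero Bochner_Integration.integral_cnj)
    finally show ?thesis .
  qed
  define C where "C n = (CLBINT t=-real n..real n. (iexp (-(t * a)) - iexp (-(t * b))) / (\<i> * t) * char M t)" for n :: nat
  have L: "(LINT t|lborel. indicator {- real n..real n} t * interval_fourier a b t * cnj (interval_fourier c d t))
      = (2 * pi * (d - c)) * (1 / (2 * pi) * C n)" for n :: nat
  proof -
    have "C n
      = (LINT t|lborel. indicator {-real n..real n} t *\<^sub>R ((iexp (-(t * a)) - iexp (-(t * b))) / (\<i> * t) * char M t))"
      unfolding C_def by (subst interval_integral_Icc) (auto simp: set_lebesgue_integral_def)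
    also have "\<dots> = (LINT t|lborel. (indicator {- real n..real n} t * interval_fourier a b t * cnj (interval_fourier c d t)) / (d - c))"
    proof (rule integral_cong_AE)
      show "AE t in lborel. indicator {-real n..real n} t *\<^sub>R ((iexp (-(t * a)) - iexp (-(t * b))) / (\<i> * t) * char M t)
         = (indicator {- real n..real n} t * interval_fourier a b t * cnj (interval_fourier c d t)) / (d - c)"
        using AE_lborel_singleton[of 0]
        by eventually_elim (auto simp: indicator_def interval_fourier_eq[OF assms(1)] ch)
    qed (simp_all add: ch)
    finally have c: "C n = (LINT t|lborel. indicator {- real n..real n} t * interval_fourier a b t
        * cnj (interval_fourier c d t)) / complex_of_real (d - c)"
      by (simp del: of_real_diff)
    have "complex_of_real (d - c) \<noteq> 0" using assms by (simp del: of_real_diff)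
    then show ?thesis unfolding c by (simp del: of_real_diff)
  qed
  have "(\<lambda>n. (2 * pi * (d - c)) * (1 / (2 * pi) * C n))
    \<longlonglongrightarrow> (2 * pi * (d - c)) * complex_of_real (measure M {a<..b})"
  proof (rule tendsto_mult[OF tendsto_const])
    show "(\<lambda>n. 1 / (2 * pi) * C n) \<longlonglongrightarrow> complex_of_real (measure M {a<..b})"
      using Levy_Inversion[OF assms(1) m0 m0] by (simp add: C_def)
  qed
  moreover have "(2 * pi * (d - c)) * complex_of_real (measure M {a<..b})
      = complex_of_real (2 * pi * measure lborel ({c<..d} \<inter> {a<..b}))"
    using assms by (simp add: m)
  ultimately show ?thesis unfolding L by (simp only:)
qed

text \<open>
  The case \<open>a = c\<close>, \<open>b = d\<close> of the improper identity bounds the integrals of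
  \<open>\<bar>interval_fourier a b\<bar>\<^sup>2\<close> over \<open>[-n, n]\<close>.
\<close>

lemma sqint_interval_fourier: "sqint (interval_fourier a b)"
proof (cases "a < b")
  case True
  define f where "f n t = indicator {- real n..real n} t * interval_fourier a b t" for n t
  have fm [measurable]: "f n \<in> borel_measurable borel" for n unfolding f_def by measurable
  have bd: "cmod (interval_fourier a b t) \<le> b - a" for t
  proof -
    have "cmod (interval_fourier a b t) \<le> (LINT x|lborel. cmod (exp (- (\<i> * complex_of_real (x * t))) * indicator {a<..b} x))"
      unfolding interval_fourier_def by (rule integral_norm_bound)
    also have "\<dots> = (LINT x|lborel. indicator {a<..b} x)"
      by (rule Bochner_Integration.integral_cong) (auto simp: indicator_def)
    also have "\<dots> = b - a" using True by simp
    finally show ?thesis .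
  qed
  have sf: "sqint (f n)" for n
  proof (rule sqint_bound)
    show "sqint (\<lambda>x. complex_of_real (b - a) * indicator {- real n..real n} x)" by (rule sqint_Icc)
    show "AE x in lborel. cmod (f n x) \<le> cmod (complex_of_real (b - a) * indicator {- real n..real n} x)"
      using bd True by (auto simp: f_def indicator_def simp del: of_real_diff)
  qed simp
  have eq: "complex_of_real ((norm (abs_l2 (f n)))\<^sup>2)
      = (LINT t|lborel. indicator {- real n..real n} t * interval_fourier a b t * cnj (interval_fourier a b t))" for n
    unfolding cinner_self[symmetric] cinner_abs_l2[OF sf sf]
    by (rule Bochner_Integration.integral_cong) (auto simp: f_def indicator_def)
  have "Bseq (\<lambda>n. complex_of_real ((norm (abs_l2 (f n)))\<^sup>2))"
    unfolding eq using True by (intro convergent_imp_Bseq convergentI[OF interval_parseval_limit]) auto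
  then obtain C where C: "C > 0" "\<And>n. (norm (abs_l2 (f n)))\<^sup>2 \<le> C"
    by (auto simp: Bseq_def norm_power)
  have bound: "norm (abs_l2 (f n)) \<le> sqrt C" for n
    using C(2)[of n] by (rule real_le_rsqrt)
  have "AE t in lborel. (\<lambda>n. f n t) \<longlonglongrightarrow> interval_fourier a b t"
    unfolding f_def by (intro AE_I2 tendsto_indicator_window)
  from sqint_Fatou(1)[OF sf interval_fourier_measurable this bound] show ?thesis .
next
  case False
  then have "interval_fourier a b = (\<lambda>_. 0)" by (auto simp: interval_fourier_empty)
  then show ?thesis by simp
qed

lemma interval_parseval:
  "(LINT t|lborel. interval_fourier a b t * cnj (interval_fourier c d t))
    = complex_of_real (2 * pi * measure lborel ({c<..d} \<inter> {a<..b}))"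
proof (cases "a < b \<and> c < d")
  case True
  have "(\<lambda>n::nat. LINT t|lborel. indicator {- real n..real n} t * interval_fourier a b t * cnj (interval_fourier c d t))
    \<longlonglongrightarrow> (LINT t|lborel. interval_fourier a b t * cnj (interval_fourier c d t))"
  proof (rule integral_dominated_convergence)
    show "integrable lborel (\<lambda>t. cmod (interval_fourier a b t * cnj (interval_fourier c d t)))"
      by (intro integrable_norm square_integrable_mult sqint_interval_fourier)
    show "AE t in lborel. (\<lambda>n. indicator {- real n..real n} t * interval_fourier a b t * cnj (interval_fourier c d t))
      \<longlonglongrightarrow> interval_fourier a b t * cnj (interval_fourier c d t)"
      unfolding mult.assoc by (intro AE_I2 tendsto_indicator_window)
  qed (auto simp: indicator_def norm_mult)
  then show ?thesis
    using interval_parseval_limit[of a b c d] True by (intro LIMSEQ_unique) auto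
next
  case False
  then consider "b \<le> a" | "d \<le> c" by linarith
  then show ?thesis by cases (simp_all add: interval_fourier_empty)
qed

section \<open>Bounded complex linear operators\<close>

lemma bounded_clinear_l2I:
  assumes "\<And>u v. A (u + v) = A u + A v" "\<And>c u. A (c *\<^sub>C u) = c *\<^sub>C A u"
    and "\<And>u. norm (A u) \<le> norm u * K"
  shows "bounded_clinear_l2 A"
proof -
  have "A (r *\<^sub>R u) = r *\<^sub>R A u" for r u
    using assms(2)[of "complex_of_real r" u] by (simp add: scaleC_of_real)
  then have "bounded_linear A"
    using assms by (intro bounded_linear_intro[where K = K]) auto
  then show ?thesis using assms(2) by (simp add: bounded_clinear_l2_def)
qed

lemma bounded_clinear_l2D:
  assumes "bounded_clinear_l2 A"
  shows "A (u + v) = A u + A v" "A (u - v) = A u - A v" "A (c *\<^sub>C u) = c *\<^sub>C A u" "A 0 = 0"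
    "bounded_linear A"
  using assms linear_simps[of A] by (auto simp: bounded_clinear_l2_def)

lemma bounded_clinear_l2_tendsto:
  "bounded_clinear_l2 A \<Longrightarrow> (f \<longlongrightarrow> a) F \<Longrightarrow> ((\<lambda>x. A (f x)) \<longlongrightarrow> A a) F"
  by (simp add: bounded_clinear_l2_def bounded_linear.tendsto)

lemma bounded_clinear_l2_comp:
  assumes "bounded_clinear_l2 A" "bounded_clinear_l2 B"
  shows "bounded_clinear_l2 (\<lambda>u. A (B u))"
  using assms by (simp add: bounded_clinear_l2_def bounded_linear_compose)

lemma bounded_clinear_l2_add:
  assumes "bounded_clinear_l2 A" "bounded_clinear_l2 B"
  shows "bounded_clinear_l2 (\<lambda>u. A u + B u)"
  using assms by (simp add: bounded_clinear_l2_def bounded_linear_add scaleC_add_right)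

lemma bounded_clinear_l2_scaleC: "bounded_clinear_l2 (\<lambda>u. c *\<^sub>C u)"
  by (rule bounded_clinear_l2I[where K = "cmod c"]) (simp_all add: scaleC_add_right mult.commute)

lemma bounded_clinear_l2_diff:
  assumes "bounded_clinear_l2 A" "bounded_clinear_l2 B"
  shows "bounded_clinear_l2 (\<lambda>u. A u - B u)"
  using assms by (simp add: bounded_clinear_l2_def bounded_linear_sub scaleC_diff_right)

section \<open>Time limiting\<close>

lemma time_limit_abs_l2:
  "sqint f \<Longrightarrow> time_limit \<tau> (abs_l2 f) = abs_l2 (\<lambda>x. indicator {-\<tau><..<\<tau>} x * f x)"
  by (simp add: time_limit.abs_eq)

lemma norm_time_limit_le: "norm (time_limit \<tau> u) \<le> norm u"
proof (cases u rule: l2_cases)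
  case (1 f)
  have [measurable]: "f \<in> borel_measurable borel" using 1 by (simp add: sqint_measurable)
  show ?thesis
    unfolding 1(2) time_limit_abs_l2[OF 1(1)]
    by (rule norm_abs_l2_mono[OF 1(1)]) (auto simp: indicator_def)
qed

lemma bounded_clinear_time_limit: "bounded_clinear_l2 (time_limit \<tau>)"
proof (rule bounded_clinear_l2I[where K = 1])
  fix u v :: l2 and c
  obtain f where f: "sqint f" "u = abs_l2 f" by (rule l2_cases)
  obtain g where g: "sqint g" "v = abs_l2 g" by (rule l2_cases)
  show "time_limit \<tau> (u + v) = time_limit \<tau> u + time_limit \<tau> v"
    by (simp add: f g plus_abs_l2 time_limit_abs_l2 sqint_indicator_mult square_integrable_add ring_distribs)
  show "time_limit \<tau> (c *\<^sub>C u) = c *\<^sub>C time_limit \<tau> u"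
    by (simp add: f scaleC_abs_l2 time_limit_abs_l2 sqint_indicator_mult square_integrable_cmult mult.left_commute)
qed (simp add: norm_time_limit_le)

lemmas time_limit_simps = bounded_clinear_l2D[OF bounded_clinear_time_limit]

lemma time_limit_time_limit: "time_limit a (time_limit b u) = time_limit (min a b) u"
proof (cases u rule: l2_cases)
  case (1 f)
  show ?thesis
    by (simp add: 1 time_limit_abs_l2 sqint_indicator_mult)
       (rule arg_cong[where f = abs_l2], auto simp: indicator_def fun_eq_iff)
qed

lemma time_limit_idem [simp]: "time_limit a (time_limit a u) = time_limit a u"
  by (simp add: time_limit_time_limit)

lemma cinner_time_limit: "cinner_l2 (time_limit \<tau> u) v = cinner_l2 u (time_limit \<tau> v)"
proof -
  obtain f where f: "sqint f" "u = abs_l2 f" by (rule l2_cases)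
  obtain g where g: "sqint g" "v = abs_l2 g" by (rule l2_cases)
  show ?thesis
    by (simp add: f g cinner_abs_l2 time_limit_abs_l2 sqint_indicator_mult)
       (rule Bochner_Integration.integral_cong, auto simp: indicator_def)
qed

lemma tendsto_time_limit: "((\<lambda>N. time_limit N u) \<longlongrightarrow> u) at_top"
proof (cases u rule: l2_cases)
  case (1 f)
  have [measurable]: "f \<in> borel_measurable borel" using 1 by (simp add: sqint_measurable)
  show ?thesis
  proof (rule tendsto_at_topI_sequentially)
    fix X :: "nat \<Rightarrow> real" assume X: "filterlim X at_top sequentially"
    have "(\<lambda>n. abs_l2 (\<lambda>x. indicator {-X n<..<X n} x * f x)) \<longlonglongrightarrow> abs_l2 f"
    proof (rule abs_l2_dominated_convergence(2))
      show "sqint f" by fact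
      show "AE x in lborel. (\<lambda>n. indicator {-X n<..<X n} x * f x) \<longlonglongrightarrow> f x"
      proof (rule AE_I2)
        fix x
        have "eventually (\<lambda>n. \<bar>x\<bar> < X n) sequentially"
          using X by (simp add: filterlim_at_top_dense)
        then have "eventually (\<lambda>n. indicator {-X n<..<X n} x * f x = f x) sequentially"
          by eventually_elim (auto simp: indicator_def)
        then show "(\<lambda>n. indicator {-X n<..<X n} x * f x) \<longlonglongrightarrow> f x" by (rule tendsto_eventually)
      qed
    qed (auto simp: indicator_def)
    then show "(\<lambda>n. time_limit (X n) u) \<longlonglongrightarrow> u"
      by (simp add: 1 time_limit_abs_l2)
  qed
qed

section \<open>The truncated Fourier transform\<close>

text \<open>
  A truncated Fourier transform at \<open>\<xi>\<close> is the inner product with a truncated wave of frequency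
  \<open>\<xi>\<close>. Its linearity, its bounds and its continuity in both arguments come from this.
\<close>

definition wave :: "real \<Rightarrow> real \<Rightarrow> l2" where
  "wave N \<xi> = abs_l2 (\<lambda>x. indicator {-N..N} x * exp (\<i> * complex_of_real (x * \<xi>)))"

lemma sqint_wave: "sqint (\<lambda>x. indicator {-N..N} x * exp (\<i> * complex_of_real (x * \<xi>)))"
  by (rule sqint_bound[OF sqint_Icc[of 1 "- N" N]]) (auto simp: indicator_def)

lemma truncated_fourier_abs_l2:
  assumes "sqint f"
  shows "truncated_fourier N (abs_l2 f) \<xi> = complex_of_real (1 / sqrt (2 * pi)) *
    (LINT x|lborel. exp (- (\<i> * complex_of_real (x * \<xi>))) * (indicator {-N..N} x * f x))"
  using assms by (subst truncated_fourier.abs_eq)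
    (auto simp: set_lebesgue_integral_def indicator_def
      intro!: Bochner_Integration.integral_cong arg_cong[where f = "\<lambda>z. _ * z"])

lemma truncated_fourier_eq_cinner:
  "truncated_fourier N u \<xi> = complex_of_real (1 / sqrt (2 * pi)) * cinner_l2 u (wave N \<xi>)"
proof (cases u rule: l2_cases)
  case (1 f)
  show ?thesis
    unfolding 1(2) truncated_fourier_abs_l2[OF 1(1)] wave_def cinner_abs_l2[OF 1(1) sqint_wave]
    by (intro arg_cong[where f = "\<lambda>z. _ * z"] Bochner_Integration.integral_cong)
       (auto simp: indicator_def exp_cnj mult.commute)
qed

lemma integrable_truncation:
  assumes "sqint f"
  shows "integrable lborel (\<lambda>x. indicator {-N..N} x * f x)"
proof -
  have "integrable lborel (\<lambda>x. f x * cnj (1 * indicator {-N..N} x))"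
    by (intro square_integrable_mult assms sqint_Icc)
  moreover have "(\<lambda>x. f x * cnj (1 * indicator {-N..N} x)) = (\<lambda>x. indicator {-N..N} x * f x)"
    by (auto simp: indicator_def)
  ultimately show ?thesis by simp
qed

lemma truncated_fourier_add:
  "truncated_fourier N (u + v) \<xi> = truncated_fourier N u \<xi> + truncated_fourier N v \<xi>"
  by (simp add: truncated_fourier_eq_cinner cinner_add_left ring_distribs)

lemma truncated_fourier_diff:
  "truncated_fourier N (u - v) \<xi> = truncated_fourier N u \<xi> - truncated_fourier N v \<xi>"
  by (simp add: truncated_fourier_eq_cinner cinner_diff_left ring_distribs)

lemma truncated_fourier_scaleC:
  "truncated_fourier N (c *\<^sub>C u) \<xi> = c * truncated_fourier N u \<xi>"
  by (simp add: truncated_fourier_eq_cinner cinner_scaleC_left mult_ac)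

lemma time_limit_wave: "N \<le> M \<Longrightarrow> time_limit N (wave M \<xi>) = wave N \<xi>"
  unfolding wave_def time_limit_abs_l2[OF sqint_wave]
proof (rule abs_l2_cong[OF sqint_indicator_mult[OF sqint_wave]])
  assume "N \<le> M"
  show "AE x in lborel. indicator {- N<..<N} x * (indicator {- M..M} x * exp (\<i> * complex_of_real (x * \<xi>)))
      = indicator {- N..N} x * exp (\<i> * complex_of_real (x * \<xi>))"
    using AE_lborel_singleton[of N] AE_lborel_singleton[of "- N"]
    by eventually_elim (use \<open>N \<le> M\<close> in \<open>auto simp: indicator_def\<close>)
qed auto

lemma truncated_fourier_time_limit:
  "N \<le> M \<Longrightarrow> truncated_fourier M (time_limit N u) = truncated_fourier N u"
  by (rule ext) (simp add: truncated_fourier_eq_cinner cinner_time_limit time_limit_wave)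

lemma truncated_fourier_bound: "\<exists>C. \<forall>u \<xi>. cmod (truncated_fourier N u \<xi>) \<le> C * norm u"
proof (intro exI allI)
  fix u \<xi>
  have "norm (wave N \<xi>) \<le> norm (abs_l2 (\<lambda>x. 1 * indicator {-N..N} x))"
    unfolding wave_def
    by (rule norm_abs_l2_mono[OF sqint_Icc]) (auto simp: indicator_def)
  then have "cmod (cinner_l2 u (wave N \<xi>)) \<le> norm u * norm (abs_l2 (\<lambda>x. 1 * indicator {-N..N} x))"
    using cmod_cinner_le[of u "wave N \<xi>"] by (meson mult_left_mono norm_ge_zero order_trans)
  then show "cmod (truncated_fourier N u \<xi>)
      \<le> (1 / sqrt (2 * pi) * norm (abs_l2 (\<lambda>x. 1 * indicator {-N..N} x))) * norm u"
    by (simp add: truncated_fourier_eq_cinner norm_mult norm_divide divide_right_mono mult.commute)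
qed

text \<open>
  The uniformity in \<open>u\<close> is what makes bounded families of band limited functions equicontinuous.
\<close>

lemma truncated_fourier_lipschitz:
  "\<exists>C. \<forall>u \<xi> \<eta>. cmod (truncated_fourier N u \<xi> - truncated_fourier N u \<eta>) \<le> C * norm u * \<bar>\<xi> - \<eta>\<bar>"
proof (intro exI allI)
  fix u \<xi> \<eta>
  define I where "I = abs_l2 (\<lambda>x. 1 * indicator {-N..N} x)"
  have "norm (wave N \<xi> - wave N \<eta>) \<le> norm (complex_of_real (\<bar>\<xi> - \<eta>\<bar> * \<bar>N\<bar>) *\<^sub>C I)"
    unfolding wave_def I_def minus_abs_l2[OF sqint_wave sqint_wave] scaleC_abs_l2[OF sqint_Icc]
  proof (rule norm_abs_l2_mono[OF square_integrable_cmult[OF sqint_Icc]])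
    have "cmod (exp (\<i> * complex_of_real (x * \<xi>)) - exp (\<i> * complex_of_real (x * \<eta>))) \<le> \<bar>\<xi> - \<eta>\<bar> * \<bar>N\<bar>"
      if "\<bar>x\<bar> \<le> \<bar>N\<bar>" for x
    proof -
      have "cmod (exp (\<i> * complex_of_real (x * \<xi>)) - exp (\<i> * complex_of_real (x * \<eta>)))
         = cmod (exp (\<i> * complex_of_real (x * \<eta>)) * (iexp (x * (\<xi> - \<eta>)) - 1))"
        by (simp add: ring_distribs exp_diff)
      also have "\<dots> = cmod (iexp (x * (\<xi> - \<eta>)) - 1)" by (simp add: norm_mult)
      also have "\<dots> \<le> \<bar>x * (\<xi> - \<eta>)\<bar>"
        using iexp_approx1[of "x * (\<xi> - \<eta>)" 0] by simp
      also have "\<dots> \<le> \<bar>\<xi> - \<eta>\<bar> * \<bar>N\<bar>"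
        using mult_right_mono[OF that, of "\<bar>\<xi> - \<eta>\<bar>"] by (simp add: abs_mult mult.commute)
      finally show ?thesis .
    qed
    then show "AE x in lborel. cmod (indicator {-N..N} x * exp (\<i> * complex_of_real (x * \<xi>))
          - indicator {-N..N} x * exp (\<i> * complex_of_real (x * \<eta>)))
        \<le> cmod (complex_of_real (\<bar>\<xi> - \<eta>\<bar> * \<bar>N\<bar>) * (1 * indicator {-N..N} x))"
      by (intro AE_I2) (auto simp: indicator_def norm_mult)
  qed auto
  then have "norm (wave N \<xi> - wave N \<eta>) \<le> \<bar>\<xi> - \<eta>\<bar> * \<bar>N\<bar> * norm I"
    by (simp add: norm_mult)
  then have "cmod (cinner_l2 u (wave N \<xi> - wave N \<eta>)) \<le> norm u * (\<bar>\<xi> - \<eta>\<bar> * \<bar>N\<bar> * norm I)"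
    using cmod_cinner_le[of u "wave N \<xi> - wave N \<eta>"] by (meson mult_left_mono norm_ge_zero order_trans)
  moreover have "truncated_fourier N u \<xi> - truncated_fourier N u \<eta>
      = complex_of_real (1 / sqrt (2 * pi)) * cinner_l2 u (wave N \<xi> - wave N \<eta>)"
    by (simp add: truncated_fourier_eq_cinner cinner_diff_right ring_distribs)
  ultimately show "cmod (truncated_fourier N u \<xi> - truncated_fourier N u \<eta>)
      \<le> (1 / sqrt (2 * pi) * \<bar>N\<bar> * norm (abs_l2 (\<lambda>x. 1 * indicator {-N..N} x))) * norm u * \<bar>\<xi> - \<eta>\<bar>"
    by (simp add: norm_mult norm_divide divide_right_mono mult_ac I_def)
qed

lemma continuous_truncated_fourier: "continuous_on UNIV (truncated_fourier N u)"
proof -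
  obtain C where C: "\<And>u \<xi> \<eta>. cmod (truncated_fourier N u \<xi> - truncated_fourier N u \<eta>) \<le> C * norm u * \<bar>\<xi> - \<eta>\<bar>"
    using truncated_fourier_lipschitz by blast
  have "(\<bar>C\<bar> * norm u)-lipschitz_on UNIV (truncated_fourier N u)"
  proof (rule lipschitz_onI)
    fix \<xi> \<eta>
    have "C * norm u * \<bar>\<xi> - \<eta>\<bar> \<le> \<bar>C\<bar> * norm u * \<bar>\<xi> - \<eta>\<bar>"
      by (intro mult_right_mono) auto
    then show "dist (truncated_fourier N u \<xi>) (truncated_fourier N u \<eta>) \<le> \<bar>C\<bar> * norm u * dist \<xi> \<eta>"
      using C[of u \<xi> \<eta>] by (simp add: dist_norm)
  qed simp
  then show ?thesis by (rule lipschitz_on_continuous_on)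
qed

lemma truncated_fourier_measurable [measurable]: "truncated_fourier N u \<in> borel_measurable borel"
  by (rule borel_measurable_continuous_onI[OF continuous_truncated_fourier])

section \<open>Plancherel's theorem\<close>

lemma truncated_fourier_interval:
  assumes "- N \<le> a" "b \<le> N"
  shows "truncated_fourier N (abs_l2 (\<lambda>x. c * indicator {a<..b} x)) \<xi>
    = complex_of_real (1 / sqrt (2 * pi)) * c * interval_fourier a b \<xi>"
proof -
  have "cinner_l2 (abs_l2 (\<lambda>x. c * indicator {a<..b} x)) (wave N \<xi>) = c * interval_fourier a b \<xi>"
    unfolding wave_def cinner_abs_l2[OF sqint_Ioc sqint_wave] interval_fourier_def integral_mult_right_zero[symmetric]
    by (rule Bochner_Integration.integral_cong) (use assms in \<open>auto simp: indicator_def exp_cnj\<close>)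
  then show ?thesis by (simp add: truncated_fourier_eq_cinner)
qed

lemma time_limit_interval:
  "time_limit N (abs_l2 (\<lambda>x. c * indicator {a<..b} x)) = abs_l2 (\<lambda>x. c * indicator {max a (- N)<..min b N} x)"
  unfolding time_limit_abs_l2[OF sqint_Ioc]
proof (rule abs_l2_cong[OF sqint_indicator_mult[OF sqint_Ioc]])
  show "AE x in lborel. indicator {- N<..<N} x * (c * indicator {a<..b} x) = c * indicator {max a (- N)<..min b N} x"
    using AE_lborel_singleton[of N] by eventually_elim (auto simp: indicator_def)
qed auto

lemma cinner_interval:
  "cinner_l2 (abs_l2 (\<lambda>x. c * indicator {a<..b} x)) (abs_l2 (\<lambda>x. d * indicator {a'<..b'} x))
    = c * cnj d * measure lborel ({a'<..b'} \<inter> {a<..b})"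
proof -
  have "cinner_l2 (abs_l2 (\<lambda>x. c * indicator {a<..b} x)) (abs_l2 (\<lambda>x. d * indicator {a'<..b'} x))
      = (LINT x|lborel. (c * cnj d) * complex_of_real (indicator ({a'<..b'} \<inter> {a<..b}) x))"
    unfolding cinner_abs_l2[OF sqint_Ioc sqint_Ioc]
    by (rule Bochner_Integration.integral_cong) (auto simp: indicator_def)
  also have "\<dots> = c * cnj d * complex_of_real (LINT x|lborel. indicator ({a'<..b'} \<inter> {a<..b}) x)"
    by (simp only: integral_mult_right_zero integral_complex_of_real)
  finally show ?thesis by simp
qed

text \<open>
  Truncating an interval function at \<open>N\<close> gives another one, up to the null set \<open>{N}\<close>, so
  Parseval's identity for intervals applies.
\<close>

lemma interval_functions_plancherel:
  assumes "u \<in> interval_functions" "v \<in> interval_functions"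
  shows "sqint (truncated_fourier N u)"
    "cinner_l2 (abs_l2 (truncated_fourier N u)) (abs_l2 (truncated_fourier N v))
      = cinner_l2 (time_limit N u) (time_limit N v)"
proof -
  have *: "\<exists>c a b. time_limit N w = abs_l2 (\<lambda>x. c * indicator {a<..b} x) \<and>
      truncated_fourier N w = (\<lambda>\<xi>. complex_of_real (1 / sqrt (2 * pi)) * c * interval_fourier a b \<xi>)"
    if w: "w \<in> interval_functions" for w
  proof -
    from w obtain c a b where "w = abs_l2 (\<lambda>x. c * indicator {a<..b} x)"
      by (auto simp: interval_functions_def)
    then have t: "time_limit N w = abs_l2 (\<lambda>x. c * indicator {max a (- N)<..min b N} x)"
      by (simp add: time_limit_interval)
    moreover have "truncated_fourier N w = truncated_fourier N (time_limit N w)"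
      by (simp add: truncated_fourier_time_limit)
    moreover have "truncated_fourier N (time_limit N w) =
      (\<lambda>\<xi>. complex_of_real (1 / sqrt (2 * pi)) * c * interval_fourier (max a (- N)) (min b N) \<xi>)"
      unfolding t by (rule ext, rule truncated_fourier_interval) auto
    ultimately show ?thesis by metis
  qed
  obtain c a b where u: "time_limit N u = abs_l2 (\<lambda>x. c * indicator {a<..b} x)"
      "truncated_fourier N u = (\<lambda>\<xi>. complex_of_real (1 / sqrt (2 * pi)) * c * interval_fourier a b \<xi>)"
    using *[OF assms(1)] by blast
  obtain d a' b' where v: "time_limit N v = abs_l2 (\<lambda>x. d * indicator {a'<..b'} x)"
      "truncated_fourier N v = (\<lambda>\<xi>. complex_of_real (1 / sqrt (2 * pi)) * d * interval_fourier a' b' \<xi>)"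
    using *[OF assms(2)] by blast
  show "sqint (truncated_fourier N u)"
    unfolding u by (rule square_integrable_cmult[OF sqint_interval_fourier])
  have "cinner_l2 (abs_l2 (truncated_fourier N u)) (abs_l2 (truncated_fourier N v))
      = (LINT \<xi>|lborel. (c * cnj d / (2 * pi)) * (interval_fourier a b \<xi> * cnj (interval_fourier a' b' \<xi>)))"
    unfolding u v cinner_abs_l2[OF square_integrable_cmult[OF sqint_interval_fourier] square_integrable_cmult[OF sqint_interval_fourier]]
  proof (rule Bochner_Integration.integral_cong)
    have "complex_of_real (sqrt (2 * pi)) * complex_of_real (sqrt (2 * pi)) = 2 * pi"
      unfolding of_real_mult[symmetric] by simp
    then show "complex_of_real (1 / sqrt (2 * pi)) * c * interval_fourier a b \<xi>
        * cnj (complex_of_real (1 / sqrt (2 * pi)) * d * interval_fourier a' b' \<xi>)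
      = c * cnj d / (2 * pi) * (interval_fourier a b \<xi> * cnj (interval_fourier a' b' \<xi>))" for \<xi>
      by (simp add: field_simps del: real_sqrt_mult)
  qed simp
  also have "\<dots> = cinner_l2 (time_limit N u) (time_limit N v)"
    unfolding u v cinner_interval integral_mult_right_zero interval_parseval by simp
  finally show "cinner_l2 (abs_l2 (truncated_fourier N u)) (abs_l2 (truncated_fourier N v))
      = cinner_l2 (time_limit N u) (time_limit N v)" .
qed

lemma subspace_closure:
  fixes S :: "'a::real_normed_vector set"
  assumes S: "subspace S"
  shows "subspace (closure S)"
proof (rule subspaceI)
  show "0 \<in> closure S" using subspace_0[OF S] closure_subset by blast
next
  fix x y assume "x \<in> closure S" "y \<in> closure S"
  then obtain f g where "\<And>n. f n \<in> S" "f \<longlonglongrightarrow> x" "\<And>n. g n \<in> S" "g \<longlonglongrightarrow> y"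
    by (auto simp: closure_sequential)
  then have "\<And>n. f n + g n \<in> S" "(\<lambda>n. f n + g n) \<longlonglongrightarrow> x + y"
    by (auto intro: subspace_add[OF S] tendsto_add)
  then show "x + y \<in> closure S" unfolding closure_sequential by (intro exI[of _ "\<lambda>n. f n + g n"]) auto
next
  fix c x assume "x \<in> closure S"
  then obtain f where "\<And>n. f n \<in> S" "f \<longlonglongrightarrow> x" by (auto simp: closure_sequential)
  then have "\<And>n. c *\<^sub>R f n \<in> S" "(\<lambda>n. c *\<^sub>R f n) \<longlonglongrightarrow> c *\<^sub>R x"
    by (auto intro: subspace_scale[OF S] tendsto_scaleR)
  then show "c *\<^sub>R x \<in> closure S" unfolding closure_sequential by (intro exI[of _ "\<lambda>n. c *\<^sub>R f n"]) auto
qed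

lemma span_sqint_truncated_fourier:
  assumes "u \<in> span interval_functions"
  shows "sqint (truncated_fourier N u)"
  using assms
proof (rule span_induct)
  show "subspace {u. sqint (truncated_fourier N u)}"
  proof (rule subspaceI; unfold mem_Collect_eq)
    have "truncated_fourier N 0 = (\<lambda>_. 0)" by (auto simp: truncated_fourier_eq_cinner)
    then show "sqint (truncated_fourier N 0)" by simp
  next
    fix u v assume "sqint (truncated_fourier N u)" "sqint (truncated_fourier N v)"
    then have "sqint (\<lambda>\<xi>. truncated_fourier N u \<xi> + truncated_fourier N v \<xi>)"
      by (rule square_integrable_add)
    then show "sqint (truncated_fourier N (u + v))" by (simp add: truncated_fourier_add[abs_def])
  next
    fix r u assume "sqint (truncated_fourier N u)"
    then have "sqint (\<lambda>\<xi>. complex_of_real r * truncated_fourier N u \<xi>)"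
      by (rule square_integrable_cmult)
    then have "sqint (truncated_fourier N (complex_of_real r *\<^sub>C u))"
      by (simp add: truncated_fourier_scaleC[abs_def])
    then show "sqint (truncated_fourier N (r *\<^sub>R u))" by (simp add: scaleC_of_real)
  qed
qed (use interval_functions_plancherel(1) in blast)

lemma abs_l2_truncated_fourier_add:
  assumes "sqint (truncated_fourier N u)" "sqint (truncated_fourier N v)"
  shows "abs_l2 (truncated_fourier N (u + v)) = abs_l2 (truncated_fourier N u) + abs_l2 (truncated_fourier N v)"
  by (simp add: plus_abs_l2 assms truncated_fourier_add[abs_def])

lemma abs_l2_truncated_fourier_scaleC:
  assumes "sqint (truncated_fourier N u)"
  shows "abs_l2 (truncated_fourier N (c *\<^sub>C u)) = c *\<^sub>C abs_l2 (truncated_fourier N u)"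
  by (simp add: scaleC_abs_l2 assms truncated_fourier_scaleC[abs_def])

text \<open>
  The identity is sesquilinear, so it extends from generators to the span in one argument at a
  time; square integrability is carried along to make inner products additive.
\<close>

lemma span_plancherel:
  assumes "u \<in> span interval_functions" "v \<in> span interval_functions"
  shows "cinner_l2 (abs_l2 (truncated_fourier N u)) (abs_l2 (truncated_fourier N v))
      = cinner_l2 (time_limit N u) (time_limit N v)"
proof -
  define P where "P u v \<longleftrightarrow> sqint (truncated_fourier N u) \<and> sqint (truncated_fourier N v) \<and>
    cinner_l2 (abs_l2 (truncated_fourier N u)) (abs_l2 (truncated_fourier N v))
      = cinner_l2 (time_limit N u) (time_limit N v)" for u v
  have sc: "r *\<^sub>R x = complex_of_real r *\<^sub>C x" for r and x :: l2 by (simp add: scaleC_of_real)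
  have z: "truncated_fourier N 0 = (\<lambda>_. 0)"
    by (auto simp: truncated_fourier_eq_cinner)
  have right: "subspace {v. P u v}" if "sqint (truncated_fourier N u)" for u
    unfolding subspace_def mem_Collect_eq
    using that z
    by (auto simp: P_def plus_abs_l2[symmetric] scaleC_abs_l2[symmetric] sc
          cinner_add_right cinner_scaleC_right time_limit_simps zero_l2_abs[symmetric]
          truncated_fourier_add[abs_def] truncated_fourier_scaleC[abs_def]
          intro: square_integrable_add square_integrable_cmult)
  have left: "subspace {u. P u v}" if "sqint (truncated_fourier N v)" for v
    unfolding subspace_def mem_Collect_eq
    using that z
    by (auto simp: P_def plus_abs_l2[symmetric] scaleC_abs_l2[symmetric] sc
          cinner_add_left cinner_scaleC_left time_limit_simps zero_l2_abs[symmetric]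
          truncated_fourier_add[abs_def] truncated_fourier_scaleC[abs_def]
          intro: square_integrable_add square_integrable_cmult)
  have "P u v" if u: "u \<in> interval_functions" for u
    using assms(2)
  proof (rule span_induct)
    show "subspace {v. P u v}" by (rule right[OF interval_functions_plancherel(1)[OF u u]])
    show "P u w" if "w \<in> interval_functions" for w
      using interval_functions_plancherel[OF u that] interval_functions_plancherel(1)[OF that u]
      by (simp add: P_def)
  qed
  with assms(1) left[OF span_sqint_truncated_fourier[OF assms(2)]] have "P u v"
    by (rule span_induct)
  then show ?thesis by (simp add: P_def)
qed

text \<open>
  Approximate \<open>u\<close> by step functions. Their transforms form a Cauchy sequence by the isometry on
  the span, and they converge pointwise to the transform of \<open>u\<close>.
\<close>

theorem plancherel:
  shows "sqint (truncated_fourier N u)"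
    and "norm (abs_l2 (truncated_fourier N u)) = norm (time_limit N u)"
proof -
  have iso: "norm (abs_l2 (truncated_fourier N w)) = norm (time_limit N w)"
    if "w \<in> span interval_functions" for w
  proof -
    have "complex_of_real ((norm (abs_l2 (truncated_fourier N w)))\<^sup>2) = complex_of_real ((norm (time_limit N w))\<^sup>2)"
      using span_plancherel[OF that that] by (simp only: cinner_self)
    then show ?thesis
      by (simp only: of_real_eq_iff) (simp add: power2_eq_iff_nonneg)
  qed
  have "closure (span interval_functions) = UNIV"
    by (rule interval_functions_dense)
       (auto simp: subspace_closure subspace_span intro: closure_subset[THEN subsetD] span_base)
  then obtain w where w: "\<And>n. w n \<in> span interval_functions" "w \<longlonglongrightarrow> u"
    using closure_sequential[of u "span interval_functions"] by auto
  define X where "X n = abs_l2 (truncated_fourier N (w n))" for n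
  have dX: "norm (X m - X n) \<le> norm (w m - w n)" for m n
  proof -
    have d: "w m - w n \<in> span interval_functions" using w(1) by (intro span_diff)
    have "X m - X n = abs_l2 (truncated_fourier N (w m - w n))"
      by (simp add: X_def minus_abs_l2 span_sqint_truncated_fourier w(1) truncated_fourier_diff[abs_def])
    then show ?thesis using iso[OF d] norm_time_limit_le by simp
  qed
  have "Cauchy X"
  proof (rule CauchyI)
    fix e :: real assume "0 < e"
    then obtain M where "\<forall>m\<ge>M. \<forall>n\<ge>M. norm (w m - w n) < e"
      using CauchyD[OF LIMSEQ_imp_Cauchy[OF w(2)]] by blast
    then show "\<exists>M. \<forall>m\<ge>M. \<forall>n\<ge>M. norm (X m - X n) < e" using dX by (meson le_less_trans)
  qed
  then obtain L where L: "X \<longlonglongrightarrow> L" by (auto simp: Cauchy_convergent_iff convergent_def)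
  have pt: "(\<lambda>n. truncated_fourier N (w n) \<xi>) \<longlonglongrightarrow> truncated_fourier N u \<xi>" for \<xi>
    unfolding truncated_fourier_eq_cinner by (intro tendsto_mult tendsto_cinner tendsto_const w(2))
  note lim = AE_limit_eq_l2_limit[OF span_sqint_truncated_fourier[OF w(1)] truncated_fourier_measurable
      AE_I2[OF pt] L[unfolded X_def]]
  show "sqint (truncated_fourier N u)" by (rule lim(1))
  have "(\<lambda>n. norm (X n)) \<longlonglongrightarrow> norm L" by (rule tendsto_norm[OF L])
  moreover have "(\<lambda>n. norm (X n)) \<longlonglongrightarrow> norm (time_limit N u)"
    unfolding X_def iso[OF w(1)]
    by (intro tendsto_norm bounded_clinear_l2_tendsto[OF bounded_clinear_time_limit] w(2))
  ultimately show "norm (abs_l2 (truncated_fourier N u)) = norm (time_limit N u)"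
    unfolding lim(2) by (rule LIMSEQ_unique)
qed

section \<open>The Fourier transform on \<open>L\<^sup>2\<close>\<close>

definition truncated_fourier_l2 :: "real \<Rightarrow> l2 \<Rightarrow> l2" where
  "truncated_fourier_l2 N u = abs_l2 (truncated_fourier N u)"

lemma norm_truncated_fourier_l2: "norm (truncated_fourier_l2 N u) = norm (time_limit N u)"
  by (simp add: truncated_fourier_l2_def plancherel)

lemma bounded_clinear_truncated_fourier_l2: "bounded_clinear_l2 (truncated_fourier_l2 N)"
  by (rule bounded_clinear_l2I[where K = 1])
     (simp_all add: truncated_fourier_l2_def abs_l2_truncated_fourier_add abs_l2_truncated_fourier_scaleC
        plancherel norm_time_limit_le)

lemma truncated_fourier_l2_time_limit:
  "N \<le> M \<Longrightarrow> truncated_fourier_l2 M (time_limit N u) = truncated_fourier_l2 N u"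
  by (simp add: truncated_fourier_l2_def truncated_fourier_time_limit)

text \<open>
  The operator \<open>fourier_l2\<close> is defined by a limit operator that returns an arbitrary value if there is no limit.
  By Plancherel's theorem the truncated transforms differ from each other by no more than the
  tails of \<open>u\<close>, so the limit exists.
\<close>

lemma tendsto_fourier_l2: "((\<lambda>N. truncated_fourier_l2 N u) \<longlongrightarrow> fourier_l2 u) at_top"
proof -
  have diff: "norm (truncated_fourier_l2 N u - truncated_fourier_l2 M u) \<le> norm (u - time_limit M u)"
    if "M \<le> N" for M N
  proof -
    have "truncated_fourier_l2 N u - truncated_fourier_l2 M u = truncated_fourier_l2 N (u - time_limit M u)"
      using that by (simp add: bounded_clinear_l2D[OF bounded_clinear_truncated_fourier_l2] truncated_fourier_l2_time_limit)
    then show ?thesis using norm_time_limit_le by (simp add: norm_truncated_fourier_l2)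
  qed
  have tail: "((\<lambda>N. norm (u - time_limit N u)) \<longlongrightarrow> 0) at_top"
    using tendsto_norm[OF tendsto_diff[OF tendsto_const tendsto_time_limit, of u u]] by simp
  have "Cauchy (\<lambda>n. truncated_fourier_l2 (real n) u)"
  proof (rule CauchyI)
    fix e :: real assume "0 < e"
    then have "eventually (\<lambda>N. norm (u - time_limit N u) < e / 2) at_top"
      using order_tendstoD(2)[OF tail, of "e / 2"] by simp
    then obtain K where "\<And>N. N \<ge> K \<Longrightarrow> norm (u - time_limit N u) < e / 2"
      by (auto simp: eventually_at_top_linorder)
    moreover define k where "k = nat \<lceil>K\<rceil>"
    ultimately have K: "norm (u - time_limit (real k) u) < e / 2" by (simp add: real_nat_ceiling_ge)
    have "norm (truncated_fourier_l2 (real m) u - truncated_fourier_l2 (real n) u) < e"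
      if "m \<ge> k" "n \<ge> k" for m n
    proof -
      have "norm (truncated_fourier_l2 (real m) u - truncated_fourier_l2 (real n) u)
          \<le> norm (truncated_fourier_l2 (real m) u - truncated_fourier_l2 (real k) u)
            + norm (truncated_fourier_l2 (real n) u - truncated_fourier_l2 (real k) u)"
        using norm_triangle_ineq4[of "truncated_fourier_l2 (real m) u - truncated_fourier_l2 (real k) u"
            "truncated_fourier_l2 (real n) u - truncated_fourier_l2 (real k) u"] by simp
      then show ?thesis
        using diff[of "real k" "real m"] diff[of "real k" "real n"] that K
        unfolding of_nat_le_iff by linarith
    qed
    then show "\<exists>M. \<forall>m\<ge>M. \<forall>n\<ge>M. norm (truncated_fourier_l2 (real m) u - truncated_fourier_l2 (real n) u) < e"
      by blast
  qed
  then obtain L where L: "(\<lambda>n. truncated_fourier_l2 (real n) u) \<longlonglongrightarrow> L"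
    by (auto simp: Cauchy_convergent_iff convergent_def)
  have "norm (L - truncated_fourier_l2 M u) \<le> norm (u - time_limit M u)" for M
  proof (rule Lim_bounded)
    show "(\<lambda>n. norm (truncated_fourier_l2 (real n) u - truncated_fourier_l2 M u)) \<longlonglongrightarrow> norm (L - truncated_fourier_l2 M u)"
      by (intro tendsto_intros L)
    show "\<forall>n\<ge>nat \<lceil>M\<rceil>. norm (truncated_fourier_l2 (real n) u - truncated_fourier_l2 M u) \<le> norm (u - time_limit M u)"
      by (auto intro!: diff simp: nat_ceiling_le_eq)
  qed
  then have "((\<lambda>M. truncated_fourier_l2 M u) \<longlongrightarrow> L) at_top"
    by (intro metric_tendsto_imp_tendsto[OF tail]) (auto simp: dist_norm norm_minus_commute)
  moreover from this have "fourier_l2 u = L"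
    unfolding fourier_l2_def truncated_fourier_l2_def by (intro tendsto_Lim) auto
  ultimately show ?thesis by simp
qed

lemma norm_fourier_l2 [simp]: "norm (fourier_l2 u) = norm u"
proof -
  have "((\<lambda>N. norm (truncated_fourier_l2 N u)) \<longlongrightarrow> norm (fourier_l2 u)) at_top"
    by (intro tendsto_norm tendsto_fourier_l2)
  moreover have "((\<lambda>N. norm (truncated_fourier_l2 N u)) \<longlongrightarrow> norm u) at_top"
    unfolding norm_truncated_fourier_l2 by (intro tendsto_norm tendsto_time_limit)
  ultimately show ?thesis using tendsto_unique by (metis trivial_limit_at_top_linorder)
qed

lemma bounded_clinear_fourier_l2: "bounded_clinear_l2 fourier_l2"
proof (rule bounded_clinear_l2I[where K = 1])
  note tf = bounded_clinear_l2D[OF bounded_clinear_truncated_fourier_l2]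
  have "((\<lambda>N. truncated_fourier_l2 N (u + v)) \<longlongrightarrow> fourier_l2 u + fourier_l2 v) at_top" for u v
    unfolding tf by (intro tendsto_add tendsto_fourier_l2)
  then show "fourier_l2 (u + v) = fourier_l2 u + fourier_l2 v" for u v
    using tendsto_unique[OF trivial_limit_at_top_linorder tendsto_fourier_l2] by blast
  have "((\<lambda>N. truncated_fourier_l2 N (c *\<^sub>C u)) \<longlongrightarrow> c *\<^sub>C fourier_l2 u) at_top" for c u
    unfolding tf by (intro bounded_linear.tendsto[OF bounded_linear_scaleC] tendsto_fourier_l2)
  then show "fourier_l2 (c *\<^sub>C u) = c *\<^sub>C fourier_l2 u" for c u
    using tendsto_unique[OF trivial_limit_at_top_linorder tendsto_fourier_l2] by blast
qed simp

lemma fourier_l2_time_limit: "fourier_l2 (time_limit M u) = truncated_fourier_l2 M u"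
proof -
  have "eventually (\<lambda>N. truncated_fourier_l2 N (time_limit M u) = truncated_fourier_l2 M u) at_top"
    using eventually_ge_at_top[of M] by eventually_elim (rule truncated_fourier_l2_time_limit)
  then have "((\<lambda>N. truncated_fourier_l2 N (time_limit M u)) \<longlongrightarrow> truncated_fourier_l2 M u) at_top"
    by (rule tendsto_eventually)
  then show ?thesis
    using tendsto_unique[OF trivial_limit_at_top_linorder tendsto_fourier_l2] by blast
qed

text \<open>
  Polarization of the isometry.
\<close>

lemma cinner_fourier_l2: "cinner_l2 (fourier_l2 u) (fourier_l2 v) = cinner_l2 u v"
proof -
  note F = bounded_clinear_l2D[OF bounded_clinear_fourier_l2]
  have "inner (fourier_l2 u) (fourier_l2 v) = inner u v" for u v
    unfolding dot_norm F(1)[symmetric] norm_fourier_l2 ..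
  then show ?thesis unfolding cinner_eq_inner F(3)[symmetric] by simp
qed

subsection \<open>Conjugation and the adjoint\<close>

lift_definition cnj_l2 :: "l2 \<Rightarrow> l2" is "\<lambda>f x. cnj (f x)"
  by (auto simp: sqint_cnj)

lemma cnj_abs_l2: "sqint f \<Longrightarrow> cnj_l2 (abs_l2 f) = abs_l2 (\<lambda>x. cnj (f x))"
  by (simp add: cnj_l2.abs_eq)

lemma cnj_cnj_l2 [simp]: "cnj_l2 (cnj_l2 u) = u"
  by (cases u rule: l2_cases) (simp add: cnj_abs_l2 sqint_cnj)

lemma cnj_l2_add: "cnj_l2 (u + v) = cnj_l2 u + cnj_l2 v"
proof -
  obtain f where f: "sqint f" "u = abs_l2 f" by (rule l2_cases)
  obtain g where g: "sqint g" "v = abs_l2 g" by (rule l2_cases)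
  show ?thesis by (simp add: f g cnj_abs_l2 plus_abs_l2 sqint_cnj square_integrable_add)
qed

lemma cnj_l2_scaleC: "cnj_l2 (c *\<^sub>C u) = cnj c *\<^sub>C cnj_l2 u"
  by (cases u rule: l2_cases) (simp add: cnj_abs_l2 scaleC_abs_l2 sqint_cnj square_integrable_cmult)

lemma norm_cnj_l2 [simp]: "norm (cnj_l2 u) = norm u"
proof -
  obtain f where f: "sqint f" "u = abs_l2 f" by (rule l2_cases)
  have "(norm (cnj_l2 u))\<^sup>2 = (norm u)\<^sup>2"
    by (simp add: f cnj_abs_l2 norm_abs_l2_square sqint_cnj)
  then show ?thesis by (simp add: power2_eq_iff_nonneg)
qed

lemma cnj_l2_diff: "cnj_l2 (u - v) = cnj_l2 u - cnj_l2 v"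
  using cnj_l2_add[of "u - v" v] by (simp add: algebra_simps)

lemma cnj_l2_eq_0_iff [simp]: "cnj_l2 u = 0 \<longleftrightarrow> u = 0"
  by (metis norm_cnj_l2 norm_eq_zero)

lemma tendsto_cnj_l2: "(f \<longlongrightarrow> a) F \<Longrightarrow> ((\<lambda>x. cnj_l2 (f x)) \<longlongrightarrow> cnj_l2 a) F"
  by (erule metric_tendsto_imp_tendsto) (simp add: dist_norm cnj_l2_diff[symmetric])

lemma time_limit_cnj_l2: "time_limit N (cnj_l2 u) = cnj_l2 (time_limit N u)"
proof (cases u rule: l2_cases)
  case (1 f)
  show ?thesis
    by (simp add: 1 cnj_abs_l2 time_limit_abs_l2 sqint_cnj sqint_indicator_mult)
       (rule arg_cong[where f = abs_l2], auto simp: indicator_def)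
qed

text \<open>
  The kernel \<open>exp (- \<i> x \<xi>)\<close> is symmetric, so conjugating the kernel to get the adjoint amounts to
  conjugating argument and value of the transform itself.
\<close>

definition inverse_fourier_l2 :: "l2 \<Rightarrow> l2" where
  "inverse_fourier_l2 u = cnj_l2 (fourier_l2 (cnj_l2 u))"

text \<open>
  For functions of bounded support the adjoint is found by exchanging the order of integration; the
  integrand \<open>e x \<xi> * a x * b \<xi>\<close> is integrable as \<open>a\<close> and \<open>b\<close> are.
\<close>

lemma cinner_truncated_fourier:
  "cinner_l2 (truncated_fourier_l2 N u) (time_limit M v)
    = cinner_l2 (time_limit N u) (cnj_l2 (truncated_fourier_l2 M (cnj_l2 v)))"
proof -
  obtain f where f: "sqint f" "u = abs_l2 f" by (rule l2_cases)
  obtain g where g: "sqint g" "v = abs_l2 g" by (rule l2_cases)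
  have [measurable]: "f \<in> borel_measurable borel" "g \<in> borel_measurable borel"
    using f g by (auto simp: sqint_measurable)
  define a where "a x = indicator {-N..N} x * f x" for x
  define b where "b x = indicator {-M..M} x * cnj (g x)" for x
  have [measurable]: "a \<in> borel_measurable borel" "b \<in> borel_measurable borel"
    unfolding a_def b_def by (auto intro!: borel_measurable_cnj)
  have ab: "integrable lborel a" "integrable lborel b"
    unfolding a_def b_def by (intro integrable_truncation f(1) sqint_cnj[OF g(1)])+
  define e where "e x \<xi> = exp (- (\<i> * complex_of_real (x * \<xi>)))" for x \<xi> :: real
  have e_sym: "e x \<xi> = e \<xi> x" for x \<xi> by (simp add: e_def mult.commute)
  have [measurable]: "(\<lambda>p. e (fst p) (snd p)) \<in> borel_measurable (lborel \<Otimes>\<^sub>M lborel)"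
    unfolding e_def by measurable
  have "integrable (lborel \<Otimes>\<^sub>M lborel) (\<lambda>p. e (fst p) (snd p) * a (fst p) * b (snd p))"
  proof (rule lborel_pair.Fubini_integrable)
    have "integrable lborel (\<lambda>x. cmod (a x) * (LINT y|lborel. cmod (b y)))"
      using ab by (intro integrable_mult_left integrable_norm) auto
    then show "integrable lborel (\<lambda>x. LINT y|lborel. cmod (e (fst (x, y)) (snd (x, y)) * a (fst (x, y)) * b (snd (x, y))))"
      by (simp add: norm_mult e_def)
    show "AE x in lborel. integrable lborel (\<lambda>y. e (fst (x, y)) (snd (x, y)) * a (fst (x, y)) * b (snd (x, y)))"
    proof (rule AE_I2)
      fix x
      have "integrable lborel (\<lambda>y. a x * b y)" using ab by simp
      then show "integrable lborel (\<lambda>y. e (fst (x, y)) (snd (x, y)) * a (fst (x, y)) * b (snd (x, y)))"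
        by (rule Bochner_Integration.integrable_bound) (auto simp: e_def norm_mult)
    qed
  qed measurable
  then have fub: "(LINT y|lborel. LINT x|lborel. e x y * a x * b y) = (LINT x|lborel. LINT y|lborel. e x y * a x * b y)"
    by (intro lborel_pair.Fubini_integral) (simp add: case_prod_beta')
  define k where "k = complex_of_real (1 / sqrt (2 * pi))"
  have k: "cnj k = k" by (simp add: k_def)
  have tf: "truncated_fourier N u \<xi> = k * (LINT x|lborel. e x \<xi> * a x)" for \<xi>
    unfolding f(2) truncated_fourier_abs_l2[OF f(1)] k_def e_def a_def ..
  have tg: "truncated_fourier M (cnj_l2 v) \<xi> = k * (LINT x|lborel. e x \<xi> * b x)" for \<xi>
    unfolding g(2) cnj_abs_l2[OF g(1)] truncated_fourier_abs_l2[OF sqint_cnj[OF g(1)]] k_def e_def b_def ..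
  have "cinner_l2 (truncated_fourier_l2 N u) (time_limit M v)
      = (LINT \<xi>|lborel. truncated_fourier N u \<xi> * cnj (indicator {-M<..<M} \<xi> * g \<xi>))"
    unfolding truncated_fourier_l2_def g(2) time_limit_abs_l2[OF g(1)]
    by (rule cinner_abs_l2[OF plancherel(1) sqint_indicator_mult[OF g(1)]]) simp
  also have "\<dots> = (LINT \<xi>|lborel. k * (LINT x|lborel. e x \<xi> * a x * b \<xi>))"
  proof (rule integral_cong_AE)
    show "AE \<xi> in lborel. truncated_fourier N u \<xi> * cnj (indicator {-M<..<M} \<xi> * g \<xi>)
        = k * (LINT x|lborel. e x \<xi> * a x * b \<xi>)"
      using AE_lborel_singleton[of M] AE_lborel_singleton[of "- M"]
      by eventually_elim (auto simp: tf b_def indicator_def)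
  qed (unfold e_def, measurable)
  also have "\<dots> = k * (LINT \<xi>|lborel. LINT x|lborel. e x \<xi> * a x * b \<xi>)"
    by simp
  also have "\<dots> = k * (LINT x|lborel. LINT \<xi>|lborel. e x \<xi> * a x * b \<xi>)"
    by (simp only: fub)
  also have "\<dots> = (LINT x|lborel. k * (LINT \<xi>|lborel. a x * (e \<xi> x * b \<xi>)))"
    by (simp add: e_sym mult_ac)
  also have "\<dots> = (LINT x|lborel. (indicator {-N<..<N} x * f x) * cnj (cnj (truncated_fourier M (cnj_l2 v) x)))"
  proof (rule integral_cong_AE)
    show "AE x in lborel. k * (LINT \<xi>|lborel. a x * (e \<xi> x * b \<xi>))
        = (indicator {-N<..<N} x * f x) * cnj (cnj (truncated_fourier M (cnj_l2 v) x))"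
      using AE_lborel_singleton[of N] AE_lborel_singleton[of "- N"]
      by eventually_elim (auto simp: tg a_def indicator_def)
  qed (unfold e_def, measurable)
  also have "\<dots> = cinner_l2 (time_limit N u) (cnj_l2 (truncated_fourier_l2 M (cnj_l2 v)))"
    unfolding truncated_fourier_l2_def cnj_abs_l2[OF plancherel(1)] f(2) time_limit_abs_l2[OF f(1)]
    by (rule cinner_abs_l2[symmetric, OF sqint_indicator_mult[OF f(1)] sqint_cnj[OF plancherel(1)]]) simp
  finally show ?thesis .
qed

lemma cinner_fourier_adjoint: "cinner_l2 (fourier_l2 u) v = cinner_l2 u (inverse_fourier_l2 v)"
proof -
  have 1: "cinner_l2 (truncated_fourier_l2 N u) v = cinner_l2 (time_limit N u) (inverse_fourier_l2 v)" for N
  proof (rule tendsto_unique[OF trivial_limit_at_top_linorder])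
    show "((\<lambda>M. cinner_l2 (truncated_fourier_l2 N u) (time_limit M v))
        \<longlongrightarrow> cinner_l2 (truncated_fourier_l2 N u) v) at_top"
      by (intro tendsto_cinner tendsto_const tendsto_time_limit)
    show "((\<lambda>M. cinner_l2 (truncated_fourier_l2 N u) (time_limit M v))
        \<longlongrightarrow> cinner_l2 (time_limit N u) (inverse_fourier_l2 v)) at_top"
      unfolding cinner_truncated_fourier inverse_fourier_l2_def
      by (intro tendsto_cinner tendsto_const tendsto_cnj_l2 tendsto_fourier_l2)
  qed
  show ?thesis
  proof (rule tendsto_unique[OF trivial_limit_at_top_linorder])
    show "((\<lambda>N. cinner_l2 (truncated_fourier_l2 N u) v) \<longlongrightarrow> cinner_l2 (fourier_l2 u) v) at_top"
      by (intro tendsto_cinner tendsto_const tendsto_fourier_l2)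
    show "((\<lambda>N. cinner_l2 (truncated_fourier_l2 N u) v) \<longlongrightarrow> cinner_l2 u (inverse_fourier_l2 v)) at_top"
      unfolding 1 by (intro tendsto_cinner tendsto_const tendsto_time_limit)
  qed
qed

lemma hilbert_adjointI:
  assumes "\<And>f g. cinner_l2 (A f) g = cinner_l2 f (B g)"
  shows "hilbert_adjoint A = B"
  unfolding hilbert_adjoint_def
proof (rule the_equality)
  fix B' assume "\<forall>f g. cinner_l2 (A f) g = cinner_l2 f (B' g)"
  then have "cinner_l2 (B' g) f = cinner_l2 (B g) f" for f g
    using assms by (metis cinner_cnj)
  then show "B' = B" by (intro ext cinner_ext)
qed (use assms in blast)

lemma band_limit_eq: "band_limit \<omega> u = fourier_l2 (time_limit \<omega> (inverse_fourier_l2 u))"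
  unfolding band_limit_def hilbert_adjointI[OF cinner_fourier_adjoint] by simp

lemma norm_inverse_fourier_l2 [simp]: "norm (inverse_fourier_l2 u) = norm u"
  by (simp add: inverse_fourier_l2_def)

lemma bounded_clinear_inverse_fourier_l2: "bounded_clinear_l2 inverse_fourier_l2"
  by (rule bounded_clinear_l2I[where K = 1])
     (simp_all add: inverse_fourier_l2_def cnj_l2_add cnj_l2_scaleC bounded_clinear_l2D[OF bounded_clinear_fourier_l2])

lemma inverse_fourier_fourier [simp]: "inverse_fourier_l2 (fourier_l2 u) = u"
proof (rule cinner_ext)
  fix w
  have "cinner_l2 w (inverse_fourier_l2 (fourier_l2 u)) = cinner_l2 w u"
    by (simp only: cinner_fourier_adjoint[symmetric] cinner_fourier_l2)
  then show "cinner_l2 (inverse_fourier_l2 (fourier_l2 u)) w = cinner_l2 u w"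
    by (metis cinner_cnj)
qed

lemma inverse_fourier_time_limit:
  "inverse_fourier_l2 (time_limit N u) = cnj_l2 (truncated_fourier_l2 N (cnj_l2 u))"
  by (simp add: inverse_fourier_l2_def time_limit_cnj_l2[symmetric] fourier_l2_time_limit)

lemma bounded_clinear_band_limit: "bounded_clinear_l2 (band_limit \<omega>)"
  unfolding band_limit_eq[abs_def]
  by (intro bounded_clinear_l2_comp[OF bounded_clinear_fourier_l2]
        bounded_clinear_l2_comp[OF bounded_clinear_time_limit] bounded_clinear_inverse_fourier_l2)

lemma band_limit_idem [simp]: "band_limit \<omega> (band_limit \<omega> u) = band_limit \<omega> u"
  by (simp add: band_limit_eq)

lemma cinner_band_limit_left:
  "cinner_l2 (band_limit \<omega> u) v = cinner_l2 (time_limit \<omega> (inverse_fourier_l2 u)) (time_limit \<omega> (inverse_fourier_l2 v))"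
  by (simp add: band_limit_eq cinner_fourier_adjoint cinner_time_limit[symmetric])

lemma cinner_band_limit: "cinner_l2 (band_limit \<omega> u) v = cinner_l2 u (band_limit \<omega> v)"
  by (metis cinner_band_limit_left cinner_cnj)

section \<open>Unique continuation for band limited functions\<close>

text \<open>
  On the bounded support the exponential series may be integrated term by term, which turns the
  transform into an everywhere convergent power series in the frequency.
\<close>

lemma truncated_fourier_entire:
  "\<exists>g. g holomorphic_on UNIV \<and> (\<forall>\<xi>. g (complex_of_real \<xi>) = truncated_fourier N u \<xi>)"
proof (cases u rule: l2_cases)
  case (1 f)
  have [measurable]: "f \<in> borel_measurable borel" using 1 by (simp add: sqint_measurable)
  define a where "a x = indicator {-N..N} x * f x" for x
  have am [measurable]: "a \<in> borel_measurable borel" unfolding a_def by measurable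
  have ai: "integrable lborel a" unfolding a_def by (rule integrable_truncation[OF 1(1)])
  define k where "k = complex_of_real (1 / sqrt (2 * pi))"
  define g where "g z = k * (LINT x|lborel. exp (- (\<i> * (x * z))) * a x)" for z
  define c where "c n = k * (LINT x|lborel. (- \<i> * x) ^ n / fact n * a x)" for n
  have ps: "(\<lambda>n. c n * (z - 0) ^ n) sums g z" for z
  proof -
    define t where "t n x = (- (\<i> * (x * z))) ^ n / fact n * a x" for n and x :: real
    have bd: "cmod (t n x) \<le> (\<bar>N\<bar> * cmod z) ^ n / fact n * cmod (a x)" for n x
    proof (cases "x \<in> {-N..N}")
      case True
      then have "(\<bar>x\<bar> * cmod z) ^ n \<le> (\<bar>N\<bar> * cmod z) ^ n"
        by (intro power_mono mult_right_mono) auto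
      then have "(\<bar>x\<bar> * cmod z) ^ n / fact n * cmod (a x) \<le> (\<bar>N\<bar> * cmod z) ^ n / fact n * cmod (a x)"
        by (intro mult_right_mono divide_right_mono) auto
      then show ?thesis by (simp add: t_def norm_mult norm_divide norm_power)
    qed (simp add: t_def a_def)
    have tm [measurable]: "t n \<in> borel_measurable borel" for n unfolding t_def by measurable
    have bi: "integrable lborel (\<lambda>x. (\<bar>N\<bar> * cmod z) ^ n / fact n * cmod (a x))" for n
      using ai by simp
    have ti: "integrable lborel (t n)" for n
      by (rule Bochner_Integration.integrable_bound[OF bi[of n]]) (use bd[of n] in auto)
    have s1: "summable (\<lambda>n. (\<bar>N\<bar> * cmod z) ^ n / fact n * r)" for r
      using summable_mult2[OF summable_exp[of "\<bar>N\<bar> * cmod z"], of r] by (simp add: field_simps)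
    have "(\<lambda>n. integral\<^sup>L lborel (t n)) sums (LINT x|lborel. (\<Sum>n. t n x))"
    proof (rule sums_integral[OF ti])
      show "AE x in lborel. summable (\<lambda>n. cmod (t n x))"
      proof (rule AE_I2)
        fix x show "summable (\<lambda>n. cmod (t n x))"
          by (rule summable_comparison_test_ev[OF _ s1[of "cmod (a x)"]]) (use bd[of _ x] in simp)
      qed
      show "summable (\<lambda>n. LINT x|lborel. cmod (t n x))"
      proof (rule summable_comparison_test_ev[OF _ s1[of "LINT x|lborel. cmod (a x)"]], intro always_eventually allI)
        fix n
        have "(LINT x|lborel. cmod (t n x)) \<le> (LINT x|lborel. (\<bar>N\<bar> * cmod z) ^ n / fact n * cmod (a x))"
          by (intro integral_mono integrable_norm ti bi bd)
        then show "norm (LINT x|lborel. cmod (t n x)) \<le> (\<bar>N\<bar> * cmod z) ^ n / fact n * (LINT x|lborel. cmod (a x))"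
          by (simp del: divide_const_simps)
      qed
    qed
    moreover have "(\<Sum>n. t n x) = exp (- (\<i> * (x * z))) * a x" for x
    proof -
      have "(\<lambda>n. (- (\<i> * (x * z))) ^ n /\<^sub>R fact n) sums exp (- (\<i> * (x * z)))" by (rule exp_converges)
      then have "(\<lambda>n. t n x) sums (exp (- (\<i> * (x * z))) * a x)"
        unfolding t_def by (intro sums_mult2) (simp add: scaleR_conv_of_real divide_inverse mult.commute)
      then show ?thesis by (rule sums_unique[symmetric])
    qed
    ultimately have "(\<lambda>n. k * integral\<^sup>L lborel (t n)) sums g z"
      unfolding g_def by (intro sums_mult) simp
    moreover have "k * integral\<^sup>L lborel (t n) = c n * (z - 0) ^ n" for n
    proof -
      have "integral\<^sup>L lborel (t n) = (LINT x|lborel. (- \<i> * x) ^ n / fact n * a x * z ^ n)"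
        by (rule Bochner_Integration.integral_cong)
           (auto simp: t_def power_mult_distrib[symmetric] mult_ac)
      then show ?thesis by (simp add: c_def)
    qed
    ultimately show ?thesis by simp
  qed
  have "g holomorphic_on ball 0 r" for r
    by (rule power_series_holomorphic[of 0 r c]) (rule ps)
  moreover have "UNIV = (\<Union>r. ball (0::complex) r)"
    using lt_ex by (auto intro: gt_ex)
  ultimately have "g holomorphic_on UNIV"
    by (metis holomorphic_on_UN_open open_ball)
  moreover have "g (complex_of_real \<xi>) = truncated_fourier N u \<xi>" for \<xi>
    unfolding 1(2) truncated_fourier_abs_l2[OF 1(1)] g_def k_def a_def by simp
  ultimately show ?thesis by blast
qed

text \<open>
  By continuity the transform vanishes everywhere on the interval, hence so does its entire
  extension on the whole plane, and Plancherel's theorem gives \<open>u = 0\<close>.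
\<close>

lemma truncated_fourier_unique_continuation:
  assumes u: "time_limit N u = u" and "a < b"
    and ae: "AE \<xi> in lborel. \<xi> \<in> {a<..<b} \<longrightarrow> truncated_fourier N u \<xi> = 0"
  shows "u = 0"
proof -
  have z: "truncated_fourier N u \<xi> = 0" if "\<xi> \<in> {a<..<b}" for \<xi>
  proof (rule ccontr)
    assume nz: "truncated_fourier N u \<xi> \<noteq> 0"
    define S where "S = {a<..<b} \<inter> truncated_fourier N u -` (- {0})"
    have S: "open S"
      unfolding S_def using continuous_open_preimage[OF continuous_on_subset[OF continuous_truncated_fourier]]
      by (metis open_greaterThanLessThan open_Compl closed_singleton subset_UNIV)
    have "AE \<xi> in lborel. \<xi> \<notin> S" using ae by eventually_elim (auto simp: S_def)
    then have "S \<in> null_sets lborel" using S by (subst AE_iff_null_sets) auto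
    then have "negligible S" by (simp add: negligible_iff_null_sets null_sets_completionI)
    then have "S = {}" using open_not_negligible[OF S] by blast
    then show False using nz that by (auto simp: S_def)
  qed
  obtain g where g: "g holomorphic_on UNIV" "\<And>\<xi>. g (complex_of_real \<xi>) = truncated_fourier N u \<xi>"
    using truncated_fourier_entire[of N u] by blast
  define m where "m = (a + b) / 2"
  have lim: "complex_of_real m islimpt (complex_of_real ` {a<..<b})"
    unfolding islimpt_approachable
  proof (intro allI impI)
    fix e :: real assume "0 < e"
    \<comment> \<open>close to the midpoint and inside the interval\<close>
    define y where "y = m + min (e / 2) ((b - a) / 4)"
    have "y \<in> {a<..<b}" "y \<noteq> m" "\<bar>y - m\<bar> < e"
      using \<open>0 < e\<close> \<open>a < b\<close> by (auto simp: y_def m_def min_def field_simps)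
    then show "\<exists>x'\<in>complex_of_real ` {a<..<b}. x' \<noteq> complex_of_real m \<and> dist x' (complex_of_real m) < e"
      by (intro bexI[of _ "complex_of_real y"]) (auto simp: dist_norm norm_of_real simp flip: of_real_diff)
  qed
  have "g w = 0" for w
    by (rule analytic_continuation[OF g(1) open_UNIV connected_UNIV _ _ lim]) (auto simp: g(2) z)
  then have "truncated_fourier N u = (\<lambda>_. 0)" using g(2) by auto
  then have "norm (time_limit N u) = 0"
    using plancherel(2)[of N u] by (simp add: zero_l2_abs[symmetric])
  then show ?thesis using u by simp
qed

lemma inverse_fourier_eq_cnj:
  assumes "time_limit \<tau> u = u"
  shows "inverse_fourier_l2 u = cnj_l2 (truncated_fourier_l2 \<tau> (cnj_l2 u))"
  using inverse_fourier_time_limit[of \<tau> u] assms by simp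

text \<open>
  This makes the eigenvalues of the compressed operator positive.
\<close>

lemma time_limited_vanishing_on_band_eq_0:
  assumes u: "time_limit \<tau> u = u" and "\<omega> > 0" and z: "time_limit \<omega> (inverse_fourier_l2 u) = 0"
  shows "u = 0"
proof -
  have "cnj_l2 (time_limit \<omega> (truncated_fourier_l2 \<tau> (cnj_l2 u))) = 0"
    using z by (simp add: inverse_fourier_eq_cnj[OF u] time_limit_cnj_l2)
  then have "time_limit \<omega> (truncated_fourier_l2 \<tau> (cnj_l2 u)) = 0" by simp
  then have "AE \<xi> in lborel. indicator {-\<omega><..<\<omega>} \<xi> * truncated_fourier \<tau> (cnj_l2 u) \<xi> = 0"
    by (simp only: truncated_fourier_l2_def time_limit_abs_l2[OF plancherel(1)]
        abs_l2_eq_0_iff[OF sqint_indicator_mult[OF plancherel(1)]] borel_open open_greaterThanLessThan)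
  then have "AE \<xi> in lborel. \<xi> \<in> {-\<omega><..<\<omega>} \<longrightarrow> truncated_fourier \<tau> (cnj_l2 u) \<xi> = 0"
    by eventually_elim auto
  then have "cnj_l2 u = 0"
    by (intro truncated_fourier_unique_continuation[of \<tau> _ "- \<omega>" \<omega>])
       (use u \<open>\<omega> > 0\<close> in \<open>auto simp: time_limit_cnj_l2\<close>)
  then show ?thesis by simp
qed

text \<open>
  This makes the eigenvalues of the compressed operator smaller than one: the transform would vanish
  on an interval outside the band.
\<close>

lemma time_limited_band_limited_eq_0:
  assumes u: "time_limit \<tau> u = u"
    and z: "time_limit \<omega> (inverse_fourier_l2 u) = inverse_fourier_l2 u"
  shows "u = 0"
proof -
  define v where "v = truncated_fourier \<tau> (cnj_l2 u)"
  have "cnj_l2 (time_limit \<omega> (abs_l2 v)) = cnj_l2 (abs_l2 v)"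
    using z unfolding v_def by (simp add: inverse_fourier_eq_cnj[OF u] time_limit_cnj_l2 truncated_fourier_l2_def)
  then have "time_limit \<omega> (abs_l2 v) = abs_l2 v" by (metis cnj_cnj_l2)
  then have "AE \<xi> in lborel. indicator {-\<omega><..<\<omega>} \<xi> * v \<xi> = v \<xi>"
    unfolding v_def time_limit_abs_l2[OF plancherel(1)]
    by (subst (asm) abs_l2_eq_iff[OF sqint_indicator_mult[OF plancherel(1)] plancherel(1)]) auto
  then have "AE \<xi> in lborel. \<xi> \<in> {\<bar>\<omega>\<bar><..<\<bar>\<omega>\<bar> + 1} \<longrightarrow> truncated_fourier \<tau> (cnj_l2 u) \<xi> = 0"
    by eventually_elim (auto simp: v_def indicator_def split: if_splits)
  then have "cnj_l2 u = 0"
    by (intro truncated_fourier_unique_continuation[of \<tau> _ "\<bar>\<omega>\<bar>" "\<bar>\<omega>\<bar> + 1"])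
       (use u in \<open>auto simp: time_limit_cnj_l2\<close>)
  then show ?thesis by simp
qed

section \<open>Modulated indicators\<close>

text \<open>
  As the frequency \<open>M\<close> grows, the Fourier transform of such a function moves off to infinity while the
  norm stays fixed; on either side of the Fourier transform this provides approximate
  eigenvectors.
\<close>

definition modulated :: "real \<Rightarrow> real \<Rightarrow> real \<Rightarrow> l2" where
  "modulated a b M = abs_l2 (\<lambda>x. exp (- (\<i> * complex_of_real (x * M))) * indicator {a<..b} x)"

lemma sqint_modulated: "sqint (\<lambda>x. exp (- (\<i> * complex_of_real (x * M))) * indicator {a<..b} x)"
  by (rule sqint_bound[OF sqint_Ioc[of 1 a b]]) (auto simp: indicator_def)

lemma norm_modulated:
  assumes "a \<le> b" shows "norm (modulated a b M) = sqrt (b - a)"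
proof -
  have "(norm (modulated a b M))\<^sup>2 = (LINT x|lborel. indicator {a<..b} x)"
    unfolding modulated_def norm_abs_l2_square[OF sqint_modulated]
    by (rule Bochner_Integration.integral_cong) (auto simp: indicator_def)
  also have "\<dots> = b - a" using assms by simp
  finally show ?thesis by (metis norm_ge_zero real_sqrt_unique)
qed

lemma time_limit_modulated_inside:
  assumes "- N \<le> a" "b \<le> N"
  shows "time_limit N (modulated a b M) = modulated a b M"
  unfolding modulated_def time_limit_abs_l2[OF sqint_modulated]
proof (rule abs_l2_cong[OF sqint_indicator_mult[OF sqint_modulated]])
  show "AE x in lborel. indicator {- N<..<N} x * (exp (- (\<i> * complex_of_real (x * M))) * indicator {a<..b} x)
      = exp (- (\<i> * complex_of_real (x * M))) * indicator {a<..b} x"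
    using AE_lborel_singleton[of N] by eventually_elim (use assms in \<open>auto simp: indicator_def\<close>)
qed auto

lemma time_limit_modulated_outside:
  assumes "N \<le> a"
  shows "time_limit N (modulated a b M) = 0"
  unfolding modulated_def time_limit_abs_l2[OF sqint_modulated] zero_l2_abs
  by (rule arg_cong[where f = abs_l2]) (use assms in \<open>auto simp: indicator_def\<close>)

text \<open>
  The transform at \<open>\<xi>\<close> is \<open>interval_fourier a b (\<xi> + M)\<close> up to a constant factor, and this is bounded by
  \<open>2 / \<bar>\<xi> + M\<bar>\<close>.
\<close>

lemma tendsto_fourier_modulated:
  assumes "a \<le> b"
  shows "(\<lambda>n. time_limit \<rho> (fourier_l2 (modulated a b (real n)))) \<longlonglongrightarrow> 0"
proof -
  define N where "N = max \<bar>a\<bar> \<bar>b\<bar>"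
  define I where "I = abs_l2 (\<lambda>x. 1 * indicator {- \<bar>\<rho>\<bar><..\<bar>\<rho>\<bar>} x)"
  have N: "- N \<le> a" "b \<le> N" by (auto simp: N_def)
  define k where "k = 1 / sqrt (2 * pi)"
  have k0: "k \<ge> 0" by (simp add: k_def)
  have tf: "truncated_fourier N (modulated a b M) \<xi> = complex_of_real k * interval_fourier a b (\<xi> + M)" for M \<xi>
  proof -
    have "cinner_l2 (modulated a b M) (wave N \<xi>) = interval_fourier a b (\<xi> + M)"
      unfolding modulated_def wave_def cinner_abs_l2[OF sqint_modulated sqint_wave] interval_fourier_def
    proof (rule Bochner_Integration.integral_cong)
      fix x
      have "exp (- (\<i> * complex_of_real (x * M))) * exp (- (\<i> * complex_of_real (x * \<xi>)))
          = exp (- (\<i> * complex_of_real (x * (\<xi> + M))))"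
        by (simp add: exp_add[symmetric] algebra_simps)
      then show "exp (- (\<i> * complex_of_real (x * M))) * indicator {a<..b} x *
         cnj (indicator {- N..N} x * exp (\<i> * complex_of_real (x * \<xi>))) =
         exp (- (\<i> * complex_of_real (x * (\<xi> + M)))) * indicator {a<..b} x"
        using N by (auto simp: indicator_def exp_cnj)
    qed simp
    then show ?thesis by (simp add: truncated_fourier_eq_cinner k_def)
  qed
  have bound: "norm (time_limit \<rho> (fourier_l2 (modulated a b M))) \<le> (2 * k * norm I) / (M - \<bar>\<rho>\<bar>)"
    if M: "M > \<bar>\<rho>\<bar>" for M
  proof -
    define K where "K = 2 * k / (M - \<bar>\<rho>\<bar>)"
    have K0: "K \<ge> 0" using k0 M by (simp add: K_def)
    have "fourier_l2 (modulated a b M) = abs_l2 (truncated_fourier N (modulated a b M))"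
      using fourier_l2_time_limit[of N "modulated a b M"]
      by (simp add: time_limit_modulated_inside[OF N] truncated_fourier_l2_def)
    then have "norm (time_limit \<rho> (fourier_l2 (modulated a b M)))
        = norm (abs_l2 (\<lambda>\<xi>. indicator {-\<rho><..<\<rho>} \<xi> * truncated_fourier N (modulated a b M) \<xi>))"
      by (simp add: time_limit_abs_l2 plancherel)
    also have "\<dots> \<le> norm (abs_l2 (\<lambda>x. complex_of_real K * (1 * indicator {- \<bar>\<rho>\<bar><..\<bar>\<rho>\<bar>} x)))"
    proof (rule norm_abs_l2_mono[OF square_integrable_cmult[OF sqint_Ioc]])
      have "cmod (truncated_fourier N (modulated a b M) \<xi>) \<le> K"
        if "\<bar>\<xi>\<bar> < \<bar>\<rho>\<bar>" for \<xi>
      proof -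
        have pos: "M - \<bar>\<rho>\<bar> > 0" "\<xi> + M \<ge> M - \<bar>\<rho>\<bar>" using M that by auto
        have "cmod (interval_fourier a b (\<xi> + M)) = cmod (iexp (- ((\<xi> + M) * a)) - iexp (- ((\<xi> + M) * b))) / (\<xi> + M)"
          using pos by (subst interval_fourier_eq[OF assms]) (auto simp: norm_divide norm_mult simp flip: of_real_add)
        also have "\<dots> \<le> 2 / (\<xi> + M)"
          using pos norm_triangle_ineq4[of "iexp (- ((\<xi> + M) * a))" "iexp (- ((\<xi> + M) * b))"]
          by (intro divide_right_mono) (auto simp del: of_real_minus of_real_mult)
        also have "\<dots> \<le> 2 / (M - \<bar>\<rho>\<bar>)"
          using pos by (intro divide_left_mono) auto
        finally have "k * cmod (interval_fourier a b (\<xi> + M)) \<le> k * (2 / (M - \<bar>\<rho>\<bar>))"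
          by (rule mult_left_mono[OF _ k0])
        then show ?thesis using k0 by (simp add: tf norm_mult mult.commute K_def)
      qed
      then show "AE \<xi> in lborel. cmod (indicator {-\<rho><..<\<rho>} \<xi> * truncated_fourier N (modulated a b M) \<xi>)
          \<le> cmod (complex_of_real K * (1 * indicator {- \<bar>\<rho>\<bar><..\<bar>\<rho>\<bar>} \<xi>))"
        using K0 by (intro AE_I2) (auto simp: indicator_def)
    qed auto
    also have "\<dots> = K * norm I"
      unfolding I_def scaleC_abs_l2[OF sqint_Ioc, symmetric] norm_scaleC
      using K0 by simp
    finally show ?thesis by (simp add: K_def)
  qed
  have div_lim: "(\<lambda>n. c / (real n - d)) \<longlonglongrightarrow> 0" for c d :: real by real_asymp
  have "(\<lambda>n. (2 * k * norm I) / (real n - \<bar>\<rho>\<bar>)) \<longlonglongrightarrow> 0"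
    using div_lim by blast
  moreover have "eventually (\<lambda>n. norm (time_limit \<rho> (fourier_l2 (modulated a b (real n))))
      \<le> (2 * k * norm I) / (real n - \<bar>\<rho>\<bar>)) sequentially"
  proof -
    have "eventually (\<lambda>n. real n > \<bar>\<rho>\<bar>) sequentially" by real_asymp
    then show ?thesis by eventually_elim (rule bound)
  qed
  ultimately show ?thesis by (rule Lim_null_comparison[rotated])
qed

section \<open>Compactness\<close>

text \<open>
  Band limiting a bounded sequence gives bounded functions with a common Lipschitz constant. The
  theorem of Arzela and Ascoli yields a subsequence that converges uniformly on the bounded
  interval, hence in \<open>L\<^sup>2\<close> after time limiting.
\<close>

lemma time_limit_band_limit_compact:
  assumes bdd: "\<And>n. norm (f n :: l2) \<le> B"
  shows "\<exists>r L. strict_mono (r :: nat \<Rightarrow> nat) \<and> (\<lambda>n. time_limit \<tau> (band_limit \<omega> (f (r n)))) \<longlonglongrightarrow> L"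
proof -
  define F where "F n = truncated_fourier \<omega> (inverse_fourier_l2 (f n))" for n
  obtain C where C: "\<And>u \<xi>. cmod (truncated_fourier \<omega> u \<xi>) \<le> C * norm u"
    using truncated_fourier_bound by blast
  obtain D where D: "\<And>u \<xi> \<eta>. cmod (truncated_fourier \<omega> u \<xi> - truncated_fourier \<omega> u \<eta>) \<le> D * norm u * \<bar>\<xi> - \<eta>\<bar>"
    using truncated_fourier_lipschitz by blast
  have B0: "B \<ge> 0" using bdd[of 0] norm_ge_zero order_trans by blast
  have FB: "cmod (F n \<xi>) \<le> \<bar>C\<bar> * B" for n \<xi>
  proof -
    have "cmod (F n \<xi>) \<le> C * norm (f n)" using C[of "inverse_fourier_l2 (f n)" \<xi>] by (simp add: F_def)
    also have "\<dots> \<le> \<bar>C\<bar> * B" by (intro mult_mono bdd) auto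
    finally show ?thesis .
  qed
  have FL: "cmod (F n \<xi> - F n \<eta>) \<le> (\<bar>D\<bar> * B) * \<bar>\<xi> - \<eta>\<bar>" for n \<xi> \<eta>
  proof -
    have "cmod (F n \<xi> - F n \<eta>) \<le> D * norm (f n) * \<bar>\<xi> - \<eta>\<bar>"
      using D[of "inverse_fourier_l2 (f n)" \<xi> \<eta>] by (simp add: F_def)
    also have "\<dots> \<le> (\<bar>D\<bar> * B) * \<bar>\<xi> - \<eta>\<bar>" by (intro mult_right_mono mult_mono bdd) auto
    finally show ?thesis .
  qed
  obtain g r where gr: "continuous_on {-\<bar>\<tau>\<bar>..\<bar>\<tau>\<bar>} g" "strict_mono (r :: nat \<Rightarrow> nat)"
    "\<And>e. 0 < e \<Longrightarrow> \<exists>N. \<forall>n x. n \<ge> N \<and> x \<in> {-\<bar>\<tau>\<bar>..\<bar>\<tau>\<bar>} \<longrightarrow> norm (F (r n) x - g x) < e"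
  proof (rule Arzela_Ascoli[of "{-\<bar>\<tau>\<bar>..\<bar>\<tau>\<bar>}" F "\<bar>C\<bar> * B"])
    fix x e :: real assume "0 < e"
    \<comment> \<open>the summand 1 keeps the denominator positive\<close>
    define d where "d = e / (\<bar>D\<bar> * B + 1)"
    have pos: "\<bar>D\<bar> * B + 1 > 0" using B0 by (intro add_nonneg_pos mult_nonneg_nonneg) auto
    then have "d > 0" using \<open>0 < e\<close> by (simp add: d_def)
    moreover have "norm (F n x - F n y) < e" if "norm (x - y) < d" for n y
    proof -
      have "norm (F n x - F n y) \<le> (\<bar>D\<bar> * B) * \<bar>x - y\<bar>" by (rule FL)
      also have "\<dots> \<le> (\<bar>D\<bar> * B + 1) * \<bar>x - y\<bar>" by (intro mult_right_mono) auto
      also have "\<dots> < (\<bar>D\<bar> * B + 1) * d" using that pos by simp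
      also have "\<dots> = e" using pos by (simp add: d_def)
      finally show ?thesis .
    qed
    ultimately show "\<exists>d>0. \<forall>n y. y \<in> {-\<bar>\<tau>\<bar>..\<bar>\<tau>\<bar>} \<and> norm (x - y) < d \<longrightarrow> norm (F n x - F n y) < e"
      by blast
  qed (auto intro: FB)
  define h where "h x = lim (\<lambda>n. F (r n) x)" for x
  have Fm [measurable]: "F n \<in> borel_measurable borel" for n by (simp add: F_def)
  have conv: "(\<lambda>n. F (r n) x) \<longlonglongrightarrow> g x" if "x \<in> {-\<bar>\<tau>\<bar>..\<bar>\<tau>\<bar>}" for x
  proof (rule LIMSEQ_I)
    fix e :: real assume "0 < e"
    then show "\<exists>no. \<forall>n\<ge>no. norm (F (r n) x - g x) < e" using gr(3)[of e] that by blast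
  qed
  have hg: "(\<lambda>n. F (r n) x) \<longlonglongrightarrow> h x" if "x \<in> {-\<tau><..<\<tau>}" for x
  proof -
    have "x \<in> {-\<bar>\<tau>\<bar>..\<bar>\<tau>\<bar>}" using that by auto
    then show ?thesis using conv[of x] limI[of "\<lambda>n. F (r n) x" "g x"] by (simp add: h_def)
  qed
  have hm [measurable]: "h \<in> borel_measurable borel" unfolding h_def by measurable
  have "(\<lambda>n. abs_l2 (\<lambda>x. indicator {-\<tau><..<\<tau>} x * F (r n) x)) \<longlonglongrightarrow> abs_l2 (\<lambda>x. indicator {-\<tau><..<\<tau>} x * h x)"
  proof (rule abs_l2_dominated_convergence(2)[OF _ _ _ sqint_Ioc[of "complex_of_real (\<bar>C\<bar> * B)" "-\<bar>\<tau>\<bar>" "\<bar>\<tau>\<bar>"]])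
    show "AE x in lborel. (\<lambda>n. indicator {-\<tau><..<\<tau>} x * F (r n) x) \<longlonglongrightarrow> indicator {-\<tau><..<\<tau>} x * h x"
    proof (rule AE_I2)
      fix x show "(\<lambda>n. indicator {-\<tau><..<\<tau>} x * F (r n) x) \<longlonglongrightarrow> indicator {-\<tau><..<\<tau>} x * h x"
        using hg[of x] by (cases "x \<in> {-\<tau><..<\<tau>}") auto
    qed
    have "\<bar>C\<bar> * B \<ge> 0" using B0 by simp
    then show "AE x in lborel. cmod (indicator {-\<tau><..<\<tau>} x * F (r n) x)
        \<le> cmod (complex_of_real (\<bar>C\<bar> * B) * indicator {-\<bar>\<tau>\<bar><..\<bar>\<tau>\<bar>} x)" for n
      using FB[of "r n"] by (intro AE_I2) (auto simp: indicator_def simp del: of_real_mult)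
  qed auto
  moreover have "time_limit \<tau> (band_limit \<omega> (f n)) = abs_l2 (\<lambda>x. indicator {-\<tau><..<\<tau>} x * F n x)" for n
    by (simp add: band_limit_eq fourier_l2_time_limit truncated_fourier_l2_def time_limit_abs_l2 plancherel F_def)
  ultimately show ?thesis using gr(2) by auto
qed

section \<open>The sinc kernel\<close>

lemma cinner_inverse_fourier: "cinner_l2 (inverse_fourier_l2 u) v = cinner_l2 u (fourier_l2 v)"
  by (metis cinner_fourier_adjoint cinner_cnj)

lemma interval_fourier_symmetric:
  assumes "\<omega> > 0"
  shows "interval_fourier (- \<omega>) \<omega> (y - x) = complex_of_real (2 * pi * sinc_kernel \<omega> x y)"
proof (cases "x = y")
  case True
  have "interval_fourier (- \<omega>) \<omega> 0 = (LINT x|lborel. complex_of_real (indicator {-\<omega><..\<omega>} x))"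
    unfolding interval_fourier_def
    by (rule Bochner_Integration.integral_cong) (auto simp: indicator_def)
  also have "\<dots> = complex_of_real (2 * \<omega>)"
    unfolding integral_complex_of_real using assms by simp
  finally show ?thesis using True by (simp add: sinc_kernel_def)
next
  case False
  then have "interval_fourier (- \<omega>) \<omega> (y - x)
      = (iexp ((y - x) * \<omega>) - iexp (- ((y - x) * \<omega>))) / (\<i> * (y - x))"
    using assms by (subst interval_fourier_eq) (auto simp del: of_real_diff)
  also have "\<dots> = 2 * sin (complex_of_real ((y - x) * \<omega>)) / (y - x)"
  proof -
    have "(iexp (t * \<omega>) - iexp (- (t * \<omega>))) / (\<i> * t) = 2 * sin (complex_of_real (t * \<omega>)) / t" for t
      by (cases "t = 0") (simp_all add: sin_exp_eq field_simps)
    then show ?thesis .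
  qed
  also have "\<dots> = complex_of_real (2 * sin ((y - x) * \<omega>) / (y - x))"
    unfolding sin_of_real by simp
  also have "2 * sin ((y - x) * \<omega>) / (y - x) = 2 * pi * sinc_kernel \<omega> x y"
  proof -
    have "sin ((y - x) * \<omega>) = - sin (\<omega> * (x - y))"
      by (simp add: sin_minus[symmetric] algebra_simps)
    then show ?thesis using False by (simp add: sinc_kernel_def field_simps)
  qed
  finally show ?thesis .
qed

abbreviation sinc_transform :: "real \<Rightarrow> (real \<Rightarrow> complex) \<Rightarrow> real \<Rightarrow> complex" where
  "sinc_transform \<omega> f x \<equiv> LINT y|lborel. complex_of_real (sinc_kernel \<omega> x y) * f y"

text \<open>
  The value at \<open>x\<close> is the inner product of the inverse transform of \<open>f\<close> with a truncated wave. Moving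
  the inverse transform to the other side produces the Fourier transform of that wave, which is
  the sinc kernel.
\<close>

lemma band_limit_kernel:
  assumes f: "sqint f" and "\<omega> > 0"
  shows "sqint (\<lambda>x. sinc_transform \<omega> f x)"
    and "band_limit \<omega> (abs_l2 f) = abs_l2 (\<lambda>x. sinc_transform \<omega> f x)"
proof -
  define k where "k = complex_of_real (1 / sqrt (2 * pi))"
  have kk: "k * cnj k * (2 * pi) = 1"
    unfolding k_def by (simp add: field_simps flip: of_real_mult)
  have "truncated_fourier \<omega> (inverse_fourier_l2 (abs_l2 f)) x
      = (sinc_transform \<omega> f x)" for x
  proof -
    have tw: "truncated_fourier \<omega> (wave \<omega> x) y = k * complex_of_real (2 * pi * sinc_kernel \<omega> x y)" for y
    proof -
      have "cinner_l2 (wave \<omega> x) (wave \<omega> y) = interval_fourier (- \<omega>) \<omega> (y - x)"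
        unfolding wave_def cinner_abs_l2[OF sqint_wave sqint_wave] interval_fourier_def
      proof (rule integral_cong_AE)
        show "AE t in lborel. indicator {- \<omega>..\<omega>} t * exp (\<i> * complex_of_real (t * x)) *
            cnj (indicator {- \<omega>..\<omega>} t * exp (\<i> * complex_of_real (t * y))) =
            exp (- (\<i> * complex_of_real (t * (y - x)))) * indicator {- \<omega><..\<omega>} t"
          using AE_lborel_singleton[of "- \<omega>"]
        proof eventually_elim
          case (elim t)
          have "exp (\<i> * complex_of_real (t * x)) * exp (- (\<i> * complex_of_real (t * y)))
              = exp (- (\<i> * complex_of_real (t * (y - x))))"
            by (simp add: exp_add[symmetric] algebra_simps)
          then show ?case using elim by (auto simp: indicator_def exp_cnj)
        qed
      qed (auto intro!: borel_measurable_times borel_measurable_cnj)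
      then show ?thesis
        by (simp add: truncated_fourier_eq_cinner interval_fourier_symmetric[OF \<open>\<omega> > 0\<close>] k_def)
    qed
    have "fourier_l2 (wave \<omega> x) = abs_l2 (truncated_fourier \<omega> (wave \<omega> x))"
      using fourier_l2_time_limit[of \<omega> "wave \<omega> x"] by (simp add: time_limit_wave truncated_fourier_l2_def)
    then have "truncated_fourier \<omega> (inverse_fourier_l2 (abs_l2 f)) x
        = k * (LINT y|lborel. f y * cnj (truncated_fourier \<omega> (wave \<omega> x) y))"
      by (simp add: truncated_fourier_eq_cinner[of _ "inverse_fourier_l2 (abs_l2 f)"] cinner_inverse_fourier
          cinner_abs_l2[OF f plancherel(1)] k_def)
    also have "\<dots> = k * (LINT y|lborel. (cnj k * (2 * pi)) * (complex_of_real (sinc_kernel \<omega> x y) * f y))"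
      by (simp add: tw mult_ac)
    also have "\<dots> = (k * cnj k * (2 * pi)) * (sinc_transform \<omega> f x)"
      by (simp only: integral_mult_right_zero mult.assoc)
    finally show ?thesis by (simp only: kk mult_1)
  qed
  then have eq: "truncated_fourier \<omega> (inverse_fourier_l2 (abs_l2 f))
      = (\<lambda>x. sinc_transform \<omega> f x)" by blast
  show "sqint (\<lambda>x. sinc_transform \<omega> f x)"
    unfolding eq[symmetric] by (rule plancherel)
  show "band_limit \<omega> (abs_l2 f) = abs_l2 (\<lambda>x. sinc_transform \<omega> f x)"
    unfolding eq[symmetric] by (simp add: band_limit_eq fourier_l2_time_limit truncated_fourier_l2_def)
qed

section \<open>Eigenvalues of the compressed band limiting operator\<close>

text \<open>
  The eigenvalue problem of the compressed operator is needed in three forms: for classes in \<open>l2\<close>,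
  here; for functions on the line vanishing outside the interval, where the interval can be rescaled; and for functions
  on \<open>(-1, 1)\<close>, as in \<open>sinc_eigenvalue\<close>.
\<close>

definition compression_eigenvalue :: "real \<Rightarrow> real \<Rightarrow> complex \<Rightarrow> bool" where
  "compression_eigenvalue \<tau> \<omega> z \<longleftrightarrow>
    (\<exists>u. u \<noteq> 0 \<and> time_limit \<tau> u = u \<and> time_limit \<tau> (band_limit \<omega> u) = z *\<^sub>C u)"

definition kernel_eigenvalue :: "real \<Rightarrow> real \<Rightarrow> complex \<Rightarrow> bool" where
  "kernel_eigenvalue \<tau> \<omega> z \<longleftrightarrow>
    (\<exists>f. sqint f \<and> (\<forall>x. x \<notin> {-\<tau><..<\<tau>} \<longrightarrow> f x = 0) \<and> \<not> (AE x in lborel. f x = 0) \<and>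
      (AE x in lborel. x \<in> {-\<tau><..<\<tau>} \<longrightarrow>
        (sinc_transform \<omega> f x) = z * f x))"

lemma sinc_kernel_compose_measurable [measurable (raw)]:
  assumes [measurable]: "f \<in> borel_measurable M" "g \<in> borel_measurable M"
  shows "(\<lambda>x. sinc_kernel c (f x) (g x)) \<in> borel_measurable M"
  unfolding sinc_kernel_def by measurable

lemma sinc_integral_measurable:
  assumes [measurable]: "f \<in> borel_measurable borel"
  shows "(\<lambda>x. sinc_transform \<omega> f x) \<in> borel_measurable borel"
  by measurable

lemma compression_eigenvalue_iff_kernel:
  assumes "\<omega> > 0"
  shows "compression_eigenvalue \<tau> \<omega> z \<longleftrightarrow> kernel_eigenvalue \<tau> \<omega> z"
proof
  assume "compression_eigenvalue \<tau> \<omega> z"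
  then obtain u where u: "u \<noteq> 0" "time_limit \<tau> u = u" "time_limit \<tau> (band_limit \<omega> u) = z *\<^sub>C u"
    by (auto simp: compression_eigenvalue_def)
  define f where "f x = indicator {-\<tau><..<\<tau>} x * rep_l2 u x" for x
  have f: "sqint f" unfolding f_def by (rule sqint_indicator_mult) auto
  have uf: "u = abs_l2 f"
    using u(2) time_limit_abs_l2[OF sqint_rep, of \<tau> u] by (simp add: f_def[abs_def])
  have "abs_l2 (\<lambda>x. indicator {-\<tau><..<\<tau>} x * (sinc_transform \<omega> f x))
      = abs_l2 (\<lambda>x. z * f x)"
    using u(3) unfolding uf band_limit_kernel(2)[OF f assms] scaleC_abs_l2[OF f]
      time_limit_abs_l2[OF band_limit_kernel(1)[OF f assms]] .
  then have "AE x in lborel. indicator {-\<tau><..<\<tau>} x * (sinc_transform \<omega> f x) = z * f x"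
    by (subst (asm) abs_l2_eq_iff)
       (auto intro!: sqint_indicator_mult band_limit_kernel(1)[OF f assms] square_integrable_cmult f)
  then have "AE x in lborel. x \<in> {-\<tau><..<\<tau>} \<longrightarrow> (sinc_transform \<omega> f x) = z * f x"
    by eventually_elim auto
  moreover have "\<not> (AE x in lborel. f x = 0)"
    using u(1) unfolding uf abs_l2_eq_0_iff[OF f] .
  moreover have "\<forall>x. x \<notin> {-\<tau><..<\<tau>} \<longrightarrow> f x = 0" by (simp add: f_def)
  ultimately show "kernel_eigenvalue \<tau> \<omega> z"
    unfolding kernel_eigenvalue_def using f by blast
next
  assume "kernel_eigenvalue \<tau> \<omega> z"
  then obtain f where f: "sqint f" "\<And>x. x \<notin> {-\<tau><..<\<tau>} \<Longrightarrow> f x = 0" "\<not> (AE x in lborel. f x = 0)"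
    "AE x in lborel. x \<in> {-\<tau><..<\<tau>} \<longrightarrow>
        (sinc_transform \<omega> f x) = z * f x"
    by (auto simp: kernel_eigenvalue_def)
  have 1: "abs_l2 f \<noteq> 0" using f by (simp add: abs_l2_eq_0_iff)
  have fe: "indicator {-\<tau><..<\<tau>} x * f x = f x" for x
    using f(2)[of x] by (cases "x \<in> {-\<tau><..<\<tau>}") auto
  have 2: "time_limit \<tau> (abs_l2 f) = abs_l2 f" by (simp only: time_limit_abs_l2[OF f(1)] fe)
  have "time_limit \<tau> (band_limit \<omega> (abs_l2 f)) = abs_l2 (\<lambda>x. z * f x)"
    unfolding band_limit_kernel(2)[OF f(1) assms] time_limit_abs_l2[OF band_limit_kernel(1)[OF f(1) assms]]
  proof (rule abs_l2_cong)
    show "sqint (\<lambda>x. indicator {-\<tau><..<\<tau>} x * (sinc_transform \<omega> f x))"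
      by (intro sqint_indicator_mult band_limit_kernel(1)[OF f(1) assms]) auto
    show "(\<lambda>x. z * f x) \<in> borel_measurable borel"
      by (rule sqint_measurable[OF square_integrable_cmult[OF f(1)]])
    show "AE x in lborel. indicator {-\<tau><..<\<tau>} x * (sinc_transform \<omega> f x) = z * f x"
      using f(4) by eventually_elim (use f(2) in \<open>auto simp: indicator_def\<close>)
  qed
  then show "compression_eigenvalue \<tau> \<omega> z"
    unfolding compression_eigenvalue_def using 1 2 by (metis scaleC_abs_l2[OF f(1)])
qed

text \<open>
  Substituting \<open>y = s y'\<close> in the integral, since
  \<open>s * sinc_kernel (\<omega> / s) (s x') (s y') = sinc_kernel \<omega> x' y'\<close>.
\<close>

lemma kernel_eigenvalue_dilate:
  assumes "kernel_eigenvalue \<tau> \<omega> z" and s: "s > 0"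
  shows "kernel_eigenvalue (s * \<tau>) (\<omega> / s) z"
proof -
  from assms obtain f where f: "sqint f" "\<And>x. x \<notin> {-\<tau><..<\<tau>} \<Longrightarrow> f x = 0" "\<not> (AE x in lborel. f x = 0)"
    "AE x in lborel. x \<in> {-\<tau><..<\<tau>} \<longrightarrow>
        (sinc_transform \<omega> f x) = z * f x"
    by (auto simp: kernel_eigenvalue_def)
  have fm [measurable]: "f \<in> borel_measurable borel" using f(1) by (rule sqint_measurable)
  define g where "g x = f (x / s)" for x
  have gm [measurable]: "g \<in> borel_measurable borel" unfolding g_def by measurable
  have g: "sqint g"
    using lborel_integrable_real_affine[OF sqint_integrable[OF f(1)], of "1 / s" 0] s
    by (simp add: square_integrable_def g_def[abs_def])
  have supp: "g x = 0" if "x \<notin> {- (s * \<tau>)<..<s * \<tau>}" for x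
    unfolding g_def by (rule f(2)) (use that s in \<open>auto simp: field_simps\<close>)
  have nz: "\<not> (AE x in lborel. g x = 0)"
  proof
    assume "AE x in lborel. g x = 0"
    then have "AE x in lborel. g (0 + s * x) = 0"
      by (intro AE_borel_affine[of s "\<lambda>x. g x = 0" 0]) (use s in auto)
    then show False using f(3) s by (simp add: g_def)
  qed
  have int: "(sinc_transform (\<omega> / s) g x)
      = (sinc_transform \<omega> f (x / s))" for x
  proof -
    have "(sinc_transform (\<omega> / s) g x)
      = \<bar>s\<bar> *\<^sub>R (LINT y|lborel. complex_of_real (sinc_kernel (\<omega> / s) x (0 + s * y)) * g (0 + s * y))"
      by (rule lborel_integral_real_affine) (use s in auto)
    also have "\<dots> = (LINT y|lborel. complex_of_real (s * sinc_kernel (\<omega> / s) x (s * y)) * f y)"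
      using s by (simp add: g_def scaleR_conv_of_real mult.assoc)
    also have "\<dots> = (sinc_transform \<omega> f (x / s))"
    proof (rule Bochner_Integration.integral_cong)
      fix y
      have "s * sinc_kernel (\<omega> / s) x (s * y) = sinc_kernel \<omega> (x / s) y"
      proof (cases "x = s * y")
        case False
        then have "x / s \<noteq> y" using s by (auto simp: field_simps)
        moreover have "\<omega> / s * (x - s * y) = \<omega> * (x / s - y)" using s by (simp add: field_simps)
        moreover have "s / (pi * (x - s * y)) = 1 / (pi * (x / s - y))"
          using s False \<open>x / s \<noteq> y\<close> by (simp add: field_simps)
        ultimately show ?thesis using False s
          by (simp add: sinc_kernel_def) (metis (no_types, lifting) mult.commute mult.right_neutral times_divide_eq_right)
      qed (use s in \<open>simp add: sinc_kernel_def\<close>)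
      then show "complex_of_real (s * sinc_kernel (\<omega> / s) x (s * y)) * f y = complex_of_real (sinc_kernel \<omega> (x / s) y) * f y"
        by simp
    qed simp
    finally show ?thesis .
  qed
  define I where "I x = (sinc_transform \<omega> f x)" for x
  have [measurable]: "I \<in> borel_measurable borel"
    unfolding I_def by (rule sinc_integral_measurable[OF fm])
  have "AE x in lborel. x \<in> {-\<tau><..<\<tau>} \<longrightarrow> I x = z * f x" using f(4) by (simp add: I_def)
  then have "AE x in lborel. 0 + (1 / s) * x \<in> {-\<tau><..<\<tau>} \<longrightarrow> I (0 + (1 / s) * x) = z * f (0 + (1 / s) * x)"
    by (intro AE_borel_affine[of "1 / s" "\<lambda>x. x \<in> {-\<tau><..<\<tau>} \<longrightarrow> I x = z * f x" 0]) (use s in auto)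
  then have "AE x in lborel. x \<in> {- (s * \<tau>)<..<s * \<tau>} \<longrightarrow>
      (sinc_transform (\<omega> / s) g x) = z * g x"
    unfolding int
  proof eventually_elim
    case (elim x)
    then show ?case using s by (auto simp: g_def I_def field_simps)
  qed
  then show ?thesis
    unfolding kernel_eigenvalue_def using g nz supp by blast
qed

lemma sinc_eigenvalue_iff_kernel: "sinc_eigenvalue c z \<longleftrightarrow> kernel_eigenvalue 1 c z"
proof -
  define M where "M = restrict_space lborel {-1<..<1::real}"
  have \<Omega>: "{-1<..<1::real} \<inter> space lborel \<in> sets lborel" by simp
  have sq: "square_integrable M f \<longleftrightarrow> sqint (\<lambda>x. indicator {-1<..<1} x * f x)" for f
  proof -
    have eq1: "(\<lambda>x. indicator {-1<..<1} x *\<^sub>R f x) = (\<lambda>x. indicator {-1<..<1} x * f x)"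
      by (auto simp: indicator_def)
    have eq2: "(\<lambda>x. indicator {-1<..<1} x *\<^sub>R (cmod (f x))\<^sup>2) = (\<lambda>x. (cmod (indicator {-1<..<1} x * f x))\<^sup>2)"
      by (auto simp: indicator_def)
    show ?thesis
      unfolding square_integrable_def M_def borel_measurable_restrict_space_iff[OF \<Omega>]
        integrable_restrict_space[OF \<Omega>] eq1 eq2 by simp
  qed
  have int: "(LINT y|M. complex_of_real (sinc_kernel c x y) * f y)
      = (LINT y|lborel. complex_of_real (sinc_kernel c x y) * (indicator {-1<..<1} y * f y))" for x f
    unfolding M_def integral_restrict_space[OF \<Omega>]
    by (rule Bochner_Integration.integral_cong) (auto simp: indicator_def)
  have ae: "(AE x in M. P x) \<longleftrightarrow> (AE x in lborel. x \<in> {-1<..<1} \<longrightarrow> P x)" for P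
    unfolding M_def by (rule AE_restrict_space_iff[OF \<Omega>])
  show ?thesis
  proof
    assume "sinc_eigenvalue c z"
    then obtain f where f: "square_integrable M f" "\<not> (AE x in M. f x = 0)"
      "AE x in M. (LINT y|M. complex_of_real (sinc_kernel c x y) * f y) = z * f x"
      unfolding sinc_eigenvalue_def M_def Let_def by blast
    define g where "g x = indicator {-1<..<1} x * f x" for x
    have "AE x in lborel. x \<in> {-1<..<1} \<longrightarrow> (sinc_transform c g x) = z * g x"
      using f(3) unfolding ae int by eventually_elim (auto simp: g_def)
    moreover have "\<not> (AE x in lborel. g x = 0)"
    proof
      assume "AE x in lborel. g x = 0"
      then have "AE x in M. f x = 0" unfolding ae by eventually_elim (auto simp: g_def)
      then show False using f(2) by blast
    qed
    moreover have "sqint g" using f(1) unfolding sq g_def .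
    moreover have "\<forall>x. x \<notin> {-1<..<1} \<longrightarrow> g x = 0" by (simp add: g_def)
    ultimately show "kernel_eigenvalue 1 c z" unfolding kernel_eigenvalue_def by blast
  next
    assume "kernel_eigenvalue 1 c z"
    then obtain f where f: "sqint f" "\<And>x. x \<notin> {-1<..<1} \<Longrightarrow> f x = 0" "\<not> (AE x in lborel. f x = 0)"
      "AE x in lborel. x \<in> {-1<..<1} \<longrightarrow> (sinc_transform c f x) = z * f x"
      by (auto simp: kernel_eigenvalue_def)
    have fe: "indicator {-1<..<1} x * f x = f x" for x using f(2)[of x] by (auto simp: indicator_def)
    have "square_integrable M f" unfolding sq fe by (rule f(1))
    moreover have "\<not> (AE x in M. f x = 0)"
    proof
      assume "AE x in M. f x = 0"
      then have "AE x in lborel. f x = 0" unfolding ae by eventually_elim (use f(2) in blast)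
      then show False using f(3) by blast
    qed
    moreover have "AE x in M. (LINT y|M. complex_of_real (sinc_kernel c x y) * f y) = z * f x"
      unfolding ae int fe by (rule f(4))
    ultimately show "sinc_eigenvalue c z"
      unfolding sinc_eigenvalue_def M_def Let_def by blast
  qed
qed

lemma sinc_eigenvalue_iff_compression:
  assumes "\<tau> > 0" "\<omega> > 0"
  shows "sinc_eigenvalue (\<omega> * \<tau>) z \<longleftrightarrow> compression_eigenvalue \<tau> \<omega> z"
proof -
  have "kernel_eigenvalue 1 (\<omega> * \<tau>) z \<longleftrightarrow> kernel_eigenvalue \<tau> \<omega> z"
    using kernel_eigenvalue_dilate[of 1 "\<omega> * \<tau>" z \<tau>] kernel_eigenvalue_dilate[of \<tau> \<omega> z "1 / \<tau>"] assms
    by auto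
  then show ?thesis
    by (simp add: sinc_eigenvalue_iff_kernel compression_eigenvalue_iff_kernel assms)
qed

section \<open>Sets of real numbers accumulating only at zero\<close>

text \<open>
  The entry with index \<open>n\<close> is determined by the range: exactly \<open>n\<close> elements exceed it.
\<close>

lemma strictly_decreasing_enumeration_unique:
  fixes l l' :: "nat \<Rightarrow> real"
  assumes l: "\<And>m n. m < n \<Longrightarrow> l n < l m" and l': "\<And>m n. m < n \<Longrightarrow> l' n < l' m"
    and r: "range l = range l'"
  shows "l = l'"
proof
  have c: "card {y \<in> range k. y > k n} = n" if k: "\<And>m n. m < n \<Longrightarrow> k n < k m" for k :: "nat \<Rightarrow> real" and n
  proof -
    have "k m > k n \<longleftrightarrow> m < n" for m
      using k[of m n] k[of n m] by (cases m n rule: linorder_cases) auto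
    then have "{y \<in> range k. y > k n} = k ` {..<n}" by auto
    moreover have "inj k" by (rule linorder_injI) (use k in fastforce)
    ultimately show ?thesis by (simp add: card_image inj_on_subset[of k UNIV])
  qed
  fix n
  obtain m where m: "l n = l' m" using r by (metis rangeE rangeI)
  have "card {y \<in> range l. y > l n} = n" by (rule c) (rule l)
  moreover have "card {y \<in> range l'. y > l' m} = m" by (rule c) (rule l')
  ultimately have "n = m" by (simp add: m r)
  then show "l n = l' n" using m by simp
qed

text \<open>
  Every nonempty subset has a greatest element, so each entry can be chosen greatest below the
  preceding one. An element that is never reached would lie below infinitely many entries.
\<close>

lemma strictly_decreasing_enumeration_exists:
  fixes E :: "real set"
  assumes inf: "infinite E" and fin: "\<And>x. x \<in> E \<Longrightarrow> finite {y \<in> E. y \<ge> x}"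
  shows "\<exists>l :: nat \<Rightarrow> real. (\<forall>m n. m < n \<longrightarrow> l n < l m) \<and> range l = E"
proof -
  have gr: "\<exists>x\<in>S. \<forall>y\<in>S. y \<le> x" if S: "S \<subseteq> E" "S \<noteq> {}" for S
  proof -
    obtain s where s: "s \<in> S" using S by blast
    have f: "finite {y \<in> S. y \<ge> s}"
      by (rule finite_subset[OF _ fin[of s]]) (use S s in auto)
    have "Max {y \<in> S. y \<ge> s} \<in> {y \<in> S. y \<ge> s}" using f s by (intro Max_in) auto
    moreover have "y \<le> Max {y \<in> S. y \<ge> s}" if "y \<in> S" for y
    proof (cases "y \<ge> s")
      case True
      then show ?thesis using f that by (intro Max_ge) auto
    next
      case False
      then show ?thesis using \<open>Max {y \<in> S. y \<ge> s} \<in> {y \<in> S. y \<ge> s}\<close> by auto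
    qed
    ultimately show ?thesis by blast
  qed
  have "\<exists>l. \<forall>n. (l n \<in> E \<and> (n = 0 \<longrightarrow> (\<forall>y\<in>E. y \<le> l n))) \<and>
      (l (Suc n) < l n \<and> (\<forall>y\<in>E. y < l n \<longrightarrow> y \<le> l (Suc n)))"
  proof (rule dependent_nat_choice[where P = "\<lambda>n x. x \<in> E \<and> (n = 0 \<longrightarrow> (\<forall>y\<in>E. y \<le> x))"
        and Q = "\<lambda>n x y. y < x \<and> (\<forall>z\<in>E. z < x \<longrightarrow> z \<le> y)"])
    show "\<exists>x. x \<in> E \<and> (0 = (0::nat) \<longrightarrow> (\<forall>y\<in>E. y \<le> x))" using gr[of E] inf by auto
  next
    fix x and n :: nat assume x: "x \<in> E \<and> (n = 0 \<longrightarrow> (\<forall>y\<in>E. y \<le> x))"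
    have "{y \<in> E. y < x} \<noteq> {}"
    proof
      assume "{y \<in> E. y < x} = {}"
      then have "E = {y \<in> E. y \<ge> x}" by force
      then show False using fin[of x] x inf by simp
    qed
    then obtain y where "y \<in> {y \<in> E. y < x}" "\<forall>z\<in>{y \<in> E. y < x}. z \<le> y"
      using gr[of "{y \<in> E. y < x}"] by auto
    then show "\<exists>y. (y \<in> E \<and> (Suc n = 0 \<longrightarrow> (\<forall>z\<in>E. z \<le> y))) \<and> y < x \<and> (\<forall>z\<in>E. z < x \<longrightarrow> z \<le> y)"
      by auto
  qed
  then obtain l where l: "\<And>n. l n \<in> E" "\<And>y. y \<in> E \<Longrightarrow> y \<le> l 0" "\<And>n. l (Suc n) < l n"
    "\<And>n y. y \<in> E \<Longrightarrow> y < l n \<Longrightarrow> y \<le> l (Suc n)" by blast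
  have dec: "l n < l m" if "m < n" for m n
    using lift_Suc_mono_less[of "\<lambda>n. - l n" m n] l(3) that by simp
  have "x \<in> range l" if x: "x \<in> E" for x
  proof (rule ccontr)
    assume nr: "x \<notin> range l"
    have "x < l n" for n
    proof (induction n)
      case 0
      then show ?case using l(2)[OF x] nr by (metis order_le_less rangeI)
    next
      case (Suc n)
      then show ?case using l(4)[OF x] nr by (metis order_le_less rangeI)
    qed
    then have "range l \<subseteq> {y \<in> E. y \<ge> x}" using l(1) by (auto intro: less_imp_le)
    then have "finite (range l)" using fin[OF x] finite_subset by blast
    moreover have "inj l" by (rule linorder_injI) (use dec in fastforce)
    ultimately show False using range_inj_infinite by blast
  qed
  then have "range l = E" using l(1) by auto
  then show ?thesis using dec by blast
qed

section \<open>Spectra of bounded operators\<close>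

text \<open>
  The equation \<open>L f = g\<close> follows from \<open>L' (L f) = L' g\<close> as \<open>L'\<close> is injective. Since \<open>L' L\<close> is
  positive, bounded and bounded below, \<open>f \<mapsto> f - t (L' (L f) - L' g)\<close> is a contraction for small \<open>t > 0\<close>, and
  Banach's fixed point theorem solves the latter equation.
\<close>

lemma surj_of_bounded_below:
  fixes L L' :: "'a::{real_inner, complete_space} \<Rightarrow> 'a"
  assumes L: "bounded_linear L" and L': "bounded_linear L'"
    and adj: "\<And>f g. inner (L f) g = inner f (L' g)"
    and c: "c > 0" "\<And>f. c * norm f \<le> norm (L f)"
    and inj: "\<And>g. L' g = 0 \<Longrightarrow> g = 0"
  shows "\<exists>f. L f = g"
proof -
  obtain B where B: "B > 0" "\<And>x. norm (L' x) \<le> norm x * B"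
    using bounded_linear.pos_bounded[OF L'] by blast
  \<comment> \<open>this \<open>t\<close> gives \<open>\<parallel>f - t L' (L f)\<parallel>\<^sup>2 \<le> \<parallel>f\<parallel>\<^sup>2 - t \<parallel>L f\<parallel>\<^sup>2\<close>\<close>
  define t where "t = 1 / B\<^sup>2"
  have t: "t > 0" using B by (simp add: t_def)
  define q where "q = sqrt (max 0 (1 - t * c\<^sup>2))"
  have q: "0 \<le> q" "q < 1" using t c by (auto simp: q_def max_def)
  have contr: "norm (f - t *\<^sub>R L' (L f)) \<le> q * norm f" for f
  proof -
    have "(norm (L' (L f)))\<^sup>2 \<le> (norm (L f) * B)\<^sup>2" by (intro power_mono B) auto
    then have "t\<^sup>2 * (norm (L' (L f)))\<^sup>2 \<le> t\<^sup>2 * (norm (L f) * B)\<^sup>2" by (intro mult_left_mono) auto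
    also have "\<dots> = t * (norm (L f))\<^sup>2"
      using B by (simp add: t_def power_mult_distrib power2_eq_square)
    finally have 1: "t\<^sup>2 * (norm (L' (L f)))\<^sup>2 \<le> t * (norm (L f))\<^sup>2" .
    have "(c * norm f)\<^sup>2 \<le> (norm (L f))\<^sup>2" using c by (intro power_mono) auto
    then have 2: "t * (c\<^sup>2 * (norm f)\<^sup>2) \<le> t * (norm (L f))\<^sup>2"
      using t by (intro mult_left_mono) (auto simp: power_mult_distrib)
    have "(norm (f - t *\<^sub>R L' (L f)))\<^sup>2 = (norm f)\<^sup>2 - 2 * t * inner f (L' (L f)) + t\<^sup>2 * (norm (L' (L f)))\<^sup>2"
      unfolding power2_norm_eq_inner
      by (simp add: inner_diff_left inner_diff_right inner_commute[of "L' (L f)" f] power2_eq_square algebra_simps)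
    also have "inner f (L' (L f)) = (norm (L f))\<^sup>2" by (simp add: adj[symmetric] power2_norm_eq_inner)
    also have "(norm f)\<^sup>2 - 2 * t * (norm (L f))\<^sup>2 + t\<^sup>2 * (norm (L' (L f)))\<^sup>2
        \<le> (norm f)\<^sup>2 - t * (c\<^sup>2 * (norm f)\<^sup>2)" using 1 2 by linarith
    also have "\<dots> = (1 - t * c\<^sup>2) * (norm f)\<^sup>2" by (simp add: algebra_simps)
    also have "\<dots> \<le> (max 0 (1 - t * c\<^sup>2)) * (norm f)\<^sup>2" by (intro mult_right_mono) auto
    also have "\<dots> = (q * norm f)\<^sup>2" by (simp add: q_def power_mult_distrib)
    finally show ?thesis by (rule power2_le_imp_le) (use q in simp)
  qed
  define \<phi> where "\<phi> f = f - t *\<^sub>R (L' (L f) - L' g)" for f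
  note lin = linear_simps[OF L] linear_simps[OF L']
  have "dist (\<phi> x) (\<phi> y) \<le> q * dist x y" for x y
  proof -
    have "\<phi> x - \<phi> y = (x - y) - t *\<^sub>R L' (L (x - y))"
      by (simp add: \<phi>_def lin algebra_simps)
    then show ?thesis using contr[of "x - y"] by (simp add: dist_norm)
  qed
  then have "\<exists>!x. \<phi> x = x"
    using q by (intro banach_fix_type[of q]) auto
  then obtain f where "\<phi> f = f" by blast
  then have "L' (L f - g) = 0" using t by (simp add: \<phi>_def lin)
  then have "L f - g = 0" by (rule inj)
  then show ?thesis by auto
qed

lemma not_in_l2_spectrumI:
  assumes A: "bounded_clinear_l2 A" and c: "c > 0" "\<And>f. c * norm f \<le> norm (A f - z *\<^sub>C f)"
    and surj: "\<And>g. \<exists>f. A f - z *\<^sub>C f = g"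
  shows "z \<notin> l2_spectrum A"
proof -
  define L where "L f = A f - z *\<^sub>C f" for f
  have L: "bounded_clinear_l2 L"
    unfolding L_def by (intro bounded_clinear_l2_diff A bounded_clinear_l2_scaleC)
  note lin = bounded_clinear_l2D[OF L]
  have inj: "f = g" if "L f = L g" for f g
  proof -
    have "c * norm (f - g) \<le> norm (L (f - g))" using c(2) by (simp add: L_def)
    also have "\<dots> = 0" using that by (simp add: lin)
    finally show ?thesis using c(1) by (simp add: mult_le_0_iff)
  qed
  have "\<forall>g. \<exists>f. L f = g" using surj by (simp add: L_def)
  then obtain B where B: "\<And>g. L (B g) = g" by metis
  have BL: "B (L f) = f" for f by (rule inj) (simp add: B)
  have "bounded_clinear_l2 B"
  proof (rule bounded_clinear_l2I)
    show "B (u + v) = B u + B v" for u v by (rule inj) (simp add: lin B)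
    show "B (d *\<^sub>C u) = d *\<^sub>C B u" for d u by (rule inj) (simp add: lin B)
    show "norm (B u) \<le> norm u * (1 / c)" for u
      using c(2)[of "B u"] B[of u] c(1) by (simp add: L_def field_simps)
  qed
  then show ?thesis
    unfolding l2_spectrum_def using B BL by (auto simp: L_def)
qed

text \<open>
  Approximate eigenvectors exclude a bounded inverse.
\<close>

lemma in_l2_spectrumI:
  assumes A: "bounded_clinear_l2 A" and d: "d > 0" "\<And>n. norm (f n) = d"
    and lim: "(\<lambda>n. A (f n) - z *\<^sub>C f n) \<longlonglongrightarrow> 0"
  shows "z \<in> l2_spectrum A"
proof (rule ccontr)
  assume "z \<notin> l2_spectrum A"
  then obtain B where B: "bounded_clinear_l2 B" "\<And>f. B (A f - z *\<^sub>C f) = f"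
    unfolding l2_spectrum_def by auto
  have "(\<lambda>n. B (A (f n) - z *\<^sub>C f n)) \<longlonglongrightarrow> B 0"
    by (rule bounded_clinear_l2_tendsto[OF B(1) lim])
  then have "(\<lambda>n. norm (f n)) \<longlonglongrightarrow> 0"
    unfolding B(2) bounded_clinear_l2D(4)[OF B(1)] by (rule tendsto_norm_zero)
  then have "d = 0" unfolding d(2) by (simp add: LIMSEQ_const_iff)
  then show False using d by simp
qed

lemma l2_eigenvalue_in_spectrum:
  assumes "bounded_clinear_l2 A" "l2_eigenvalue A z"
  shows "z \<in> l2_spectrum A"
proof -
  obtain f where "f \<noteq> 0" "A f = z *\<^sub>C f" using assms(2) by (auto simp: l2_eigenvalue_def)
  then show ?thesis using in_l2_spectrumI[OF assms(1), of "norm f" "\<lambda>_. f" z] by simp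
qed

section \<open>Spectral theory of time and band limiting\<close>

lemma norm_square_time_limit_complement:
  "(norm (u - time_limit a u))\<^sup>2 = (norm u)\<^sup>2 - (norm (time_limit a u))\<^sup>2"
proof -
  have "complex_of_real ((norm (u - time_limit a u))\<^sup>2) = complex_of_real ((norm u)\<^sup>2 - (norm (time_limit a u))\<^sup>2)"
    unfolding of_real_diff cinner_self[symmetric]
    by (simp add: cinner_diff_left cinner_diff_right cinner_time_limit)
  then show ?thesis by (simp only: of_real_eq_iff)
qed

locale time_band =
  fixes \<tau> \<omega> :: real
  assumes \<tau>: "\<tau> > 0" and \<omega>: "\<omega> > 0"
begin

abbreviation P :: "l2 \<Rightarrow> l2" where "P \<equiv> time_limit \<tau>"
abbreviation Q :: "l2 \<Rightarrow> l2" where "Q \<equiv> band_limit \<omega>"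

lemmas P_simps = bounded_clinear_l2D[OF bounded_clinear_time_limit[of \<tau>]]
lemmas Q_simps = bounded_clinear_l2D[OF bounded_clinear_band_limit[of \<omega>]]

lemma norm_Q: "norm (Q u) = norm (time_limit \<omega> (inverse_fourier_l2 u))"
  by (simp add: band_limit_eq)

lemma norm_Q_le: "norm (Q u) \<le> norm u"
  using norm_time_limit_le[of \<omega> "inverse_fourier_l2 u"] by (simp add: norm_Q)

lemma norm_PQ_le: "norm (P (Q u)) \<le> norm u"
  using norm_time_limit_le[of \<tau> "Q u"] norm_Q_le[of u] by linarith

lemma cinner_PQ:
  assumes "P u = u" "P v = v"
  shows "cinner_l2 (P (Q u)) v = cinner_l2 u (P (Q v))"
  using assms by (metis cinner_time_limit cinner_band_limit)

text \<open>
  The compressed operator is positive; as \<open>Q\<close> is a projection, its quadratic form is the energy of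
  \<open>u\<close> inside the band.
\<close>

lemma cinner_PQ_self:
  assumes "P u = u"
  shows "cinner_l2 (P (Q u)) u = complex_of_real ((norm (Q u))\<^sup>2)"
proof -
  have "cinner_l2 (P (Q u)) u = cinner_l2 (Q u) u" by (simp add: cinner_time_limit assms)
  also have "\<dots> = cinner_l2 (Q u) (Q u)" by (metis band_limit_idem cinner_band_limit)
  finally show ?thesis by (simp add: cinner_self)
qed

lemma norm_Q_pos:
  assumes "P u = u" "u \<noteq> 0"
  shows "0 < norm (Q u)"
  using time_limited_vanishing_on_band_eq_0[OF assms(1) \<omega>] assms(2) by (auto simp: norm_Q)

lemma norm_Q_less:
  assumes "P u = u" "u \<noteq> 0"
  shows "norm (Q u) < norm u"
proof (rule ccontr)
  assume "\<not> norm (Q u) < norm u"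
  then have "norm (time_limit \<omega> (inverse_fourier_l2 u)) = norm (inverse_fourier_l2 u)"
    using norm_Q_le[of u] by (simp add: norm_Q)
  then have "inverse_fourier_l2 u - time_limit \<omega> (inverse_fourier_l2 u) = 0"
    using norm_square_time_limit_complement[of "inverse_fourier_l2 u" \<omega>] by simp
  then have "time_limit \<omega> (inverse_fourier_l2 u) = inverse_fourier_l2 u" by simp
  then show False using time_limited_band_limited_eq_0[OF assms(1)] assms(2) by blast
qed

lemma compression_eigenvalue_bounds:
  assumes "P u = u" "u \<noteq> 0" "P (Q u) = z *\<^sub>C u"
  shows "\<exists>l. z = complex_of_real l \<and> 0 < l \<and> l < 1"
proof (intro exI conjI)
  have nu: "norm u > 0" using assms(2) by simp
  have "z * complex_of_real ((norm u)\<^sup>2) = complex_of_real ((norm (Q u))\<^sup>2)"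
    using cinner_PQ_self[OF assms(1)] unfolding assms(3) cinner_scaleC_left cinner_self .
  then show "z = complex_of_real ((norm (Q u))\<^sup>2 / (norm u)\<^sup>2)"
    using nu by (simp add: field_simps)
  show "0 < (norm (Q u))\<^sup>2 / (norm u)\<^sup>2"
    using nu norm_Q_pos[OF assms(1,2)] by simp
  have "(norm (Q u))\<^sup>2 < (norm u)\<^sup>2"
    using norm_Q_less[OF assms(1,2)] by (intro power_strict_mono) auto
  then show "(norm (Q u))\<^sup>2 / (norm u)\<^sup>2 < 1" using nu by simp
qed

lemma eigenvectors_orthogonal:
  assumes "P u = u" "P (Q u) = complex_of_real l *\<^sub>C u"
    and "P v = v" "P (Q v) = complex_of_real m *\<^sub>C v" and "l \<noteq> m"
  shows "cinner_l2 u v = 0"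
proof -
  have "l * cinner_l2 u v = m * cinner_l2 u v"
    using cinner_PQ[OF assms(1,3)] unfolding assms(2,4) cinner_scaleC_left cinner_scaleC_right by simp
  then show ?thesis using assms(5) by simp
qed

definition eigenvalues :: "real set" where
  "eigenvalues = {l. compression_eigenvalue \<tau> \<omega> (complex_of_real l)}"

lemma compression_eigenvalueD:
  assumes "compression_eigenvalue \<tau> \<omega> z"
  shows "\<exists>l. z = complex_of_real l \<and> 0 < l \<and> l < 1"
  using assms compression_eigenvalue_bounds unfolding compression_eigenvalue_def by blast

lemma eigenvalues_image: "{z. compression_eigenvalue \<tau> \<omega> z} = complex_of_real ` eigenvalues"
proof (intro equalityI subsetI)
  fix z assume "z \<in> {z. compression_eigenvalue \<tau> \<omega> z}"
  moreover from this obtain l where "z = complex_of_real l" using compression_eigenvalueD by blast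
  ultimately show "z \<in> complex_of_real ` eigenvalues" by (simp add: eigenvalues_def)
qed (auto simp: eigenvalues_def)

lemma eigenvalues_bounds: "l \<in> eigenvalues \<Longrightarrow> 0 < l \<and> l < 1"
  using compression_eigenvalueD[of "complex_of_real l"] by (auto simp: eigenvalues_def)

text \<open>
  Unit eigenvectors \<open>u\<close>, \<open>v\<close> for different eigenvalues \<open>l\<close>, \<open>m\<close> are orthogonal, so their images \<open>l u\<close>,
  \<open>m v\<close> have distance \<open>sqrt (l\<^sup>2 + m\<^sup>2) \<ge> \<epsilon>\<close>. Infinitely many of them would contradict compactness.
\<close>

lemma finite_eigenvalues_ge:
  assumes "\<epsilon> > 0"
  shows "finite {l \<in> eigenvalues. l \<ge> \<epsilon>}"
proof (rule ccontr)
  assume "infinite {l \<in> eigenvalues. l \<ge> \<epsilon>}"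
  then obtain l :: "nat \<Rightarrow> real" where l: "inj l" "range l \<subseteq> {l \<in> eigenvalues. l \<ge> \<epsilon>}"
    using infinite_countable_subset by blast
  have "\<exists>u. norm u = 1 \<and> P u = u \<and> P (Q u) = complex_of_real (l n) *\<^sub>C u" for n
  proof -
    have "l n \<in> eigenvalues" using l(2) by auto
    then obtain u where u: "u \<noteq> 0" "P u = u" "P (Q u) = complex_of_real (l n) *\<^sub>C u"
      by (auto simp: eigenvalues_def compression_eigenvalue_def)
    define v where "v = complex_of_real (1 / norm u) *\<^sub>C u"
    have "norm v = 1" using u(1) by (simp add: v_def norm_divide)
    moreover have "P v = v" "P (Q v) = complex_of_real (l n) *\<^sub>C v"
      by (simp_all add: v_def P_simps Q_simps u mult.commute)
    ultimately show ?thesis by blast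
  qed
  then obtain u where u: "\<And>n. norm (u n) = 1" "\<And>n. P (u n) = u n"
    "\<And>n. P (Q (u n)) = complex_of_real (l n) *\<^sub>C u n" by metis
  have "\<exists>r L. strict_mono (r :: nat \<Rightarrow> nat) \<and> (\<lambda>n. P (Q (u (r n)))) \<longlonglongrightarrow> L"
    by (rule time_limit_band_limit_compact[of _ 1]) (simp add: u)
  then obtain r L where r: "strict_mono (r :: nat \<Rightarrow> nat)" "(\<lambda>n. P (Q (u (r n)))) \<longlonglongrightarrow> L"
    by blast
  then obtain M where M: "\<And>m n. m \<ge> M \<Longrightarrow> n \<ge> M \<Longrightarrow> norm (P (Q (u (r m))) - P (Q (u (r n)))) < \<epsilon>"
    using CauchyD[OF LIMSEQ_imp_Cauchy[OF r(2)] assms] by blast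
  define m n where "m = r M" and "n = r (Suc M)"
  have "m \<noteq> n" using strict_monoD[OF r(1), of M "Suc M"] by (simp add: m_def n_def)
  then have "l m \<noteq> l n" using l(1) by (auto dest: injD)
  then have o: "cinner_l2 (u m) (u n) = 0" "cinner_l2 (u n) (u m) = 0"
    using eigenvectors_orthogonal[OF u(2) u(3) u(2) u(3)] by auto
  have uu: "cinner_l2 (u k) (u k) = 1" for k by (simp add: cinner_self u(1))
  have "complex_of_real ((norm (P (Q (u m)) - P (Q (u n))))\<^sup>2) = complex_of_real ((l m)\<^sup>2 + (l n)\<^sup>2)"
    unfolding cinner_self[symmetric] u(3)
    by (simp add: cinner_diff_left cinner_diff_right cinner_scaleC_left cinner_scaleC_right o
        uu power2_eq_square)
  then have eq: "(norm (P (Q (u m)) - P (Q (u n))))\<^sup>2 = (l m)\<^sup>2 + (l n)\<^sup>2"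
    by (simp only: of_real_eq_iff)
  have "l m \<ge> \<epsilon>" using l(2) by auto
  then have "\<epsilon>\<^sup>2 \<le> (l m)\<^sup>2" using assms by (intro power_mono) auto
  then have "\<epsilon>\<^sup>2 \<le> (norm (P (Q (u m)) - P (Q (u n))))\<^sup>2"
    unfolding eq using zero_le_power2[of "l n"] by linarith
  then have "\<epsilon> \<le> norm (P (Q (u m)) - P (Q (u n)))" by (rule power2_le_imp_le) simp
  then show False using M[of M "Suc M"] by (simp add: m_def n_def)
qed

text \<open>
  Let \<open>A\<close> be the compressed operator and \<open>m\<close> its norm on \<open>V\<close>. Unit vectors \<open>f\<^sub>n\<close> with
  \<open>\<parallel>A f\<^sub>n\<parallel> \<rightarrow> m\<close> satisfy \<open>A (A f\<^sub>n) - m\<^sup>2 f\<^sub>n \<rightarrow> 0\<close>, because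
  \<open>\<parallel>A (A f) - m\<^sup>2 f\<parallel>\<^sup>2 \<le> m\<^sup>2 (m\<^sup>2 - \<parallel>A f\<parallel>\<^sup>2)\<close> for unit vectors. By compactness a subsequence converges to an
  eigenvector \<open>u\<close> of \<open>A\<^sup>2\<close> for \<open>m\<^sup>2\<close>; then either \<open>A u = m u\<close>, or \<open>A u - m u\<close> is an eigenvector of
  \<open>A\<close> for \<open>- m\<close>.
\<close>

lemma invariant_subspace_eigenvector:
  assumes V: "closed V" "\<And>u. u \<in> V \<Longrightarrow> P u = u" "\<And>u v. u \<in> V \<Longrightarrow> v \<in> V \<Longrightarrow> u - v \<in> V"
    "\<And>c u. u \<in> V \<Longrightarrow> c *\<^sub>C u \<in> V" "\<And>u. u \<in> V \<Longrightarrow> P (Q u) \<in> V"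
    and ne: "w \<in> V" "w \<noteq> 0"
  shows "\<exists>u z. u \<in> V \<and> u \<noteq> 0 \<and> P (Q u) = z *\<^sub>C u"
proof -
  define A where "A u = P (Q u)" for u
  have A: "bounded_clinear_l2 A"
    unfolding A_def by (rule bounded_clinear_l2_comp[OF bounded_clinear_time_limit bounded_clinear_band_limit])
  note A_simps = bounded_clinear_l2D[OF A]
  define S where "S = {norm (A u) | u. u \<in> V \<and> norm u = 1}"
  have bdd: "bdd_above S"
  proof (rule bdd_aboveI)
    fix x assume "x \<in> S"
    then obtain u where "x = norm (P (Q u))" "norm u = 1" by (auto simp: S_def A_def)
    then show "x \<le> 1" using norm_PQ_le[of u] by simp
  qed
  define w' where "w' = complex_of_real (1 / norm w) *\<^sub>C w"
  have w': "w' \<in> V" "norm w' = 1" using ne V(4) by (auto simp: w'_def norm_divide)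
  have wS: "norm (A w') \<in> S" using w' by (auto simp: S_def)
  define m where "m = Sup S"
  have Sm: "norm (A u) \<le> m * norm u" if "u \<in> V" for u
  proof (cases "u = 0")
    case False
    define u' where "u' = complex_of_real (1 / norm u) *\<^sub>C u"
    have "u' \<in> V" "norm u' = 1" using that False V(4) by (auto simp: u'_def norm_divide)
    then have "norm (A u') \<le> m" unfolding m_def by (intro cSup_upper bdd) (auto simp: S_def)
    then show ?thesis using False by (simp add: u'_def A_simps norm_divide field_simps)
  qed (simp add: A_simps)
  have "A w' \<noteq> 0"
  proof
    assume "A w' = 0"
    then have "norm (Q w') = 0"
      using cinner_PQ_self[OF V(2)[OF w'(1)]] by (simp add: A_def)
    moreover have "w' \<noteq> 0" using w'(2) by auto
    ultimately show False using norm_Q_pos[OF V(2)[OF w'(1)]] by simp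
  qed
  then have m0: "m > 0" using Sm[OF w'(1)] w'(2) by (simp add: less_le_trans[of 0 "norm (A w')"])
  have "\<exists>u. u \<in> V \<and> norm u = 1 \<and> m - 1 / real (Suc n) < norm (A u)" for n
  proof -
    have "\<exists>x\<in>S. m - 1 / real (Suc n) < x"
      unfolding m_def by (rule less_cSupD) (use wS in auto)
    then show ?thesis by (auto simp: S_def)
  qed
  then obtain f where f: "\<And>n. f n \<in> V" "\<And>n. norm (f n) = 1" "\<And>n. m - 1 / real (Suc n) < norm (A (f n))"
    by metis
  have "(\<lambda>n. norm (A (f n))) \<longlonglongrightarrow> m"
  proof (rule tendsto_sandwich)
    show "(\<lambda>n. m - 1 / real (Suc n)) \<longlonglongrightarrow> m" by real_asymp
    show "\<forall>\<^sub>F n in sequentially. m - 1 / real (Suc n) \<le> norm (A (f n))"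
      using f(3) by (intro always_eventually allI less_imp_le)
    show "\<forall>\<^sub>F n in sequentially. norm (A (f n)) \<le> m" using Sm[OF f(1)] f(2) by simp
  qed auto
  then have lim2: "(\<lambda>n. m\<^sup>2 * (m\<^sup>2 - (norm (A (f n)))\<^sup>2)) \<longlonglongrightarrow> m\<^sup>2 * (m\<^sup>2 - m\<^sup>2)"
    by (intro tendsto_intros)
  \<comment> \<open>the defect in the eigenvalue equation for \<open>A\<^sup>2\<close>\<close>
  define d where "d n = A (A (f n)) - complex_of_real (m\<^sup>2) *\<^sub>C f n" for n
  have d_le: "(norm (d n))\<^sup>2 \<le> m\<^sup>2 * (m\<^sup>2 - (norm (A (f n)))\<^sup>2)" for n
  proof -
    have AV: "A (f n) \<in> V" unfolding A_def by (rule V(5)[OF f(1)])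
    have c1: "cinner_l2 (A (A (f n))) (f n) = complex_of_real ((norm (A (f n)))\<^sup>2)"
      unfolding cinner_self[symmetric] using cinner_PQ[OF V(2)[OF AV] V(2)[OF f(1)]] by (simp add: A_def)
    have c2: "cinner_l2 (f n) (A (A (f n))) = complex_of_real ((norm (A (f n)))\<^sup>2)"
      using cinner_cnj[of "f n" "A (A (f n))"] c1 by simp
    have c3: "cinner_l2 (f n) (f n) = 1" by (simp add: cinner_self f(2))
    have c4: "cinner_l2 (A (A (f n))) (A (A (f n))) = complex_of_real ((norm (A (A (f n))))\<^sup>2)"
      by (rule cinner_self)
    have "complex_of_real ((norm (d n))\<^sup>2)
        = complex_of_real ((norm (A (A (f n))))\<^sup>2 - 2 * m\<^sup>2 * (norm (A (f n)))\<^sup>2 + m\<^sup>2 * m\<^sup>2)"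
      unfolding cinner_self[symmetric] d_def
      by (simp add: cinner_diff_left cinner_diff_right cinner_scaleC_left cinner_scaleC_right
          c1 c2 c3 c4 algebra_simps)
    then have "(norm (d n))\<^sup>2 = (norm (A (A (f n))))\<^sup>2 - 2 * m\<^sup>2 * (norm (A (f n)))\<^sup>2 + m\<^sup>2 * m\<^sup>2"
      by (simp only: of_real_eq_iff)
    moreover have "(norm (A (A (f n))))\<^sup>2 \<le> m\<^sup>2 * (norm (A (f n)))\<^sup>2"
      using power_mono[OF Sm[OF AV], of 2] by (simp add: power_mult_distrib)
    ultimately show ?thesis by (simp add: algebra_simps)
  qed
  have "(\<lambda>n. (norm (d n))\<^sup>2) \<longlonglongrightarrow> 0"
    by (rule tendsto_sandwich[OF _ _ tendsto_const]) (use lim2 d_le in auto)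
  then have "(\<lambda>n. sqrt ((norm (d n))\<^sup>2)) \<longlonglongrightarrow> sqrt 0" by (rule tendsto_real_sqrt)
  then have d0: "d \<longlonglongrightarrow> 0" by (simp add: tendsto_norm_zero_iff)
  have "\<exists>r L. strict_mono (r :: nat \<Rightarrow> nat) \<and> (\<lambda>n. P (Q (f (r n)))) \<longlonglongrightarrow> L"
    by (rule time_limit_band_limit_compact[of _ 1]) (simp add: f)
  then obtain r L where r: "strict_mono (r :: nat \<Rightarrow> nat)" "(\<lambda>n. A (f (r n))) \<longlonglongrightarrow> L"
    by (auto simp: A_def)
  have AAL: "(\<lambda>n. A (A (f (r n)))) \<longlonglongrightarrow> A L"
    by (rule bounded_clinear_l2_tendsto[OF A r(2)])
  have dr: "(\<lambda>n. d (r n)) \<longlonglongrightarrow> 0" using LIMSEQ_subseq_LIMSEQ[OF d0 r(1)] by (simp add: o_def)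
  define k where "k = complex_of_real (1 / m\<^sup>2)"
  have km: "k * complex_of_real (m\<^sup>2) = 1" using m0 by (simp add: k_def flip: of_real_mult)
  have "f (r n) = k *\<^sub>C (A (A (f (r n))) - d (r n))" for n
    using km by (simp add: d_def)
  moreover have "(\<lambda>n. k *\<^sub>C (A (A (f (r n))) - d (r n))) \<longlonglongrightarrow> k *\<^sub>C (A L - 0)"
    by (intro bounded_linear.tendsto[OF bounded_linear_scaleC] tendsto_diff AAL dr)
  ultimately have fl: "(\<lambda>n. f (r n)) \<longlonglongrightarrow> k *\<^sub>C A L" by simp
  define u where "u = k *\<^sub>C A L"
  have fu: "(\<lambda>n. f (r n)) \<longlonglongrightarrow> u" using fl by (simp add: u_def)
  have uV: "u \<in> V" by (rule closed_sequentially[OF V(1) _ fu]) (rule f)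
  have "norm u = 1"
    using LIMSEQ_unique[OF tendsto_norm[OF fu]] by (simp add: f(2))
  then have u0: "u \<noteq> 0" by auto
  have AAu: "A (A u) = complex_of_real (m\<^sup>2) *\<^sub>C u"
  proof -
    have "(\<lambda>n. A (A (f (r n)))) \<longlonglongrightarrow> A (A u)"
      by (intro bounded_clinear_l2_tendsto[OF A] fu)
    then have "A (A u) = A L" using AAL LIMSEQ_unique by blast
    then show ?thesis using km by (simp add: u_def mult.commute)
  qed
  define g where "g = A u - complex_of_real m *\<^sub>C u"
  show ?thesis
  proof (cases "g = 0")
    case True
    then show ?thesis using uV u0 by (auto simp: g_def A_def)
  next
    case False
    have "g \<in> V" using uV V by (auto simp: g_def A_def)
    moreover have "A g = complex_of_real (- m) *\<^sub>C g"
      by (simp add: g_def A_simps AAu scaleC_diff_right scaleC_minus_left power2_eq_square)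
    ultimately show ?thesis using False by (auto simp: A_def)
  qed
qed

text \<open>
  Band limiting is, up to the unitary Fourier transform, a restriction of the inverse transform, to
  which the decay for modulated indicators applies after conjugation.
\<close>

lemma oscillating_sequence:
  "\<exists>f. (\<forall>n. norm (f n) = sqrt (2 * \<tau>) \<and> P (f n) = f n) \<and> (\<lambda>n. Q (f n)) \<longlonglongrightarrow> 0"
proof (intro exI conjI allI)
  fix n :: nat
  show "norm (cnj_l2 (modulated (- \<tau>) \<tau> (real n))) = sqrt (2 * \<tau>)"
    using \<tau> by (simp add: norm_modulated)
  show "P (cnj_l2 (modulated (- \<tau>) \<tau> (real n))) = cnj_l2 (modulated (- \<tau>) \<tau> (real n))"
    by (simp add: time_limit_cnj_l2 time_limit_modulated_inside)
next
  have "(\<lambda>n. norm (time_limit \<omega> (fourier_l2 (modulated (- \<tau>) \<tau> (real n))))) \<longlonglongrightarrow> 0"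
    using \<tau> by (intro tendsto_norm_zero tendsto_fourier_modulated) simp
  then have "(\<lambda>n. norm (Q (cnj_l2 (modulated (- \<tau>) \<tau> (real n))))) \<longlonglongrightarrow> 0"
    by (simp add: norm_Q inverse_fourier_l2_def time_limit_cnj_l2)
  then show "(\<lambda>n. Q (cnj_l2 (modulated (- \<tau>) \<tau> (real n)))) \<longlonglongrightarrow> 0"
    by (simp add: tendsto_norm_zero_iff)
qed

text \<open>
  The product of the commuting operators \<open>P Q - m\<close> over the entries \<open>m\<close> of a list, applied to a vector.
\<close>

definition factors :: "real list \<Rightarrow> l2 \<Rightarrow> l2" where
  "factors = fold (\<lambda>m u. P (Q u) - complex_of_real m *\<^sub>C u)"

lemma factors_Cons: "factors (m # ms) u = factors ms (P (Q u) - complex_of_real m *\<^sub>C u)"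
  by (simp add: factors_def)

lemma factors_Nil: "factors [] u = u"
  by (simp add: factors_def)

lemma P_factors: "P u = u \<Longrightarrow> P (factors ms u) = factors ms u"
  by (induction ms arbitrary: u) (simp_all add: factors_Cons factors_Nil P_simps)

lemma cinner_factors:
  assumes e: "P e = e" "P (Q e) = complex_of_real l *\<^sub>C e" and "P u = u"
  shows "cinner_l2 (factors ms u) e = (\<Prod>m\<leftarrow>ms. complex_of_real (l - m)) * cinner_l2 u e"
  using assms(3)
proof (induction ms arbitrary: u)
  case (Cons m ms)
  have "cinner_l2 (P (Q u) - complex_of_real m *\<^sub>C u) e = complex_of_real (l - m) * cinner_l2 u e"
    unfolding cinner_diff_left cinner_PQ[OF Cons.prems e(1)] e(2)
    by (simp add: cinner_scaleC_left cinner_scaleC_right algebra_simps)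
  then show ?case
    using Cons.prems by (subst factors_Cons, subst Cons.IH) (simp_all add: P_simps)
qed (simp add: factors_Nil)

text \<open>
  The polynomial \<open>\<Prod> (x - m)\<close> has a nonzero constant term, so a multiple of the identity is a combination
  of it and of a multiple of \<open>x\<close>. The induction on the list is the quantitative form of this.
\<close>

lemma factors_bounded_below:
  assumes "\<And>m. m \<in> set ms \<Longrightarrow> m \<noteq> 0"
  shows "\<exists>C\<ge>0. \<forall>u. norm u \<le> C * (norm (P (Q u)) + norm (factors ms u))"
  using assms
proof (induction ms)
  case Nil
  then show ?case by (intro exI[of _ 1]) (simp add: factors_Nil)
next
  case (Cons m ms)
  then obtain C where C: "C \<ge> 0" "\<And>u. norm u \<le> C * (norm (P (Q u)) + norm (factors ms u))" by auto
  have m: "\<bar>m\<bar> > 0" using Cons.prems by auto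
  have "norm u \<le> (1 + C * (1 + \<bar>m\<bar>)) / \<bar>m\<bar> * (norm (P (Q u)) + norm (factors (m # ms) u))" for u
  proof -
    define v where "v = P (Q u) - complex_of_real m *\<^sub>C u"
    have "norm (P (Q v)) \<le> norm (P (Q (P (Q u)))) + norm (complex_of_real m *\<^sub>C P (Q u))"
      unfolding v_def P_simps Q_simps by (rule norm_triangle_ineq4)
    also have "\<dots> \<le> norm (P (Q u)) + \<bar>m\<bar> * norm (P (Q u))" using norm_PQ_le by simp
    finally have 1: "norm (P (Q v)) \<le> (1 + \<bar>m\<bar>) * norm (P (Q u))" by (simp add: algebra_simps)
    have "norm v \<le> C * (norm (P (Q v)) + norm (factors ms v))" by (rule C(2))
    also have "\<dots> \<le> C * ((1 + \<bar>m\<bar>) * norm (P (Q u)) + norm (factors ms v))"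
      by (intro mult_left_mono add_right_mono 1 C(1))
    finally have 2: "norm v \<le> C * (1 + \<bar>m\<bar>) * norm (P (Q u)) + C * norm (factors ms v)"
      by (simp add: algebra_simps)
    have "norm (complex_of_real m *\<^sub>C u) = norm (P (Q u) - v)" by (simp add: v_def)
    also have "\<dots> \<le> norm (P (Q u)) + norm v" by (rule norm_triangle_ineq4)
    finally have 3: "\<bar>m\<bar> * norm u \<le> norm (P (Q u)) + norm v" by simp
    have "0 \<le> (1 + C * \<bar>m\<bar>) * norm (factors ms v)" using C(1) by simp
    then have "\<bar>m\<bar> * norm u \<le> (1 + C * (1 + \<bar>m\<bar>)) * (norm (P (Q u)) + norm (factors ms v))"
      using 2 3 by (simp add: algebra_simps)
    then show ?thesis using m unfolding factors_Cons v_def[symmetric] by (simp add: field_simps)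
  qed
  moreover have "(1 + C * (1 + \<bar>m\<bar>)) / \<bar>m\<bar> \<ge> 0" using C(1) by auto
  ultimately show ?case by blast
qed

text \<open>
  The subspace \<open>V\<close> of the range of \<open>P\<close> orthogonal to all eigenvectors is invariant, hence zero. If the
  eigenvalues were the entries of a finite list, then the product of the corresponding factors would
  map the range of \<open>P\<close> into \<open>V\<close>, so it would be zero there. The preceding bound then keeps \<open>P Q f\<close>
  away from zero on vectors of fixed norm, against the oscillating sequence.
\<close>

lemma infinite_eigenvalues: "infinite eigenvalues"
proof
  assume "finite eigenvalues"
  then obtain ms where ms: "set ms = eigenvalues" using finite_list by blast
  define V where "V = {u. P u = u} \<inter> (\<Inter>e\<in>{e. P e = e \<and> (\<exists>z. P (Q e) = z *\<^sub>C e)}. {u. cinner_l2 u e = 0})"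
  have V0: "V \<subseteq> {0}"
  proof
    fix w assume w: "w \<in> V"
    show "w \<in> {0}"
    proof (rule ccontr)
      assume "w \<notin> {0}"
      then have "w \<noteq> 0" by simp
      have "\<exists>u z. u \<in> V \<and> u \<noteq> 0 \<and> P (Q u) = z *\<^sub>C u"
      proof (rule invariant_subspace_eigenvector[OF _ _ _ _ _ w \<open>w \<noteq> 0\<close>])
        have cont: "continuous_on UNIV (\<lambda>u. cinner_l2 u e)" for e
          by (simp add: continuous_on_def tendsto_cinner)
        have contP: "continuous_on UNIV P"
          by (simp add: linear_continuous_on P_simps)
        show "closed V"
          unfolding V_def
          by (intro closed_Int closed_INT ballI closed_Collect_eq continuous_on_const continuous_on_id cont contP)
        show "P u = u" if "u \<in> V" for u using that by (simp add: V_def)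
        show "u - v \<in> V" if "u \<in> V" "v \<in> V" for u v
          using that by (auto simp: V_def P_simps cinner_diff_left)
        show "c *\<^sub>C u \<in> V" if "u \<in> V" for c u
          using that by (auto simp: V_def P_simps cinner_scaleC_left)
        show "P (Q u) \<in> V" if u: "u \<in> V" for u
          using u by (auto simp: V_def cinner_PQ cinner_scaleC_right)
      qed
      then obtain u z where "u \<in> V" "u \<noteq> 0" "P (Q u) = z *\<^sub>C u" by blast
      then have "cinner_l2 u u = 0" by (auto simp: V_def)
      then show False using \<open>u \<noteq> 0\<close> by (simp add: cinner_self)
    qed
  qed
  have fz: "factors ms u = 0" if u: "P u = u" for u
  proof -
    have "cinner_l2 (factors ms u) e = 0" if e: "P e = e" "P (Q e) = z *\<^sub>C e" for e z
    proof (cases "e = 0")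
      case False
      obtain l where l: "z = complex_of_real l" using compression_eigenvalue_bounds[OF e(1) False e(2)] by blast
      then have "l \<in> set ms"
        using e False by (auto simp: ms eigenvalues_def compression_eigenvalue_def)
      then have "(\<Prod>m\<leftarrow>ms. complex_of_real (l - m)) = 0"
        by (auto simp: prod_list_zero_iff)
      then show ?thesis using cinner_factors[OF e(1) _ u, of l ms] e(2) l by simp
    qed simp
    then have "factors ms u \<in> V" using P_factors[OF u] by (auto simp: V_def)
    then show ?thesis using V0 by auto
  qed
  obtain C where C: "C \<ge> 0" "\<And>u. norm u \<le> C * (norm (P (Q u)) + norm (factors ms u))"
    using factors_bounded_below[of ms] eigenvalues_bounds ms by force
  obtain f where f: "\<And>n. norm (f n) = sqrt (2 * \<tau>)" "\<And>n. P (f n) = f n" "(\<lambda>n. Q (f n)) \<longlonglongrightarrow> 0"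
    using oscillating_sequence by blast
  have "(\<lambda>n. C * norm (P (Q (f n)))) \<longlonglongrightarrow> C * norm (P 0)"
    by (intro tendsto_mult tendsto_const tendsto_norm bounded_clinear_l2_tendsto[OF bounded_clinear_time_limit] f(3))
  moreover have "sqrt (2 * \<tau>) \<le> C * norm (P (Q (f n)))" for n
    using C(2)[of "f n"] by (simp add: f(1) fz[OF f(2)])
  ultimately have "sqrt (2 * \<tau>) \<le> 0" by (intro LIMSEQ_le_const) (auto simp: P_simps)
  then show False using \<tau> by simp
qed

subsection \<open>The sum of the two projections\<close>

definition T :: "l2 \<Rightarrow> l2" where "T u = P u + Q u"

lemma bounded_clinear_T: "bounded_clinear_l2 T"
  unfolding T_def[abs_def]
  by (rule bounded_clinear_l2_add[OF bounded_clinear_time_limit bounded_clinear_band_limit])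

lemmas T_simps = bounded_clinear_l2D[OF bounded_clinear_T]

lemma cinner_T: "cinner_l2 (T u) v = cinner_l2 u (T v)"
  by (simp add: T_def cinner_add_left cinner_add_right cinner_time_limit cinner_band_limit)

lemma eigenvalue_T_real:
  assumes "T u = z *\<^sub>C u" "u \<noteq> 0"
  shows "cnj z = z"
  using cinner_T[of u u] assms by (simp add: cinner_scaleC_left cinner_scaleC_right cinner_self)

text \<open>
  With \<open>b = Q a / w\<close> the vector \<open>a + b\<close> is an eigenvector. It is nonzero since
  \<open>P (a + b) = (1 + w) a\<close> and \<open>w \<noteq> - 1\<close>, as \<open>w\<^sup>2 < 1\<close>.
\<close>

lemma eigenvalue_T_if:
  assumes "l \<in> eigenvalues" and w: "w\<^sup>2 = l"
  shows "l2_eigenvalue T (complex_of_real (1 + w))"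
proof -
  have l: "0 < l" "l < 1" using eigenvalues_bounds[OF assms(1)] by auto
  have w0: "w \<noteq> 0" "1 + w \<noteq> 0" using l w by (auto simp: add_eq_0_iff power2_eq_square)
  obtain a where a: "a \<noteq> 0" "P a = a" "P (Q a) = complex_of_real l *\<^sub>C a"
    using assms(1) by (auto simp: eigenvalues_def compression_eigenvalue_def)
  define b where "b = complex_of_real (1 / w) *\<^sub>C Q a"
  have "complex_of_real (1 / w) * complex_of_real l = complex_of_real w"
  proof -
    have "1 / w * l = w" using w w0(1) by (simp add: power2_eq_square field_simps)
    then show ?thesis by (simp only: of_real_mult[symmetric])
  qed
  then have Pb: "P b = complex_of_real w *\<^sub>C a"
    by (simp only: b_def P_simps a(3) scaleC_scaleC)
  have Qb: "Q b = b" by (simp add: b_def Q_simps)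
  have Qa: "Q a = complex_of_real w *\<^sub>C b" using w0(1) by (simp add: b_def flip: of_real_mult)
  have Pf: "P (a + b) = complex_of_real (1 + w) *\<^sub>C a"
    by (simp add: P_simps a(2) Pb scaleC_add_left)
  have "T (a + b) = complex_of_real (1 + w) *\<^sub>C (a + b)"
    unfolding T_def Pf by (simp add: Q_simps Qa Qb scaleC_add_left scaleC_add_right)
  moreover have "a + b \<noteq> 0"
  proof
    assume "a + b = 0"
    then have "complex_of_real (1 + w) *\<^sub>C a = 0" using Pf by (simp add: P_simps)
    then show False using a(1) w0(2) by (simp del: of_real_add)
  qed
  ultimately show ?thesis unfolding l2_eigenvalue_def by blast
qed

lemma eigenvalue_T_only_if:
  assumes "l2_eigenvalue T z" "z \<noteq> 0" "z \<noteq> 1"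
  shows "compression_eigenvalue \<tau> \<omega> ((z - 1)\<^sup>2)"
proof -
  obtain u where u: "u \<noteq> 0" "T u = z *\<^sub>C u" using assms(1) by (auto simp: l2_eigenvalue_def)
  define a b where "a = P u" and "b = Q u"
  have ab: "a + b = z *\<^sub>C u" using u(2) by (simp add: T_def a_def b_def)
  have "P (a + b) = z *\<^sub>C a" unfolding ab by (simp add: P_simps a_def)
  then have Pb: "P b = (z - 1) *\<^sub>C a"
    by (simp add: P_simps a_def scaleC_diff_left algebra_simps)
  have "Q (a + b) = z *\<^sub>C b" unfolding ab by (simp add: Q_simps b_def)
  then have Qa: "Q a = (z - 1) *\<^sub>C b"
    by (simp add: Q_simps b_def scaleC_diff_left algebra_simps)
  have "a \<noteq> 0"
  proof
    assume "a = 0"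
    then have "b = 0" using Qa assms(3) by (simp add: Q_simps)
    then show False using ab \<open>a = 0\<close> u(1) assms(2) by simp
  qed
  moreover have "P a = a" by (simp add: a_def)
  moreover have "P (Q a) = (z - 1)\<^sup>2 *\<^sub>C a" by (simp add: Qa P_simps Pb power2_eq_square)
  ultimately show ?thesis unfolding compression_eigenvalue_def by blast
qed

text \<open>
  Let \<open>f\<^sub>n\<close> be unit vectors with \<open>d\<^sub>n = T f\<^sub>n - z f\<^sub>n \<rightarrow> 0\<close>. Along a subsequence \<open>P Q f\<^sub>n\<close> converges, by
  compactness. Then so does \<open>P f\<^sub>n = (P Q f\<^sub>n - P d\<^sub>n) / (z - 1)\<close>, then \<open>Q f\<^sub>n\<close> by the same formula with \<open>P\<close> and
  \<open>Q\<close> exchanged, and then \<open>f\<^sub>n = (P f\<^sub>n + Q f\<^sub>n - d\<^sub>n) / z\<close>. The limit is an eigenvector.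
\<close>

lemma T_bounded_below:
  assumes z: "z \<noteq> 0" "z \<noteq> 1" "\<not> l2_eigenvalue T z"
  shows "\<exists>c>0. \<forall>f. c * norm f \<le> norm (T f - z *\<^sub>C f)"
proof (rule ccontr)
  assume neg: "\<not> ?thesis"
  have "\<exists>f. norm f = 1 \<and> norm (T f - z *\<^sub>C f) < 1 / real (Suc n)" for n
  proof -
    obtain f where f: "norm (T f - z *\<^sub>C f) < 1 / real (Suc n) * norm f"
      using neg by (metis not_le of_nat_0_less_iff zero_less_Suc zero_less_divide_1_iff)
    then have f0: "f \<noteq> 0" by (auto simp: T_simps)
    define g where "g = complex_of_real (1 / norm f) *\<^sub>C f"
    have "T g - z *\<^sub>C g = complex_of_real (1 / norm f) *\<^sub>C (T f - z *\<^sub>C f)"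
      by (simp add: g_def T_simps scaleC_diff_right mult.commute)
    then have "norm (T g - z *\<^sub>C g) = norm (T f - z *\<^sub>C f) / norm f" by (simp add: norm_divide)
    also have "\<dots> < 1 / real (Suc n)" using f f0 by (simp add: field_simps)
    finally show ?thesis using f0 by (intro exI[of _ g]) (simp add: g_def norm_divide)
  qed
  then obtain f where f: "\<And>n. norm (f n) = 1" "\<And>n. norm (T (f n) - z *\<^sub>C f n) < 1 / real (Suc n)"
    by metis
  define d where "d n = T (f n) - z *\<^sub>C f n" for n
  have "(\<lambda>n. norm (d n)) \<longlonglongrightarrow> 0"
  proof (rule tendsto_sandwich[OF _ _ tendsto_const])
    show "(\<lambda>n. 1 / real (Suc n)) \<longlonglongrightarrow> 0" by real_asymp
    show "\<forall>\<^sub>F n in sequentially. norm (d n) \<le> 1 / real (Suc n)"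
      unfolding d_def using f(2) by (intro always_eventually allI less_imp_le)
  qed simp
  then have d0: "d \<longlonglongrightarrow> 0" by (simp add: tendsto_norm_zero_iff)
  have "\<exists>r L. strict_mono (r :: nat \<Rightarrow> nat) \<and> (\<lambda>n. P (Q (f (r n)))) \<longlonglongrightarrow> L"
    by (rule time_limit_band_limit_compact[of _ 1]) (simp add: f)
  then obtain r L where r: "strict_mono (r :: nat \<Rightarrow> nat)" "(\<lambda>n. P (Q (f (r n)))) \<longlonglongrightarrow> L"
    by blast
  have dr: "(\<lambda>n. d (r n)) \<longlonglongrightarrow> 0" using LIMSEQ_subseq_LIMSEQ[OF d0 r(1)] by (simp add: o_def)
  define k where "k = 1 / (z - 1)"
  have k: "k * (z - 1) = 1" using z by (simp add: k_def)
  note lims = bounded_linear.tendsto[OF bounded_linear_scaleC] tendsto_diff tendsto_add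
    bounded_clinear_l2_tendsto[OF bounded_clinear_time_limit] bounded_clinear_l2_tendsto[OF bounded_clinear_band_limit]
  have "P (f n) = k *\<^sub>C (P (Q (f n)) - P (d n))" for n
  proof -
    have "P (Q (f n)) - P (d n) = (z - 1) *\<^sub>C P (f n)"
      by (simp add: d_def T_def P_simps scaleC_diff_left algebra_simps)
    then show ?thesis using k by simp
  qed
  moreover have "(\<lambda>n. k *\<^sub>C (P (Q (f (r n))) - P (d (r n)))) \<longlonglongrightarrow> k *\<^sub>C (L - P 0)"
    by (intro lims r(2) dr)
  ultimately have a: "(\<lambda>n. P (f (r n))) \<longlonglongrightarrow> k *\<^sub>C (L - P 0)" by simp
  have "Q (f n) = k *\<^sub>C (Q (P (f n)) - Q (d n))" for n
  proof -
    have "Q (P (f n)) - Q (d n) = (z - 1) *\<^sub>C Q (f n)"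
      by (simp add: d_def T_def Q_simps scaleC_diff_left algebra_simps)
    then show ?thesis using k by simp
  qed
  moreover have "(\<lambda>n. k *\<^sub>C (Q (P (f (r n))) - Q (d (r n)))) \<longlonglongrightarrow> k *\<^sub>C (Q (k *\<^sub>C (L - P 0)) - Q 0)"
    by (intro lims a dr)
  ultimately have b: "(\<lambda>n. Q (f (r n))) \<longlonglongrightarrow> k *\<^sub>C (Q (k *\<^sub>C (L - P 0)) - Q 0)" by simp
  have "f n = (1 / z) *\<^sub>C (P (f n) + Q (f n) - d n)" for n
    using z by (simp add: d_def T_def)
  with bounded_linear.tendsto[OF bounded_linear_scaleC[of "1 / z"] tendsto_diff[OF tendsto_add[OF a b] dr]]
  obtain g where g: "(\<lambda>n. f (r n)) \<longlonglongrightarrow> g" by auto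
  have "norm g = 1" using LIMSEQ_unique[OF tendsto_norm[OF g]] by (simp add: f(1))
  then have "g \<noteq> 0" by auto
  moreover have "T g = z *\<^sub>C g"
  proof -
    have "(\<lambda>n. d (r n)) \<longlonglongrightarrow> T g - z *\<^sub>C g"
      unfolding d_def by (intro lims bounded_clinear_l2_tendsto[OF bounded_clinear_T] g)
    then have "T g - z *\<^sub>C g = 0" by (rule LIMSEQ_unique[OF _ dr])
    then show ?thesis by simp
  qed
  ultimately show False using z(3) by (auto simp: l2_eigenvalue_def)
qed

text \<open>
  The adjoint \<open>T - cnj z\<close> is injective because eigenvalues of the self-adjoint operator \<open>T\<close> are real.
\<close>

lemma not_in_spectrum_T:
  assumes z: "z \<noteq> 0" "z \<noteq> 1" "\<not> l2_eigenvalue T z"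
  shows "z \<notin> l2_spectrum T"
proof -
  obtain c where c: "c > 0" "\<And>f. c * norm f \<le> norm (T f - z *\<^sub>C f)"
    using T_bounded_below[OF z] by blast
  show ?thesis
  proof (rule not_in_l2_spectrumI[OF bounded_clinear_T c])
    fix g
    have bl: "bounded_linear (\<lambda>f. T f - y *\<^sub>C f)" for y
      using bounded_clinear_l2D(5)[OF bounded_clinear_l2_diff[OF bounded_clinear_T bounded_clinear_l2_scaleC]] .
    show "\<exists>f. T f - z *\<^sub>C f = g"
    proof (rule surj_of_bounded_below[OF bl bl _ c])
      show "inner (T f - z *\<^sub>C f) h = inner f (T h - cnj z *\<^sub>C h)" for f h
        by (simp add: inner_l2_def cinner_diff_left cinner_diff_right cinner_T cinner_scaleC_left cinner_scaleC_right)
      show "h = 0" if "T h - cnj z *\<^sub>C h = 0" for h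
      proof (rule ccontr)
        assume "h \<noteq> 0"
        have "T h = cnj z *\<^sub>C h" using that by simp
        moreover from this have "cnj z = z" using eigenvalue_T_real[OF _ \<open>h \<noteq> 0\<close>] by fastforce
        ultimately show False using z(3) \<open>h \<noteq> 0\<close> by (auto simp: l2_eigenvalue_def)
      qed
    qed
  qed
qed

text \<open>
  The functions have their frequencies outside the band, and for large \<open>n\<close> little of their mass lies in
  the time interval.
\<close>

lemma zero_in_spectrum_T: "0 \<in> l2_spectrum T"
proof (rule in_l2_spectrumI[OF bounded_clinear_T])
  define f where "f n = fourier_l2 (modulated \<omega> (\<omega> + 1) (real n))" for n :: nat
  show "norm (f n) = 1" for n by (simp add: f_def norm_modulated)
  have "Q (f n) = 0" for n
    by (simp add: f_def band_limit_eq time_limit_modulated_outside bounded_clinear_l2D[OF bounded_clinear_fourier_l2])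
  moreover have "(\<lambda>n. P (f n)) \<longlonglongrightarrow> 0"
    unfolding f_def by (rule tendsto_fourier_modulated) simp
  ultimately show "(\<lambda>n. T (f n) - 0 *\<^sub>C f n) \<longlonglongrightarrow> 0" by (simp add: T_def)
qed simp

text \<open>
  The functions live on the time interval, and for large \<open>n\<close> little of their mass lies in the band.
\<close>

lemma one_in_spectrum_T: "1 \<in> l2_spectrum T"
proof -
  obtain f where f: "\<And>n. norm (f n) = sqrt (2 * \<tau>)" "\<And>n. P (f n) = f n" "(\<lambda>n. Q (f n)) \<longlonglongrightarrow> 0"
    using oscillating_sequence by blast
  show ?thesis
  proof (rule in_l2_spectrumI[OF bounded_clinear_T _ f(1)])
    show "(\<lambda>n. T (f n) - 1 *\<^sub>C f n) \<longlonglongrightarrow> 0" using f(3) by (simp add: T_def f(2))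
  qed (use \<tau> in simp)
qed

text \<open>
  The description by which the sequence is defined is satisfied by exactly one sequence.
\<close>

lemma sinc_eigenvalue_seq_range: "range (sinc_eigenvalue_seq (\<omega> * \<tau>)) = eigenvalues"
proof -
  define good where "good l \<longleftrightarrow> (\<forall>m n. m < n \<longrightarrow> l n < l m) \<and>
    range (\<lambda>n. complex_of_real (l n)) = {z. sinc_eigenvalue (\<omega> * \<tau>) z}" for l :: "nat \<Rightarrow> real"
  have good_iff: "good l \<longleftrightarrow> (\<forall>m n. m < n \<longrightarrow> l n < l m) \<and> range l = eigenvalues" for l
  proof -
    have "range (\<lambda>n. complex_of_real (l n)) = complex_of_real ` range l" by auto
    moreover have "inj complex_of_real" by (simp add: inj_def)
    ultimately show ?thesis
      by (simp add: good_def sinc_eigenvalue_iff_compression[OF \<tau> \<omega>] eigenvalues_image inj_image_eq_iff)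
  qed
  have "\<exists>l. good l"
    unfolding good_iff
    by (rule strictly_decreasing_enumeration_exists[OF infinite_eigenvalues finite_eigenvalues_ge])
       (use eigenvalues_bounds in blast)
  then have "\<exists>!l. good l"
    by (rule ex_ex1I) (rule strictly_decreasing_enumeration_unique, auto simp: good_iff)
  then have "good (THE l. good l)" by (rule theI')
  moreover have "sinc_eigenvalue_seq (\<omega> * \<tau>) = (THE l. good l)"
    unfolding sinc_eigenvalue_seq_def good_def ..
  ultimately show ?thesis by (simp add: good_iff)
qed

lemma spectrum_T:
  shows "l2_spectrum T = {0, 1}
      \<union> {complex_of_real (1 + sqrt (sinc_eigenvalue_seq (\<omega> * \<tau>) n)) | n. True}
      \<union> {complex_of_real (1 - sqrt (sinc_eigenvalue_seq (\<omega> * \<tau>) n)) | n. True}" (is "_ = {0, 1} \<union> ?plus \<union> ?minus")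
    and "l2_eigenvalue T (complex_of_real (1 + sqrt (sinc_eigenvalue_seq (\<omega> * \<tau>) n)))" (is ?ev1)
    and "l2_eigenvalue T (complex_of_real (1 - sqrt (sinc_eigenvalue_seq (\<omega> * \<tau>) n)))" (is ?ev2)
proof -
  define s where "s = sinc_eigenvalue_seq (\<omega> * \<tau>)"
  have s: "s n \<in> eigenvalues" for n using sinc_eigenvalue_seq_range by (auto simp: s_def)
  have s0: "s n > 0" for n using eigenvalues_bounds[OF s] by blast
  have ev1: "l2_eigenvalue T (complex_of_real (1 + sqrt (s n)))" for n
    by (rule eigenvalue_T_if[OF s]) (use s0[of n] in simp)
  have ev2: "l2_eigenvalue T (complex_of_real (1 - sqrt (s n)))" for n
    using eigenvalue_T_if[OF s, of "- sqrt (s n)" n] s0[of n] by simp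
  show ?ev1 ?ev2 using ev1 ev2 unfolding s_def by blast+
  show "l2_spectrum T = {0, 1} \<union> ?plus \<union> ?minus"
  proof (intro equalityI subsetI)
    fix z assume z: "z \<in> l2_spectrum T"
    show "z \<in> {0, 1} \<union> ?plus \<union> ?minus"
    proof (cases "z = 0 \<or> z = 1")
      case False
      then have "l2_eigenvalue T z" using not_in_spectrum_T z by blast
      then have "compression_eigenvalue \<tau> \<omega> ((z - 1)\<^sup>2)" using eigenvalue_T_only_if False by blast
      then have "(z - 1)\<^sup>2 \<in> complex_of_real ` range s"
        using eigenvalues_image sinc_eigenvalue_seq_range by (auto simp: s_def)
      then obtain n where n: "(z - 1)\<^sup>2 = complex_of_real (s n)" by auto
      have "(complex_of_real (sqrt (s n)))\<^sup>2 = complex_of_real (s n)"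
        using s0[of n] by (simp flip: of_real_power)
      then have "(z - 1)\<^sup>2 = (complex_of_real (sqrt (s n)))\<^sup>2" using n by simp
      then have "z - 1 = complex_of_real (sqrt (s n)) \<or> z - 1 = - complex_of_real (sqrt (s n))"
        by (simp only: power2_eq_iff)
      then have "z = complex_of_real (1 + sqrt (s n)) \<or> z = complex_of_real (1 - sqrt (s n))"
        by (auto simp: algebra_simps)
      then show ?thesis by (auto simp: s_def)
    qed auto
  next
    fix z assume "z \<in> {0, 1} \<union> ?plus \<union> ?minus"
    then show "z \<in> l2_spectrum T"
      using zero_in_spectrum_T one_in_spectrum_T l2_eigenvalue_in_spectrum[OF bounded_clinear_T] ev1 ev2
      unfolding s_def by blast
  qed
qed

end

theorem mainTheorem3:
  fixes \<tau> \<omega> :: real and T :: "l2 \<Rightarrow> l2"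
  assumes "\<tau> > 0" and "\<omega> > 0"
    and "T = (\<lambda>f. time_limit \<tau> f + band_limit \<omega> f)"
  shows "l2_spectrum T =
      {0, 1}
      \<union> {complex_of_real (1 + sqrt (sinc_eigenvalue_seq (\<omega> * \<tau>) n)) | n. True}
      \<union> {complex_of_real (1 - sqrt (sinc_eigenvalue_seq (\<omega> * \<tau>) n)) | n. True}
    \<and> (\<forall>n. l2_eigenvalue T (complex_of_real (1 + sqrt (sinc_eigenvalue_seq (\<omega> * \<tau>) n)))
         \<and> l2_eigenvalue T (complex_of_real (1 - sqrt (sinc_eigenvalue_seq (\<omega> * \<tau>) n))))"
proof -
  interpret time_band \<tau> \<omega> using assms(1,2) by unfold_locales
  have "T = time_band.T \<tau> \<omega>" unfolding assms(3) by (rule ext) (simp add: T_def)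
  then show ?thesis using spectrum_T by simp
qed

end
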